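(* Let $\mathcal D=\{a_1,a_2,a_3\}\subset\mathbb{CP}^1$ be any three distinct points. Let $\chi:\pi_1(\mathbb{CP}^1\setminus\mathcal D)\to GL(2,\mathbb C)$ be a reducible indecomposable representation which is diagonalizable at least at one of the points, i.e. in some basis all the monodromy matrices $G_1,G_2,G_3$ are upper triangular and at least one of them is diagonal. Then $\chi$ is realized by the monodromy of a Riemann equation with singular points $a_1,a_2,a_3$.
   Context: A Riemann equation with singular points $\mathcal D=\{a_1,a_2,a_3\}$ is a second order linear differential equation $y''+b_1(z)y'+b_2(z)y=0$ on the Riemann sphere whose coefficients are holomorphic outside $\mathcal D$ (with every point of $\mathbb{CP}^1\setminus\mathcal D$, including $\infty$ in the local coordinate $1/z$ if $\infty\notin\mathcal D$, being an ordinary point) and which is Fuchsian at each $a_i$: in a local coordinate $t$ centred at $a_i$, the coefficient of the $(2-j)$-th derivative has a pole of order at most $j$, $j=1,2$. Monodromy: continuing a basis (row) $Y$ of the two-dimensional solution space near a base point along a loop $\gamma$ in $\mathbb{CP}^1\setminus\mathcal D$ gives another basis $Y^*$ with $Y=Y^*G_\gamma$, $G_\gamma\in GL(2,\mathbb C)$. The matrix depends only on the homotopy class of $\gamma$, and $[\gamma]\mapsto G_\gamma$ is the monodromy representation, defined up to simultaneous conjugation (choice of basis). An equation realizes $\chi$ if $\chi$ is its monodromy representation in some basis of solutions. The group $\pi_1(\mathbb{CP}^1\setminus\mathcal D)$ is generated by loops around $a_1,a_2,a_3$ whose product is trivial; $G_i$ denotes the matrix corresponding to the loop around $a_i$. Indecomposable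 means not a direct sum of two one-dimensional representations. *)

theory Defs
  imports "HOL-Complex_Analysis.Complex_Analysis" "HOL-Algebra.Generated_Groups"
begin

section \<open>The Riemann sphere\<close>

datatype cp1 = CFin complex | CInf

definition chart_inf :: "complex \<Rightarrow> cp1" where
  "chart_inf w = (if w = 0 then CInf else CFin (inverse w))"

text \<open>The topology glued from the two charts \<open>CFin\<close> (coordinate \<open>z\<close>) and \<open>chart_inf\<close>
  (coordinate \<open>w = 1/z\<close>).\<close>

instantiation cp1 :: topological_space
begin

definition open_cp1 :: "cp1 set \<Rightarrow> bool" where
  "open_cp1 U \<longleftrightarrow> open (CFin -` U) \<and> open (chart_inf -` U)"

instance
proof
  show "open (UNIV :: cp1 set)"
    by (simp add: open_cp1_def)
  show "open (S \<inter> T)" if "open S" "open T" for S T :: "cp1 set"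
    using that by (simp add: open_cp1_def open_Int)
  show "open (\<Union> K)" if "\<forall>S\<in>K. open S" for K :: "cp1 set set"
    using that by (auto simp: open_cp1_def vimage_Union)
qed

end

definition cp1_holomorphic_on :: "(cp1 \<Rightarrow> complex) \<Rightarrow> cp1 set \<Rightarrow> bool" where
  "cp1_holomorphic_on f U \<longleftrightarrow>
     (\<lambda>z. f (CFin z)) holomorphic_on (CFin -` U) \<and>
     (\<lambda>w. f (chart_inf w)) holomorphic_on (chart_inf -` U)"

section \<open>The fundamental group\<close>

definition loops :: "'a::topological_space set \<Rightarrow> 'a \<Rightarrow> (real \<Rightarrow> 'a) set" where
  "loops S p = {g. path g \<and> path_image g \<subseteq> S \<and> pathstart g = p \<and> pathfinish g = p}"

definition loop_class :: "'a::topological_space set \<Rightarrow> (real \<Rightarrow> 'a) \<Rightarrow> (real \<Rightarrow> 'a) set" where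
  "loop_class S g = {h. homotopic_paths S g h}"

definition fundamental_group ::
  "'a::topological_space set \<Rightarrow> 'a \<Rightarrow> (real \<Rightarrow> 'a) set monoid" where
  "fundamental_group S p =
     \<lparr> carrier = loop_class S ` loops S p,
       mult = (\<lambda>A B. {h. \<exists>g\<in>A. \<exists>k\<in>B. homotopic_paths S (g +++ k) h}),
       one = loop_class S (\<lambda>_. p) \<rparr>"

lemma loop_class_eq_iff:
  "g \<in> loops S p \<Longrightarrow> loop_class S g = loop_class S h \<longleftrightarrow> homotopic_paths S g h"
  unfolding loop_class_def loops_def
  by (auto dest: homotopic_paths_trans homotopic_paths_sym intro: homotopic_paths_sym)

lemma loops_join: "g \<in> loops S p \<Longrightarrow> h \<in> loops S p \<Longrightarrow> g +++ h \<in> loops S p"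
  by (auto simp: loops_def subset_path_image_join)

lemma loops_const: "p \<in> S \<Longrightarrow> (\<lambda>_. p) \<in> loops S p"
  by (auto simp: loops_def path_def path_image_def pathstart_def pathfinish_def)

lemma loops_reversepath: "g \<in> loops S p \<Longrightarrow> reversepath g \<in> loops S p"
  by (auto simp: loops_def)

lemma loop_class_mult:
  assumes "g \<in> loops S p" "h \<in> loops S p"
  shows "loop_class S g \<otimes>\<^bsub>fundamental_group S p\<^esub> loop_class S h = loop_class S (g +++ h)"
proof -
  have "homotopic_paths S (g +++ h) k"
    if "homotopic_paths S g g'" "homotopic_paths S h h'" "homotopic_paths S (g' +++ h') k" for g' h' k
  proof -
    have "homotopic_paths S (g +++ h) (g' +++ h')"
      using that(1,2) assms by (intro homotopic_paths_join) (auto simp: loops_def)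
    then show ?thesis
      using that(3) homotopic_paths_trans by blast
  qed
  moreover have "homotopic_paths S g g" "homotopic_paths S h h"
    using assms by (auto simp: loops_def)
  ultimately show ?thesis
    unfolding fundamental_group_def loop_class_def by (auto simp del: homotopic_paths_refl)
qed

lemma group_fundamental_group:
  assumes "p \<in> S"
  shows "group (fundamental_group S p)"
proof (rule groupI)
  let ?G = "fundamental_group S p"
  have carr: "carrier ?G = loop_class S ` loops S p" and one: "\<one>\<^bsub>?G\<^esub> = loop_class S (\<lambda>_. p)"
    by (simp_all add: fundamental_group_def)
  show "\<one>\<^bsub>?G\<^esub> \<in> carrier ?G"
    using assms by (simp add: carr one loops_const)
  show "x \<otimes>\<^bsub>?G\<^esub> y \<in> carrier ?G" if "x \<in> carrier ?G" "y \<in> carrier ?G" for x y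
    using that by (auto simp: carr loop_class_mult loops_join)
  show "x \<otimes>\<^bsub>?G\<^esub> y \<otimes>\<^bsub>?G\<^esub> z = x \<otimes>\<^bsub>?G\<^esub> (y \<otimes>\<^bsub>?G\<^esub> z)"
    if xyz: "x \<in> carrier ?G" "y \<in> carrier ?G" "z \<in> carrier ?G" for x y z
  proof -
    obtain f g h where fgh: "f \<in> loops S p" "g \<in> loops S p" "h \<in> loops S p"
      and "x = loop_class S f" "y = loop_class S g" "z = loop_class S h"
      using xyz by (auto simp: carr)
    moreover have "homotopic_paths S ((f +++ g) +++ h) (f +++ (g +++ h))"
      using fgh by (intro homotopic_paths_sym[OF homotopic_paths_assoc]) (auto simp: loops_def)
    ultimately show ?thesis
      by (simp add: loop_class_mult loops_join loop_class_eq_iff[where p = p])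
  qed
  show "\<one>\<^bsub>?G\<^esub> \<otimes>\<^bsub>?G\<^esub> x = x" if x: "x \<in> carrier ?G" for x
  proof -
    obtain g where g: "g \<in> loops S p" and xg: "x = loop_class S g"
      using x by (auto simp: carr)
    have "continuous_on {0..1} (\<lambda>t::real. max 0 (2 * t - 1))"
      by (intro continuous_intros)
    then have "homotopic_paths S g ((\<lambda>_. p) +++ g)"
      using g by (intro homotopic_paths_reparametrize[where f = "\<lambda>t. max 0 (2 * t - 1)"])
        (auto simp: loops_def joinpaths_def pathstart_def)
    then show ?thesis
      using g assms
      by (metis homotopic_paths_sym loop_class_eq_iff loop_class_mult loops_const loops_join one xg)
  qed
  show "\<exists>y\<in>carrier ?G. y \<otimes>\<^bsub>?G\<^esub> x = \<one>\<^bsub>?G\<^esub>" if x: "x \<in> carrier ?G" for x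
  proof -
    obtain g where g: "g \<in> loops S p" and xg: "x = loop_class S g"
      using x by (auto simp: carr)
    have "homotopic_paths S (reversepath g +++ g) (\<lambda>_. p)"
    proof -
      define r where "r = reversepath g"
      have r: "continuous_on {0..1} r" "r 0 = p" "r 1 = p" "r \<in> {0..1} \<rightarrow> S"
        using loops_reversepath[OF g]
        by (auto simp: r_def loops_def path_def path_image_def pathstart_def pathfinish_def)
      let ?A = "{0..1::real} \<times> {0..1::real}"
      let ?m = "\<lambda>y::real\<times>real. (1 - fst y) * min (2 * snd y) (2 - 2 * snd y)"
      have m: "?m ` ?A \<subseteq> {0..1}"
        by (auto intro!: mult_le_one)
      have "continuous_on ?A (\<lambda>y. r (?m y))"
        by (rule continuous_on_compose2[OF r(1) _ m]) (intro continuous_intros)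
      moreover have "(\<lambda>y. r (?m y)) \<in> ?A \<rightarrow> S"
        using m r(4) by (fastforce simp: Pi_iff image_subset_iff)
      moreover have "r (?m (0, t)) = (reversepath g +++ g) t" if "t \<in> {0..1}" for t
        using that by (auto simp: joinpaths_def r_def reversepath_def min_def algebra_simps)
      ultimately show ?thesis
        using g r(2,3)
        by (auto simp: homotopic_paths intro!: exI[of _ "\<lambda>y. r (?m y)"])
           (auto simp: loops_def pathstart_def pathfinish_def joinpaths_def reversepath_def)
    qed
    then have "loop_class S (reversepath g) \<otimes>\<^bsub>?G\<^esub> x = \<one>\<^bsub>?G\<^esub>"
      using g loop_class_eq_iff loop_class_mult loops_join loops_reversepath one xg by metis
    then show ?thesis
      using loops_reversepath[OF g] by (auto simp: carr)
  qed
qed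

section \<open>Generators of the fundamental group of a punctured sphere\<close>

text \<open>The circle of radius \<open>r\<close> around a point in the coordinate \<open>z - c\<close> or \<open>w = 1/z\<close>,
  positively oriented with respect to that coordinate.\<close>

fun circle_at :: "cp1 \<Rightarrow> real \<Rightarrow> real \<Rightarrow> cp1" where
  "circle_at (CFin c) r = CFin \<circ> circlepath c r"
| "circle_at CInf r = chart_inf \<circ> circlepath 0 r"

fun disc_at :: "cp1 \<Rightarrow> real \<Rightarrow> cp1 set" where
  "disc_at (CFin c) r = CFin ` cball c r"
| "disc_at CInf r = chart_inf ` cball 0 r"

definition loop_around :: "cp1 set \<Rightarrow> cp1 \<Rightarrow> cp1 \<Rightarrow> (real \<Rightarrow> cp1) \<Rightarrow> bool" where
  "loop_around D p a g \<longleftrightarrow>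
     (\<exists>r q. r > 0 \<and> disc_at a r \<inter> D = {a} \<and>
        path q \<and> path_image q \<subseteq> - D \<and> pathstart q = p \<and> pathfinish q = pathstart (circle_at a r) \<and>
        homotopic_paths (- D) g (q +++ circle_at a r +++ reversepath q))"

definition standard_generators :: "(3 \<Rightarrow> cp1) \<Rightarrow> cp1 \<Rightarrow> (3 \<Rightarrow> real \<Rightarrow> cp1) \<Rightarrow> bool" where
  "standard_generators a p g \<longleftrightarrow>
     (let S = - range a; G = fundamental_group S p; c = (\<lambda>i. loop_class S (g i)) in
        (\<forall>i. g i \<in> loops S p \<and> loop_around (range a) p (a i) (g i)) \<and>
        generate G (range c) = carrier G \<and>
        c 1 \<otimes>\<^bsub>G\<^esub> c 2 \<otimes>\<^bsub>G\<^esub> c 3 = \<one>\<^bsub>G\<^esub>)"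

section \<open>Two-dimensional representations\<close>

definition GL :: "('a::field^'n^'n) monoid" where
  "GL = \<lparr> carrier = {A. invertible A}, mult = (**), one = mat 1 \<rparr>"

definition invariant_subspace ::
  "('g, 'b) monoid_scheme \<Rightarrow> ('g \<Rightarrow> complex^2^2) \<Rightarrow> (complex^2) set \<Rightarrow> bool" where
  "invariant_subspace G \<rho> V \<longleftrightarrow>
     vec.subspace V \<and> (\<forall>g\<in>carrier G. \<forall>v\<in>V. \<rho> g *v v \<in> V)"

definition reducible :: "('g, 'b) monoid_scheme \<Rightarrow> ('g \<Rightarrow> complex^2^2) \<Rightarrow> bool" where
  "reducible G \<rho> \<longleftrightarrow> (\<exists>V. invariant_subspace G \<rho> V \<and> V \<noteq> {0} \<and> V \<noteq> UNIV)"

definition indecomposable :: "('g, 'b) monoid_scheme \<Rightarrow> ('g \<Rightarrow> complex^2^2) \<Rightarrow> bool" where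
  "indecomposable G \<rho> \<longleftrightarrow>
     \<not> (\<exists>V W. invariant_subspace G \<rho> V \<and> invariant_subspace G \<rho> W \<and>
           vec.dim V = 1 \<and> vec.dim W = 1 \<and>
           V \<inter> W = {0} \<and> {v + w | v w. v \<in> V \<and> w \<in> W} = UNIV)"

definition upper_triangular :: "complex^2^2 \<Rightarrow> bool" where
  "upper_triangular A \<longleftrightarrow> A $ 2 $ 1 = 0"

definition diagonal :: "complex^2^2 \<Rightarrow> bool" where
  "diagonal A \<longleftrightarrow> A $ 1 $ 2 = 0 \<and> A $ 2 $ 1 = 0"

section \<open>Riemann equations\<close>

definition pole_order_le :: "nat \<Rightarrow> (complex \<Rightarrow> complex) \<Rightarrow> complex \<Rightarrow> bool" where
  "pole_order_le k f c \<longleftrightarrow>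
     (\<exists>h. h analytic_on {c} \<and> (\<forall>\<^sub>F z in at c. f z = h z / (z - c) ^ k))"

text \<open>Under \<open>w = 1/z\<close> one has \<open>dy/dz = - w\<^sup>2 dy/dw\<close> and
  \<open>d\<^sup>2y/dz\<^sup>2 = w\<^sup>4 d\<^sup>2y/dw\<^sup>2 + 2 w\<^sup>3 dy/dw\<close>, so \<open>y'' + b1 y' + b2 y = 0\<close> becomes the equation in \<open>w\<close>
  with the following coefficients.\<close>

definition coeff1_inf :: "(complex \<Rightarrow> complex) \<Rightarrow> complex \<Rightarrow> complex" where
  "coeff1_inf b1 w = 2 / w - b1 (1 / w) / w ^ 2"

definition coeff2_inf :: "(complex \<Rightarrow> complex) \<Rightarrow> complex \<Rightarrow> complex" where
  "coeff2_inf b2 w = b2 (1 / w) / w ^ 4"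

text \<open>At \<open>CInf\<close> an ordinary point is one where both coefficients have a removable singularity,
  since their formulas give no meaningful value at \<open>w = 0\<close>.\<close>

fun ordinary_point :: "(complex \<Rightarrow> complex) \<Rightarrow> (complex \<Rightarrow> complex) \<Rightarrow> cp1 \<Rightarrow> bool" where
  "ordinary_point b1 b2 (CFin c) \<longleftrightarrow> b1 analytic_on {c} \<and> b2 analytic_on {c}"
| "ordinary_point b1 b2 CInf \<longleftrightarrow>
     pole_order_le 0 (coeff1_inf b1) 0 \<and> pole_order_le 0 (coeff2_inf b2) 0"

fun fuchsian_point :: "(complex \<Rightarrow> complex) \<Rightarrow> (complex \<Rightarrow> complex) \<Rightarrow> cp1 \<Rightarrow> bool" where
  "fuchsian_point b1 b2 (CFin c) \<longleftrightarrow> pole_order_le 1 b1 c \<and> pole_order_le 2 b2 c"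
| "fuchsian_point b1 b2 CInf \<longleftrightarrow>
     pole_order_le 1 (coeff1_inf b1) 0 \<and> pole_order_le 2 (coeff2_inf b2) 0"

definition riemann_equation ::
  "cp1 set \<Rightarrow> (complex \<Rightarrow> complex) \<Rightarrow> (complex \<Rightarrow> complex) \<Rightarrow> bool" where
  "riemann_equation D b1 b2 \<longleftrightarrow>
     card D = 3 \<and> (\<forall>x\<in>- D. ordinary_point b1 b2 x) \<and> (\<forall>x\<in>D. fuchsian_point b1 b2 x)"

section \<open>Monodromy\<close>

text \<open>For \<open>p = CInf\<close> the equation is imposed at the finite points near \<open>p\<close>; since \<open>y\<close> is
  holomorphic at \<open>p\<close>, at an ordinary point \<open>p\<close> the equation in the coordinate \<open>w\<close> then also
  holds at \<open>w = 0\<close> by continuity.\<close>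

definition local_solution ::
  "(complex \<Rightarrow> complex) \<Rightarrow> (complex \<Rightarrow> complex) \<Rightarrow> cp1 \<Rightarrow> (cp1 \<Rightarrow> complex) \<Rightarrow> bool" where
  "local_solution b1 b2 p y \<longleftrightarrow>
     (\<exists>U. open U \<and> p \<in> U \<and> cp1_holomorphic_on y U \<and>
        (let f = (\<lambda>z. y (CFin z)) in
           \<forall>z. CFin z \<in> U \<longrightarrow> deriv (deriv f) z + b1 z * deriv f z + b2 z * f z = 0))"

text \<open>A basis, written as a row, of the space of germs of solutions at \<open>p\<close>.\<close>

definition solution_basis ::
  "(complex \<Rightarrow> complex) \<Rightarrow> (complex \<Rightarrow> complex) \<Rightarrow> cp1 \<Rightarrow> (cp1 \<Rightarrow> complex^2) \<Rightarrow> bool" where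
  "solution_basis b1 b2 p Y \<longleftrightarrow>
     (\<forall>j. local_solution b1 b2 p (\<lambda>x. Y x $ j)) \<and>
     (\<forall>c::complex^2. (\<forall>\<^sub>F x in nhds p. (\<Sum>j\<in>UNIV. c $ j * Y x $ j) = 0) \<longrightarrow> c = 0) \<and>
     (\<forall>y. local_solution b1 b2 p y \<longrightarrow>
        (\<exists>c::complex^2. \<forall>\<^sub>F x in nhds p. y x = (\<Sum>j\<in>UNIV. c $ j * Y x $ j)))"

text \<open>Analytic continuation of the germ of \<open>Y\<close> at the start of \<open>g\<close> to the germ of \<open>Y'\<close> at its end:
  \<open>F t\<close> represents the germ at \<open>g t\<close>.\<close>

definition continuation_along ::
  "(real \<Rightarrow> cp1) \<Rightarrow> (cp1 \<Rightarrow> complex^2) \<Rightarrow> (cp1 \<Rightarrow> complex^2) \<Rightarrow> bool" where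
  "continuation_along g Y Y' \<longleftrightarrow>
     (\<exists>F :: real \<Rightarrow> cp1 \<Rightarrow> complex^2.
        (\<forall>\<^sub>F x in nhds (pathstart g). F 0 x = Y x) \<and>
        (\<forall>\<^sub>F x in nhds (pathfinish g). F 1 x = Y' x) \<and>
        (\<forall>t\<in>{0..1}. \<exists>U. open U \<and> g t \<in> U \<and> (\<forall>j. cp1_holomorphic_on (\<lambda>x. F t x $ j) U) \<and>
           (\<exists>e>0. \<forall>s\<in>{0..1}. \<bar>s - t\<bar> < e \<longrightarrow>
              g s \<in> U \<and> (\<forall>\<^sub>F x in nhds (g s). F s x = F t x))))"

definition monodromy_matrix ::
  "(cp1 \<Rightarrow> complex^2) \<Rightarrow> (real \<Rightarrow> cp1) \<Rightarrow> complex^2^2 \<Rightarrow> bool" where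
  "monodromy_matrix Y g G \<longleftrightarrow>
     (\<exists>Y'. continuation_along g Y Y' \<and> (\<forall>\<^sub>F x in nhds (pathfinish g). Y x = Y' x v* G))"

definition realizes ::
  "cp1 set \<Rightarrow> cp1 \<Rightarrow> (complex \<Rightarrow> complex) \<Rightarrow> (complex \<Rightarrow> complex) \<Rightarrow>
     ((real \<Rightarrow> cp1) set \<Rightarrow> complex^2^2) \<Rightarrow> bool" where
  "realizes D p b1 b2 \<rho> \<longleftrightarrow>
     (\<exists>Y. solution_basis b1 b2 p Y \<and>
        (\<forall>g\<in>loops (- D) p. monodromy_matrix Y g (\<rho> (loop_class (- D) g))))"

end

theory Submission
  imports Defs
begin

text \<open>
  Let \<open>t\<close> be the Moebius coordinate sending \<open>a1, a2, a3\<close> to \<open>0, 1, \<infinity>\<close>. The functions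
  \<open>y = t\<^bsup>\<alpha>0\<^esup> (t - 1)\<^bsup>\<alpha>1\<^esup>\<close> and \<open>y f\<close> with \<open>f' = t\<^bsup>\<beta>0\<^esup> (t - 1)\<^bsup>\<beta>1\<^esup>\<close> span the solutions of a Riemann
  equation with triangular monodromy whose diagonal at \<open>a1, a2\<close> is prescribed by the exponents
  modulo integers. Since \<open>\<gamma> 3\<close> is determined by \<open>\<gamma> 1\<close> and \<open>\<gamma> 2\<close>, it remains to match the off-diagonal entries
  of two matrices up to conjugation by \<open>[[1, s], [0, k]]\<close>.
  If some generator has distinct eigenvalues, then at least two have, and after a cyclic
  relabelling these are the first two; two triangular pairs with this diagonal are conjugate unless
  one of them is diagonalizable. If the monodromy of \<open>(y, y f)\<close> were, then some \<open>f - s\<close> would be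
  multiplicative and would vanish at both 0 and 1, so that the beta integral of
  \<open>t\<^bsup>\<beta>0\<^esup> (1 - t)\<^bsup>\<beta>1\<^esup>\<close> would be zero; by the Weierstrass theorem this fails for some integer shift of \<open>\<beta>0\<close>.
  If all the generators have a double eigenvalue and one of them, say the second, is scalar, then \<open>f = log t\<close> works.
\<close>

text \<open>Solutions are not continued directly. A path in the t-plane is lifted to triples of
  values of log t, log (t - 1) and f, and a loop acts on such a triple by shifting the logarithms
  and by an affine map f -> B f + F. The factor B depends only on the two shifts and the exponents;
  F depends on the loop as a whole and is never computed in general. What matters is only whether
  all these affine maps share a fixed point s. The fixed point belonging to one circle about 0, or
  about 1, is read off from the primitive that is a complex power times a power series at the
  centre, and the two are compared at 1/2. The matrices determine the exponents only modulo
  integers. This freedom is used twice: real parts are made positive, so that both primitives and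
  the integral converge, and then one exponent is shifted once more to get a nonzero integral. Any
  of the three points may be infinity, so the formulas on the sphere are written in homogeneous
  coordinates.\<close>

lemma unit_interval_chain:
  fixes Q :: "real \<Rightarrow> bool"
  assumes "\<delta> > 0"
    and step: "\<And>s s'. s \<in> {0..1} \<Longrightarrow> s' \<in> {0..1} \<Longrightarrow> \<bar>s - s'\<bar> < \<delta> \<Longrightarrow> Q s \<Longrightarrow> Q s'"
    and "Q 0"
  shows "Q 1"
proof -
  \<comment> \<open>A grid of mesh 1 / (n + 1) below \<open>\<delta>\<close>: since the step size is
    uniform, finitely many moves lead from 0 to 1. Later \<open>Q s\<close> says that row
    \<open>s\<close> of a homotopy has a suitable lift.\<close>
  obtain n :: nat where n: "1 / real (Suc n) < \<delta>"
    using \<open>\<delta> > 0\<close> nat_approx_posE by blast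
  have "k \<le> Suc n \<Longrightarrow> Q (real k / real (Suc n))" for k
  proof (induction k)
    case 0
    then show ?case using \<open>Q 0\<close> by simp
  next
    case (Suc k)
    have N: "real (Suc n) > 0" by simp
    have "real (Suc k) / real (Suc n) = real k / real (Suc n) + 1 / real (Suc n)"
      by (simp add: add_divide_distrib)
    then have "\<bar>real k / real (Suc n) - real (Suc k) / real (Suc n)\<bar> < \<delta>"
      using n N by simp
    moreover have "j \<le> Suc n \<Longrightarrow> real j / real (Suc n) \<in> {0..1}" for j
      by simp
    ultimately show ?case
      using Suc.IH Suc.prems step Suc_leD by blast
  qed
  from this[of "Suc n"] show ?thesis by simp
qed

lemma continuous_near:
  fixes g :: "real \<Rightarrow> complex"
  assumes "continuous_on {0..1} g" "t \<in> {0..1}" "open V" "g t \<in> V"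
  obtains e where "e > 0" "\<And>s. s \<in> {0..1} \<Longrightarrow> \<bar>s - t\<bar> < e \<Longrightarrow> g s \<in> V"
proof -
  obtain \<eta> where \<eta>: "\<eta> > 0" "ball (g t) \<eta> \<subseteq> V"
    using assms open_contains_ball by blast
  then obtain e where "e > 0" "\<And>s. s \<in> {0..1} \<Longrightarrow> dist s t < e \<Longrightarrow> dist (g s) (g t) < \<eta>"
    using assms(1,2) unfolding continuous_on_iff by blast
  then show thesis
    using that[of e] \<eta>(2) by (auto simp: dist_real_def subset_iff dist_commute)
qed

section \<open>Lifting paths to a sheaf of sections\<close>

text \<open>Stands for the etale space of a sheaf without constructing that space:
  \<open>fib x\<close> holds the possible values over \<open>x\<close>, and
  \<open>sec U \<Psi>\<close> says that \<open>\<Psi>\<close> is a section on \<open>U\<close>. By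
  \<open>sec_exists\<close> a section exists on every disc inside \<open>S\<close>, whatever its
  radius; this uniformity carries the lifting of homotopies.\<close>

locale germ_system =
  fixes S :: "complex set"
    and sec :: "complex set \<Rightarrow> (complex \<Rightarrow> 'b::topological_space) \<Rightarrow> bool"
    and fib :: "complex \<Rightarrow> 'b set"
  assumes open_S: "open S"
    and sec_open: "sec U \<Psi> \<Longrightarrow> open U"
    and sec_fib: "sec U \<Psi> \<Longrightarrow> x \<in> U \<Longrightarrow> \<Psi> x \<in> fib x"
    and sec_unique: "\<lbrakk>sec U \<Psi>; sec V \<Psi>'; open W; convex W; W \<subseteq> U \<inter> V; x \<in> W; \<Psi> x = \<Psi>' x; y \<in> W\<rbrakk>
        \<Longrightarrow> \<Psi> y = \<Psi>' y"
    and sec_exists: "\<lbrakk>v \<in> fib c; e > 0; ball c e \<subseteq> S\<rbrakk> \<Longrightarrow> \<exists>\<Psi>. sec (ball c e) \<Psi> \<and> \<Psi> c = v"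
begin

text \<open>Continuity of \<open>m\<close> is expressed without a topology on the fibres: near each
  time the values follow one section along \<open>g\<close>.\<close>

definition lift :: "(real \<Rightarrow> complex) \<Rightarrow> (real \<Rightarrow> 'b) \<Rightarrow> bool" where
  "lift g m \<longleftrightarrow> (\<forall>t\<in>{0..1}. \<exists>U \<Psi>. sec U \<Psi> \<and> g t \<in> U \<and>
     (\<exists>e>0. \<forall>s\<in>{0..1}. \<bar>s - t\<bar> < e \<longrightarrow> g s \<in> U \<and> m s = \<Psi> (g s)))"

lemma liftE:
  assumes "lift g m" "t \<in> {0..1}"
  obtains U \<Psi> e where "sec U \<Psi>" "g t \<in> U" "e > 0" "m t = \<Psi> (g t)"
    "\<forall>s\<in>{0..1}. \<bar>s - t\<bar> < e \<longrightarrow> g s \<in> U \<and> m s = \<Psi> (g s)"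
proof -
  obtain U \<Psi> e where "sec U \<Psi>" "g t \<in> U" "e > 0"
    and *: "\<forall>s\<in>{0..1}. \<bar>s - t\<bar> < e \<longrightarrow> g s \<in> U \<and> m s = \<Psi> (g s)"
    using assms unfolding lift_def by blast
  moreover have "m t = \<Psi> (g t)"
    using * assms(2) \<open>e > 0\<close> by simp
  ultimately show thesis using that by blast
qed

lemma lift_fib: "lift g m \<Longrightarrow> t \<in> {0..1} \<Longrightarrow> m t \<in> fib (g t)"
  by (erule (1) liftE) (simp add: sec_fib)

lemma sec_eq_ball:
  assumes "sec U \<Psi>" "sec V \<Psi>'" "c \<in> U" "c \<in> V"
  obtains \<eta> where "\<eta> > 0" "ball c \<eta> \<subseteq> U \<inter> V"
    "\<forall>x\<in>ball c \<eta>. \<forall>y\<in>ball c \<eta>. \<Psi> x = \<Psi>' x \<longrightarrow> \<Psi> y = \<Psi>' y"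
proof -
  have "open (U \<inter> V)" using assms sec_open by blast
  then obtain \<eta> where "\<eta> > 0" and \<eta>: "ball c \<eta> \<subseteq> U \<inter> V"
    using assms open_contains_ball by blast
  then show thesis
    using that sec_unique[OF assms(1,2) open_ball convex_ball \<eta>] by blast
qed

text \<open>Two sections that agree at one point of a small disc agree on all of it. So agreement of
  the two lifts is a locally constant property of the time.\<close>

lemma lift_unique:
  assumes g: "continuous_on {0..1} g" and m: "lift g m" "lift g m'" and "m 0 = m' 0"
    and t: "t \<in> {0..1}"
  shows "m t = m' t"
proof -
  have loc: "\<exists>e>0. \<forall>s\<in>{0..1}. \<bar>s - t\<bar> < e \<longrightarrow> (m s = m' s \<longleftrightarrow> m t = m' t)" if t: "t \<in> {0..1}" for t
  proof -
    obtain U \<Psi> e where U: "sec U \<Psi>" "g t \<in> U" "e > 0" "m t = \<Psi> (g t)"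
      "\<forall>s\<in>{0..1}. \<bar>s - t\<bar> < e \<longrightarrow> g s \<in> U \<and> m s = \<Psi> (g s)"
      using liftE[OF m(1) t] by blast
    obtain V \<Psi>' e' where V: "sec V \<Psi>'" "g t \<in> V" "e' > 0" "m' t = \<Psi>' (g t)"
      "\<forall>s\<in>{0..1}. \<bar>s - t\<bar> < e' \<longrightarrow> g s \<in> V \<and> m' s = \<Psi>' (g s)"
      using liftE[OF m(2) t] by blast
    obtain \<eta> where \<eta>: "\<eta> > 0" "ball (g t) \<eta> \<subseteq> U \<inter> V"
      "\<forall>x\<in>ball (g t) \<eta>. \<forall>y\<in>ball (g t) \<eta>. \<Psi> x = \<Psi>' x \<longrightarrow> \<Psi> y = \<Psi>' y"
      using sec_eq_ball[OF U(1) V(1) U(2) V(2)] by blast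
    obtain e'' where e'': "e'' > 0" "\<And>s. s \<in> {0..1} \<Longrightarrow> \<bar>s - t\<bar> < e'' \<Longrightarrow> g s \<in> ball (g t) \<eta>"
      using continuous_near[OF g t open_ball[of "g t" \<eta>]] \<eta>(1) by auto
    have "m s = m' s \<longleftrightarrow> m t = m' t" if "s \<in> {0..1}" "\<bar>s - t\<bar> < min e (min e' e'')" for s
      using that U(4) V(4) U(5)[rule_format, of s] V(5)[rule_format, of s] e''(2)[of s] \<eta>(1) \<eta>(3)[rule_format, of "g s" "g t"] \<eta>(3)[rule_format, of "g t" "g s"]
      by auto
    then show ?thesis
      using U(3) V(3) e''(1) by (intro exI[of _ "min e (min e' e'')"]) auto
  qed
  \<comment> \<open>Agreement as a real function with values 0 and 1, to which the constancy of
    continuous functions with finite range applies.\<close>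
  define Z where "Z = (\<lambda>t. if m t = m' t then 0 else 1 :: real)"
  have "continuous_on {0..1} Z"
    unfolding continuous_on_iff
  proof (intro ballI allI impI)
    fix x \<epsilon> :: real
    assume x: "x \<in> {0..1}" and "\<epsilon> > 0"
    obtain e where "e > 0" "\<And>s. s \<in> {0..1} \<Longrightarrow> \<bar>s - x\<bar> < e \<Longrightarrow> (m s = m' s \<longleftrightarrow> m x = m' x)"
      using loc[OF x] by blast
    then show "\<exists>d>0. \<forall>x'\<in>{0..1}. dist x' x < d \<longrightarrow> dist (Z x') (Z x) < \<epsilon>"
      using \<open>\<epsilon> > 0\<close> by (intro exI[of _ e]) (auto simp: Z_def dist_real_def)
  qed
  moreover have "finite (Z ` {0..1})"
    by (rule finite_subset[of _ "{0,1}"]) (auto simp: Z_def)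
  ultimately have "Z constant_on {0..1}"
    by (intro continuous_finite_range_constant) auto
  then have "Z t = Z 0"
    using t unfolding constant_on_def by force
  then show ?thesis
    using assms(4) by (auto simp: Z_def split: if_splits)
qed

text \<open>A step below \<open>\<delta>\<close> moves every point of a row by less than a common
  radius \<open>e\<close> for which all discs about the image lie in \<open>S\<close>. The value
  \<open>m t\<close> is carried from \<open>h (s, t)\<close> to \<open>h (s', t)\<close> by the
  section on the disc about \<open>h (s, t)\<close>. The last clause keeps the value wherever the
  two rows meet, in particular at fixed ends.\<close>

lemma lift_row:
  assumes h: "continuous_on ({0..1} \<times> {0..1}) h" and hS: "h ` ({0..1} \<times> {0..1}) \<subseteq> S"
  obtains \<delta> :: real where "\<delta> > 0"
    "\<forall>s\<in>{0..1}. \<forall>s'\<in>{0..1}. \<forall>m. \<bar>s - s'\<bar> < \<delta> \<longrightarrow> lift (\<lambda>t. h (s, t)) m \<longrightarrow>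
       (\<exists>m'. lift (\<lambda>t. h (s', t)) m' \<and> (\<forall>t\<in>{0..1}. h (s', t) = h (s, t) \<longrightarrow> m' t = m t))"
proof -
  let ?K = "h ` ({0..1} \<times> {0..1})"
  have "compact ?K"
    by (intro compact_continuous_image h compact_Times compact_Icc)
  then obtain e where e: "e > 0" "(\<Union>c\<in>?K. ball c e) \<subseteq> S"
    using compact_subset_open_imp_ball_epsilon_subset[OF _ open_S hS] by blast
  have "uniformly_continuous_on ({0..1} \<times> {0..1}) h"
    by (intro compact_uniformly_continuous h compact_Times compact_Icc)
  then obtain \<delta> where \<delta>: "\<delta> > 0"
    "\<forall>x\<in>{0..1} \<times> {0..1}. \<forall>y\<in>{0..1} \<times> {0..1}. dist y x < \<delta> \<longrightarrow> dist (h y) (h x) < e"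
    using e(1) unfolding uniformly_continuous_on_def by blast
  have row: "continuous_on {0..1} (\<lambda>t. h (s, t))" if "s \<in> {0..1}" for s
    by (rule continuous_on_compose2[OF h]) (use that in \<open>auto intro!: continuous_intros\<close>)
  show thesis
  proof (rule that[OF \<delta>(1)], intro ballI allI impI)
    fix s s' :: real and m
    assume s: "s \<in> {0..1}" "s' \<in> {0..1}" "\<bar>s - s'\<bar> < \<delta>" and m: "lift (\<lambda>t. h (s, t)) m"
    have "\<forall>t\<in>{0..1}. \<exists>\<Psi>. sec (ball (h (s, t)) e) \<Psi> \<and> \<Psi> (h (s, t)) = m t"
    proof
      fix t :: real
      assume t: "t \<in> {0..1}"
      then have "ball (h (s, t)) e \<subseteq> S" using e(2) s(1) by blast
      then show "\<exists>\<Psi>. sec (ball (h (s, t)) e) \<Psi> \<and> \<Psi> (h (s, t)) = m t"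
        using e(1) lift_fib[OF m t] by (intro sec_exists)
    qed
    from bchoice[OF this] obtain P where P: "\<And>t. t \<in> {0..1} \<Longrightarrow> sec (ball (h (s, t)) e) (P t)"
      "\<And>t. t \<in> {0..1} \<Longrightarrow> P t (h (s, t)) = m t"
      by blast
    have close: "h (s', t) \<in> ball (h (s, t)) e" if "t \<in> {0..1}" for t
      using \<delta>(2)[rule_format, of "(s, t)" "(s', t)"] that s
      by (auto simp: dist_Pair_Pair dist_real_def dist_commute abs_minus_commute)
    have "lift (\<lambda>t. h (s', t)) (\<lambda>t. P t (h (s', t)))"
      unfolding lift_def
    proof
      fix t :: real
      assume t: "t \<in> {0..1}"
      obtain U \<Psi> e1 where U: "sec U \<Psi>" "h (s, t) \<in> U" "e1 > 0" "m t = \<Psi> (h (s, t))"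
        "\<forall>r\<in>{0..1}. \<bar>r - t\<bar> < e1 \<longrightarrow> h (s, r) \<in> U \<and> m r = \<Psi> (h (s, r))"
        using liftE[OF m t] by blast
      have ht: "h (s, t) \<in> ball (h (s, t)) e" using e by simp
      obtain \<eta> where \<eta>: "\<eta> > 0" "ball (h (s, t)) \<eta> \<subseteq> U \<inter> ball (h (s, t)) e"
        "\<forall>x\<in>ball (h (s, t)) \<eta>. \<forall>y\<in>ball (h (s, t)) \<eta>. \<Psi> x = P t x \<longrightarrow> \<Psi> y = P t y"
        using sec_eq_ball[OF U(1) P(1)[OF t] U(2) ht] by blast
      obtain e2 where e2: "e2 > 0" "\<And>r. r \<in> {0..1} \<Longrightarrow> \<bar>r - t\<bar> < e2 \<Longrightarrow> h (s, r) \<in> ball (h (s, t)) \<eta>"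
        using continuous_near[OF row[OF s(1)] t open_ball[of "h (s, t)" \<eta>]] \<eta>(1) by auto
      obtain e3 where e3: "e3 > 0" "\<And>r. r \<in> {0..1} \<Longrightarrow> \<bar>r - t\<bar> < e3 \<Longrightarrow> h (s', r) \<in> ball (h (s, t)) e"
        using continuous_near[OF row[OF s(2)] t open_ball[of "h (s, t)" e]] close[OF t] by auto
      \<comment> \<open>The sections chosen for \<open>r\<close> and for \<open>t\<close> both take
        the value \<open>m r\<close> at \<open>h (s, r)\<close>. The two discs meet in a convex set,
        so the sections also agree at \<open>h (s', r)\<close>.\<close>
      have "P r (h (s', r)) = P t (h (s', r))" if r: "r \<in> {0..1}" "\<bar>r - t\<bar> < min e1 (min e2 e3)" for r
      proof -
        have "m r = P t (h (s, r))"
          using U(5)[rule_format, of r] r e2(2)[of r] \<eta>(1) \<eta>(3)[rule_format, of "h (s, t)" "h (s, r)"] P(2)[OF t] U(4) by auto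
        moreover have "h (s, r) \<in> ball (h (s, r)) e \<inter> ball (h (s, t)) e"
          using e2(2)[of r] r \<eta>(2) e(1) by auto
        moreover have "h (s', r) \<in> ball (h (s, r)) e \<inter> ball (h (s, t)) e"
          using e3(2)[of r] r close[OF r(1)] by auto
        ultimately show ?thesis
          using P(2)[OF r(1)] sec_unique[OF P(1)[OF r(1)] P(1)[OF t] _ _ order_refl, of "h (s, r)" "h (s', r)"]
          by (simp add: convex_Int open_Int)
      qed
      then show "\<exists>U \<Psi>. sec U \<Psi> \<and> h (s', t) \<in> U \<and>
          (\<exists>e>0. \<forall>r\<in>{0..1}. \<bar>r - t\<bar> < e \<longrightarrow> h (s', r) \<in> U \<and> P r (h (s', r)) = \<Psi> (h (s', r)))"
        using P(1)[OF t] close[OF t] U(3) e2(1) e3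
        by (intro exI[of _ "ball (h (s, t)) e"] exI[of _ "P t"] conjI exI[of _ "min e1 (min e2 e3)"]) auto
    qed
    then show "\<exists>m'. lift (\<lambda>t. h (s', t)) m' \<and> (\<forall>t\<in>{0..1}. h (s', t) = h (s, t) \<longrightarrow> m' t = m t)"
      using P(2) by (intro exI[of _ "\<lambda>t. P t (h (s', t))"]) auto
  qed
qed

lemma lift_const:
  assumes "c \<in> S" "v \<in> fib c"
  shows "lift (\<lambda>_. c) (\<lambda>_. v)"
proof -
  obtain e where "e > 0" "ball c e \<subseteq> S"
    using open_S assms open_contains_ball by blast
  then obtain \<Psi> where "sec (ball c e) \<Psi>" "\<Psi> c = v"
    using sec_exists assms by blast
  then show ?thesis
    using \<open>e > 0\<close> unfolding lift_def by (metis centre_in_ball)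
qed

text \<open>Apply \<open>lift_row\<close> to the contraction \<open>g (s * t)\<close>: row 0 is
  constant and lifted by \<open>lift_const\<close>, row 1 is \<open>g\<close>, and all rows start at
  \<open>g 0\<close>, which preserves the initial value \<open>v\<close>.\<close>

lemma lift_exists:
  assumes "path g" "path_image g \<subseteq> S" "v \<in> fib (pathstart g)"
  obtains m where "lift g m" "m 0 = v"
proof -
  let ?h = "\<lambda>y::real\<times>real. g (fst y * snd y)"
  have *: "(\<lambda>y::real\<times>real. fst y * snd y) ` ({0..1} \<times> {0..1}) \<subseteq> {0..1}"
    by (auto intro: mult_le_one)
  have h: "continuous_on ({0..1} \<times> {0..1}) ?h"
    by (rule continuous_on_compose2[OF _ _ *]) (use assms(1) in \<open>auto simp: path_def intro!: continuous_intros\<close>)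
  have hS: "?h ` ({0..1} \<times> {0..1}) \<subseteq> S"
    using * assms(2) unfolding path_image_def by blast
  obtain \<delta> :: real where \<delta>: "\<delta> > 0"
    "\<forall>s\<in>{0..1}. \<forall>s'\<in>{0..1}. \<forall>m. \<bar>s - s'\<bar> < \<delta> \<longrightarrow> lift (\<lambda>t. ?h (s, t)) m \<longrightarrow>
       (\<exists>m'. lift (\<lambda>t. ?h (s', t)) m' \<and> (\<forall>t\<in>{0..1}. ?h (s', t) = ?h (s, t) \<longrightarrow> m' t = m t))"
    using lift_row[OF h hS] by blast
  have "\<exists>m. lift (\<lambda>t. ?h (1, t)) m \<and> m 0 = v"
  proof (rule unit_interval_chain[OF \<delta>(1)])
    fix s s' :: real
    assume s: "s \<in> {0..1}" "s' \<in> {0..1}" "\<bar>s - s'\<bar> < \<delta>" and "\<exists>m. lift (\<lambda>t. ?h (s, t)) m \<and> m 0 = v"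
    then obtain m where "lift (\<lambda>t. ?h (s, t)) m" "m 0 = v" by blast
    then show "\<exists>m. lift (\<lambda>t. ?h (s', t)) m \<and> m 0 = v"
      using \<delta>(2)[rule_format, OF s] by fastforce
  next
    have "g 0 \<in> S"
      using assms(2) by (auto simp: path_image_def)
    then show "\<exists>m. lift (\<lambda>t. ?h (0, t)) m \<and> m 0 = v"
      using lift_const assms(3) by (auto simp: pathstart_def)
  qed
  then show thesis using that by auto
qed

text \<open>All rows of a path homotopy have the same end points, so the last clause of
  \<open>lift_row\<close> preserves both end values of the lift at each step.\<close>

lemma lift_homotopic:
  assumes gg': "homotopic_paths S g g'" and m: "lift g m"
  obtains m' where "lift g' m'" "m' 0 = m 0" "m' 1 = m 1"
proof -
  obtain h :: "real \<times> real \<Rightarrow> complex" where h: "continuous_on ({0..1} \<times> {0..1}) h" "h ` ({0..1} \<times> {0..1}) \<subseteq> S"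
    and h0: "\<forall>x\<in>{0..1}. h (0, x) = g x" and h1: "\<forall>x\<in>{0..1}. h (1, x) = g' x"
    and ends: "\<forall>s\<in>{0..1}. h (s, 0) = g 0 \<and> h (s, 1) = g 1"
    using gg' unfolding homotopic_paths pathstart_def pathfinish_def image_subset_iff_funcset o_def by blast
  have cong: "lift f m \<longleftrightarrow> lift f' m" if "\<And>t. t \<in> {0..1} \<Longrightarrow> f t = f' t" for f f' m
    unfolding lift_def using that by simp
  obtain \<delta> :: real where \<delta>: "\<delta> > 0"
    "\<forall>s\<in>{0..1}. \<forall>s'\<in>{0..1}. \<forall>m. \<bar>s - s'\<bar> < \<delta> \<longrightarrow> lift (\<lambda>t. h (s, t)) m \<longrightarrow>
       (\<exists>m'. lift (\<lambda>t. h (s', t)) m' \<and> (\<forall>t\<in>{0..1}. h (s', t) = h (s, t) \<longrightarrow> m' t = m t))"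
    using lift_row[OF h] by blast
  have "\<exists>m'. lift (\<lambda>t. h (1, t)) m' \<and> m' 0 = m 0 \<and> m' 1 = m 1"
  proof (rule unit_interval_chain[OF \<delta>(1), where Q = "\<lambda>s. \<exists>m'. lift (\<lambda>t. h (s, t)) m' \<and> m' 0 = m 0 \<and> m' 1 = m 1"])
    fix s s' :: real
    assume s: "s \<in> {0..1}" "s' \<in> {0..1}" "\<bar>s - s'\<bar> < \<delta>"
      and "\<exists>m'. lift (\<lambda>t. h (s, t)) m' \<and> m' 0 = m 0 \<and> m' 1 = m 1"
    then obtain m' where "lift (\<lambda>t. h (s, t)) m'" "m' 0 = m 0" "m' 1 = m 1" by blast
    then obtain m'' where "lift (\<lambda>t. h (s', t)) m''"
      "\<forall>t\<in>{0..1}. h (s', t) = h (s, t) \<longrightarrow> m'' t = m' t"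
      using \<delta>(2)[rule_format, OF s] by blast
    then show "\<exists>m'. lift (\<lambda>t. h (s', t)) m' \<and> m' 0 = m 0 \<and> m' 1 = m 1"
      using ends s \<open>m' 0 = m 0\<close> \<open>m' 1 = m 1\<close> by (intro exI[of _ m'']) auto
  next
    show "\<exists>m'. lift (\<lambda>t. h (0, t)) m' \<and> m' 0 = m 0 \<and> m' 1 = m 1"
      using cong[of "\<lambda>t. h (0, t)" g] h0 m by blast
  qed
  then show thesis
    using that cong[of "\<lambda>t. h (1, t)" g'] h1 by blast
qed

lemma lift_reversepath:
  assumes "lift g m"
  shows "lift (reversepath g) (\<lambda>t. m (1 - t))"
  unfolding lift_def
proof
  fix t :: real
  assume t: "t \<in> {0..1}"
  then have "1 - t \<in> {0..1}" by auto
  from liftE[OF assms this] obtain U \<Psi> e where U: "sec U \<Psi>" "g (1 - t) \<in> U" "e > 0"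
    "m (1 - t) = \<Psi> (g (1 - t))"
    "\<forall>s\<in>{0..1}. \<bar>s - (1 - t)\<bar> < e \<longrightarrow> g s \<in> U \<and> m s = \<Psi> (g s)"
    by blast
  have "g (1 - s) \<in> U \<and> m (1 - s) = \<Psi> (g (1 - s))" if "s \<in> {0..1}" "\<bar>s - t\<bar> < e" for s
    using U(5)[rule_format, of "1 - s"] that by auto
  then show "\<exists>U \<Psi>. sec U \<Psi> \<and> reversepath g t \<in> U \<and>
      (\<exists>e>0. \<forall>s\<in>{0..1}. \<bar>s - t\<bar> < e \<longrightarrow> reversepath g s \<in> U \<and> m (1 - s) = \<Psi> (reversepath g s))"
    using U unfolding reversepath_def by (intro exI[of _ U] exI[of _ \<Psi>] conjI exI[of _ e]) auto
qed

lemma lift_join: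
  assumes cont: "path g" "path g'" and m: "lift g m" "lift g' m'"
    and ends: "pathfinish g = pathstart g'" "m 1 = m' 0"
  shows "lift (g +++ g') (m +++ m')"
  unfolding lift_def
proof
  fix t :: real
  assume t: "t \<in> {0..1}"
  let ?Q = "\<lambda>I. \<exists>U \<Psi>. sec U \<Psi> \<and> (g +++ g') t \<in> U \<and> (\<exists>e>0. \<forall>s\<in>{0..1}. \<bar>s - t\<bar> < e \<longrightarrow> s \<in> I \<longrightarrow>
       (g +++ g') s \<in> U \<and> (m +++ m') s = \<Psi> ((g +++ g') s))"
  have gp: "(g +++ g') s = g' (2 * s - 1)" "(m +++ m') s = m' (2 * s - 1)" if "s \<ge> 1/2" for s
  proof -
    have "2 * s = 1 \<or> \<not> s \<le> 1/2" using that by auto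
    then show "(g +++ g') s = g' (2 * s - 1)" "(m +++ m') s = m' (2 * s - 1)"
      using ends by (auto simp: joinpaths_def pathfinish_def pathstart_def)
  qed
  have left: "?Q {..1/2}" if "t \<le> 1/2"
  proof -
    have "2 * t \<in> {0..1}" using t that by auto
    from liftE[OF m(1) this] obtain U \<Psi> e where U: "sec U \<Psi>" "g (2 * t) \<in> U" "e > 0"
      "m (2 * t) = \<Psi> (g (2 * t))"
      "\<forall>s\<in>{0..1}. \<bar>s - 2 * t\<bar> < e \<longrightarrow> g s \<in> U \<and> m s = \<Psi> (g s)"
      by blast
    have "(g +++ g') s \<in> U \<and> (m +++ m') s = \<Psi> ((g +++ g') s)"
      if "s \<in> {0..1}" "\<bar>s - t\<bar> < e / 2" "s \<le> 1/2" for s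
    proof -
      have "\<bar>2 * s - 2 * t\<bar> < e" using that(2) by linarith
      then show ?thesis
        using U(5)[rule_format, of "2 * s"] that by (auto simp: joinpaths_def)
    qed
    moreover have "(g +++ g') t \<in> U" using U that by (auto simp: joinpaths_def)
    ultimately show ?thesis
      using U(1,3) by (intro exI[of _ U] exI[of _ \<Psi>] conjI exI[of _ "e/2"]) auto
  qed
  have right: "?Q {1/2..}" if "t \<ge> 1/2"
  proof -
    have "2 * t - 1 \<in> {0..1}" using t that by auto
    from liftE[OF m(2) this] obtain U \<Psi> e where U: "sec U \<Psi>" "g' (2 * t - 1) \<in> U" "e > 0"
      "m' (2 * t - 1) = \<Psi> (g' (2 * t - 1))"
      "\<forall>s\<in>{0..1}. \<bar>s - (2 * t - 1)\<bar> < e \<longrightarrow> g' s \<in> U \<and> m' s = \<Psi> (g' s)"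
      by blast
    have "(g +++ g') s \<in> U \<and> (m +++ m') s = \<Psi> ((g +++ g') s)"
      if "s \<in> {0..1}" "\<bar>s - t\<bar> < e / 2" "s \<ge> 1/2" for s
    proof -
      have "\<bar>2 * s - 1 - (2 * t - 1)\<bar> < e" using that(2) by linarith
      then show ?thesis
        using U(5)[rule_format, of "2 * s - 1"] that gp[OF that(3)] by auto
    qed
    moreover have "(g +++ g') t \<in> U" using U gp(1)[OF that] by auto
    ultimately show ?thesis
      using U(1,3) by (intro exI[of _ U] exI[of _ \<Psi>] conjI exI[of _ "e/2"]) auto
  qed
  consider "t < 1/2" | "t > 1/2" | "t = 1/2" by linarith
  then show "\<exists>U \<Psi>. sec U \<Psi> \<and> (g +++ g') t \<in> U \<and> (\<exists>e>0. \<forall>s\<in>{0..1}. \<bar>s - t\<bar> < e \<longrightarrow>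
       (g +++ g') s \<in> U \<and> (m +++ m') s = \<Psi> ((g +++ g') s))"
  proof cases
    case 1
    then obtain U \<Psi> e where U: "sec U \<Psi>" "(g +++ g') t \<in> U" "e > 0"
      "\<forall>s\<in>{0..1}. \<bar>s - t\<bar> < e \<longrightarrow> s \<in> {..1/2} \<longrightarrow> (g +++ g') s \<in> U \<and> (m +++ m') s = \<Psi> ((g +++ g') s)"
      using left[OF less_imp_le[OF 1]] by blast
    then show ?thesis
      using 1 by (intro exI[of _ U] exI[of _ \<Psi>] conjI exI[of _ "min e (1/2 - t)"]) auto
  next
    case 2
    then obtain U \<Psi> e where U: "sec U \<Psi>" "(g +++ g') t \<in> U" "e > 0"
      "\<forall>s\<in>{0..1}. \<bar>s - t\<bar> < e \<longrightarrow> s \<in> {1/2..} \<longrightarrow> (g +++ g') s \<in> U \<and> (m +++ m') s = \<Psi> ((g +++ g') s)"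
      using right[OF less_imp_le[OF 2]] by blast
    then show ?thesis
      using 2 by (intro exI[of _ U] exI[of _ \<Psi>] conjI exI[of _ "min e (t - 1/2)"]) auto
  next
    \<comment> \<open>At the junction the sections from the left and from the right have the same
      value, hence coincide on a small disc, and the left one serves for both sides.\<close>
    case 3
    obtain U \<Psi> e where U: "sec U \<Psi>" "(g +++ g') t \<in> U" "e > 0"
      "\<forall>s\<in>{0..1}. \<bar>s - t\<bar> < e \<longrightarrow> s \<in> {..1/2} \<longrightarrow> (g +++ g') s \<in> U \<and> (m +++ m') s = \<Psi> ((g +++ g') s)"
      using left[OF eq_refl[OF 3]] by blast
    obtain V \<Psi>' e' where V: "sec V \<Psi>'" "(g +++ g') t \<in> V" "e' > 0"
      "\<forall>s\<in>{0..1}. \<bar>s - t\<bar> < e' \<longrightarrow> s \<in> {1/2..} \<longrightarrow> (g +++ g') s \<in> V \<and> (m +++ m') s = \<Psi>' ((g +++ g') s)"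
      using right[OF eq_refl[OF 3[symmetric]]] by blast
    obtain \<eta> where \<eta>: "\<eta> > 0" "ball ((g +++ g') t) \<eta> \<subseteq> U \<inter> V"
      "\<forall>x\<in>ball ((g +++ g') t) \<eta>. \<forall>y\<in>ball ((g +++ g') t) \<eta>. \<Psi> x = \<Psi>' x \<longrightarrow> \<Psi> y = \<Psi>' y"
      using sec_eq_ball[OF U(1) V(1) U(2) V(2)] by blast
    have cj: "continuous_on {0..1} (g +++ g')"
      using cont ends path_join unfolding path_def by blast
    obtain e'' where e'': "e'' > 0"
      "\<And>s. s \<in> {0..1} \<Longrightarrow> \<bar>s - t\<bar> < e'' \<Longrightarrow> (g +++ g') s \<in> ball ((g +++ g') t) \<eta>"
      using continuous_near[OF cj t open_ball[of "(g +++ g') t" \<eta>]] \<eta>(1) by auto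
    have "\<Psi> ((g +++ g') t) = \<Psi>' ((g +++ g') t)"
      using U(4)[rule_format, OF t] V(4)[rule_format, OF t] U(3) V(3) unfolding 3 by simp
    then have "(g +++ g') s \<in> U \<and> (m +++ m') s = \<Psi> ((g +++ g') s)"
      if "s \<in> {0..1}" "\<bar>s - t\<bar> < min e (min e' e'')" for s
      using U(4)[rule_format, of s] V(4)[rule_format, of s] that e''(2)[of s] \<eta>(1,2) \<eta>(3)[rule_format, of "(g +++ g') t" "(g +++ g') s"]
      by (cases "s \<le> 1/2") (auto simp: subset_iff)
    then show ?thesis
      using U V(3) e''(1)
      by (intro exI[of _ U] exI[of _ \<Psi>] conjI exI[of _ "min e (min e' e'')"]) auto
  qed
qed

end

abbreviation two_pi_i :: complex where
  "two_pi_i \<equiv> 2 * of_real pi * \<i>"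

section \<open>The logarithms of t and t - 1 and a primitive of their exponential\<close>

lemma has_field_derivative_eq_on_convex:
  fixes f g :: "complex \<Rightarrow> complex"
  assumes W: "convex W"
    and f: "\<And>x. x \<in> W \<Longrightarrow> (f has_field_derivative d x) (at x)"
    and g: "\<And>x. x \<in> W \<Longrightarrow> (g has_field_derivative d x) (at x)"
    and xy: "x \<in> W" "y \<in> W" and eq: "f x = g x"
  shows "f y = g y"
proof -
  have "((\<lambda>z. f z - g z) has_field_derivative 0) (at z within W)" if "z \<in> W" for z
    using DERIV_diff[OF f[OF that] g[OF that]] by (auto intro: has_field_derivative_at_within)
  then obtain k where "\<And>z. z \<in> W \<Longrightarrow> f z - g z = k"
    using has_field_derivative_zero_constant[OF W] by metis
  from this[OF xy(1)] this[OF xy(2)] show ?thesis using eq by simp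
qed

lemma primitive_on_ball:
  fixes f :: "complex \<Rightarrow> complex"
  assumes "f holomorphic_on ball c e"
  obtains F where "F c = v" "\<forall>x\<in>ball c e. (F has_field_derivative f x) (at x)"
proof -
  obtain F0 where F0: "\<And>x. x \<in> ball c e \<Longrightarrow> (F0 has_field_derivative f x) (at x within ball c e)"
    using holomorphic_convex_primitive'[OF convex_ball open_ball assms] by blast
  show thesis
  proof (rule that[of "\<lambda>x. F0 x - F0 c + v"], simp, intro ballI)
    fix x assume x: "x \<in> ball c e"
    have "(F0 has_field_derivative f x) (at x)"
      using F0[OF x] x by (simp add: at_within_open[OF _ open_ball])
    then show "((\<lambda>x. F0 x - F0 c + v) has_field_derivative f x) (at x)"
      by (auto intro!: derivative_eq_intros)
  qed
qed

text \<open>Integrate \<open>h' / h\<close> starting from the value \<open>v\<close>; the function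
  \<open>h x * exp (- L x)\<close> has derivative 0 and equals 1 at the centre.\<close>

lemma log_on_ball:
  fixes h :: "complex \<Rightarrow> complex"
  assumes h: "\<And>x. x \<in> ball c e \<Longrightarrow> (h has_field_derivative h' x) (at x)"
    and h': "h' holomorphic_on ball c e" and nz: "\<And>x. x \<in> ball c e \<Longrightarrow> h x \<noteq> 0"
    and "e > 0" and v: "exp v = h c"
  obtains L where "L c = v" "\<forall>x\<in>ball c e. exp (L x) = h x \<and> (L has_field_derivative h' x / h x) (at x)"
proof -
  have hol: "h holomorphic_on ball c e"
    using h by (meson field_differentiable_at_within field_differentiable_def holomorphic_on_def)
  then have "(\<lambda>x. h' x / h x) holomorphic_on ball c e"
    using h' nz by (intro holomorphic_on_divide) auto
  then obtain L where L: "L c = v" "\<forall>x\<in>ball c e. (L has_field_derivative h' x / h x) (at x)"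
    by (rule primitive_on_ball)
  have "h x * exp (- L x) = 1" if x: "x \<in> ball c e" for x
  proof (rule has_field_derivative_eq_on_convex[OF convex_ball[of c e],
        where f = "\<lambda>x. h x * exp (- L x)" and g = "\<lambda>_. 1" and d = "\<lambda>_. 0" and x = c])
    fix y assume y: "y \<in> ball c e"
    show "((\<lambda>x. h x * exp (- L x)) has_field_derivative 0) (at y)"
      using nz[OF y] by (auto intro!: derivative_eq_intros h[OF y] L(2)[rule_format, OF y])
  qed (use x \<open>e > 0\<close> L(1) v in \<open>auto simp: exp_minus simp flip: v\<close>)
  then have "exp (L x) = h x" if "x \<in> ball c e" for x
    using that by (simp add: exp_minus field_simps)
  then show thesis using that L by blast
qed

text \<open>The difference of the two functions takes values in the multiples of 2 pi i, which are 2
  pi apart, so it is constant. Increments along a lift can therefore be read off from any explicit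
  logarithm.\<close>

lemma continuous_log_increment_unique:
  fixes l l' :: "real \<Rightarrow> complex"
  assumes l: "continuous_on {0..1} l" "continuous_on {0..1} l'"
    and "\<And>t. t \<in> {0..1} \<Longrightarrow> exp (l t) = exp (l' t)"
    and t: "t \<in> {0..1}"
  shows "l t - l 0 = l' t - l' 0"
proof -
  let ?d = "\<lambda>t. l t - l' t"
  have "?d constant_on {0..1}"
  proof (rule continuous_discrete_range_constant)
    show "continuous_on {0..1} ?d" using l by (intro continuous_intros)
    fix x :: real assume x: "x \<in> {0..1}"
    show "\<exists>e>0. \<forall>y. y \<in> {0..1} \<and> ?d y \<noteq> ?d x \<longrightarrow> e \<le> norm (?d y - ?d x)"
    proof (intro exI[of _ "2 * pi"] conjI allI impI)
      fix y :: real assume y: "y \<in> {0..1} \<and> ?d y \<noteq> ?d x"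
      have "exp (?d y) = 1" "exp (?d x) = 1"
        using assms(3) x y by (auto simp: exp_diff)
      then have "exp (?d y - ?d x) = 1" by (simp add: exp_diff[of "?d y"])
      then obtain n :: int where n: "Re (?d y - ?d x) = 0" "Im (?d y - ?d x) = of_int (2 * n) * pi"
        by (auto simp: exp_eq_1)
      then have "n \<noteq> 0" using y by (auto simp: complex_eq_iff)
      then have "2 * pi \<le> \<bar>Im (?d y - ?d x)\<bar>" using n(2) by (simp add: abs_mult)
      then show "2 * pi \<le> norm (?d y - ?d x)"
        using abs_Im_le_cmod order_trans by blast
    qed simp
  qed simp
  then have "?d t = ?d 0" using t unfolding constant_on_def by force
  then show ?thesis by (simp add: algebra_simps)
qed

text \<open>A triple consists of values of \<open>log t\<close>, \<open>log (t - 1)\<close> and \<open>f\<close>, where \<open>f\<close> is a primitive of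
  \<open>exp (\<beta>0 log t + \<beta>1 log (t - 1))\<close>.\<close>

type_synonym triple = "complex \<times> complex \<times> complex"

text \<open>The third entry is unrestricted: a primitive is determined up to a constant, so every
  complex number is a possible value of \<open>f\<close>. Both logarithms are recorded because the
  complex powers of \<open>x\<close> and \<open>x - 1\<close> depend on them.\<close>

definition fib3 :: "complex \<Rightarrow> triple set" where
  "fib3 x = {(l0, l1, f). exp l0 = x \<and> exp l1 = x - 1}"

definition branch3 where
  "branch3 \<beta>0 \<beta>1 U L0 L1 \<Phi> \<longleftrightarrow> open U \<and> (\<forall>x\<in>U. exp (L0 x) = x \<and> exp (L1 x) = x - 1 \<and>
     (L0 has_field_derivative 1 / x) (at x) \<and>
     (L1 has_field_derivative 1 / (x - 1)) (at x) \<and>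
     (\<Phi> has_field_derivative exp (\<beta>0 * L0 x + \<beta>1 * L1 x)) (at x))"

lemma branch3D:
  assumes "branch3 \<beta>0 \<beta>1 U L0 L1 \<Phi>"
  shows "open U" "x \<in> U \<Longrightarrow> exp (L0 x) = x" "x \<in> U \<Longrightarrow> exp (L1 x) = x - 1"
    "x \<in> U \<Longrightarrow> (L0 has_field_derivative 1 / x) (at x)"
    "x \<in> U \<Longrightarrow> (L1 has_field_derivative 1 / (x - 1)) (at x)"
    "x \<in> U \<Longrightarrow> (\<Phi> has_field_derivative exp (\<beta>0 * L0 x + \<beta>1 * L1 x)) (at x)"
  using assms unfolding branch3_def by auto

definition sec3 :: "complex \<Rightarrow> complex \<Rightarrow> complex set \<Rightarrow> (complex \<Rightarrow> triple) \<Rightarrow> bool" where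
  "sec3 \<beta>0 \<beta>1 U \<Psi> \<longleftrightarrow> (\<exists>L0 L1 \<Phi>. \<Psi> = (\<lambda>x. (L0 x, L1 x, \<Phi> x)) \<and> branch3 \<beta>0 \<beta>1 U L0 L1 \<Phi>)"

interpretation gs: germ_system "- {0, 1}" "sec3 \<beta>0 \<beta>1" fib3 for \<beta>0 \<beta>1
proof
  show "open (- {0, 1 :: complex})" by (simp add: open_Compl)
  show "open U" if "sec3 \<beta>0 \<beta>1 U \<Psi>" for U \<Psi>
    using that by (auto simp: sec3_def branch3_def)
  show "\<Psi> x \<in> fib3 x" if "sec3 \<beta>0 \<beta>1 U \<Psi>" "x \<in> U" for U \<Psi> x
    using that by (auto simp: sec3_def branch3_def fib3_def)
  show "\<Psi> y = \<Psi>' y" if s: "sec3 \<beta>0 \<beta>1 U \<Psi>" "sec3 \<beta>0 \<beta>1 V \<Psi>'"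
    and W: "open W" "convex W" "W \<subseteq> U \<inter> V" "x \<in> W" and eq: "\<Psi> x = \<Psi>' x" and y: "y \<in> W"
  for U \<Psi> V \<Psi>' W x y
  proof -
    from s(1) obtain L0 L1 \<Phi> where A: "\<Psi> = (\<lambda>x. (L0 x, L1 x, \<Phi> x))" and A': "branch3 \<beta>0 \<beta>1 U L0 L1 \<Phi>"
      unfolding sec3_def by blast
    note A = A branch3D(4-6)[OF A']
    from s(2) obtain L0' L1' \<Phi>' where B: "\<Psi>' = (\<lambda>x. (L0' x, L1' x, \<Phi>' x))" and B': "branch3 \<beta>0 \<beta>1 V L0' L1' \<Phi>'"
      unfolding sec3_def by blast
    note B = B branch3D(4-6)[OF B']
    have 0: "L0 z = L0' z" if "z \<in> W" for z
    proof (rule has_field_derivative_eq_on_convex[OF W(2), where x = x and d = "\<lambda>x. 1 / x" and f = L0 and g = L0'])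
      show "(L0 has_field_derivative 1 / z) (at z)" "(L0' has_field_derivative 1 / z) (at z)" if "z \<in> W" for z
        using A B that W(3) by blast+
    qed (use W that eq A(1) B(1) in auto)
    have 1: "L1 z = L1' z" if "z \<in> W" for z
    proof (rule has_field_derivative_eq_on_convex[OF W(2), where x = x and d = "\<lambda>x. 1 / (x - 1)" and f = L1 and g = L1'])
      show "(L1 has_field_derivative 1 / (z - 1)) (at z)" "(L1' has_field_derivative 1 / (z - 1)) (at z)" if "z \<in> W" for z
        using A B that W(3) by blast+
    qed (use W that eq A(1) B(1) in auto)
    \<comment> \<open>The logarithms had to be compared first: only once they agree on
      \<open>W\<close> do the two primitives have the same derivative.\<close>
    have "\<Phi> y = \<Phi>' y"
    proof (rule has_field_derivative_eq_on_convex[OF W(2),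
          where x = x and f = \<Phi> and g = \<Phi>' and d = "\<lambda>x. exp (\<beta>0 * L0 x + \<beta>1 * L1 x)"])
      show "(\<Phi> has_field_derivative exp (\<beta>0 * L0 z + \<beta>1 * L1 z)) (at z)" if "z \<in> W" for z
        using that W(3) by (intro A(4)) auto
      show "(\<Phi>' has_field_derivative exp (\<beta>0 * L0 z + \<beta>1 * L1 z)) (at z)" if "z \<in> W" for z
        unfolding 0[OF that] 1[OF that] using that W(3) by (intro B(4)) auto
    qed (use W y eq A(1) B(1) in auto)
    then show ?thesis using 0 1 y A(1) B(1) by simp
  qed
  show "\<exists>\<Psi>. sec3 \<beta>0 \<beta>1 (ball c e) \<Psi> \<and> \<Psi> c = v"
    if v: "v \<in> fib3 c" and e: "e > 0" "ball c e \<subseteq> - {0, 1}" for v c e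
  proof -
    obtain v0 v1 f where vv: "v = (v0, v1, f)" "exp v0 = c" "exp v1 = c - 1"
      using v by (auto simp: fib3_def)
    have "0 \<notin> ball c e" "1 \<notin> ball c e" using e(2) by blast+
    then have nz: "x \<noteq> 0" "x - 1 \<noteq> 0" if "x \<in> ball c e" for x using that by auto
    have "((\<lambda>x. x) has_field_derivative 1) (at x)" "((\<lambda>x. x - 1) has_field_derivative 1) (at x)" for x :: complex
      by (auto intro!: derivative_eq_intros)
    note der = this
    obtain L0 where L0: "L0 c = v0" "\<forall>x\<in>ball c e. exp (L0 x) = x \<and> (L0 has_field_derivative 1 / x) (at x)"
      using log_on_ball[OF der(1) holomorphic_on_const nz(1) e(1) vv(2)] by blast
    obtain L1 where L1: "L1 c = v1"
      "\<forall>x\<in>ball c e. exp (L1 x) = x - 1 \<and> (L1 has_field_derivative 1 / (x - 1)) (at x)"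
      using log_on_ball[OF der(2) holomorphic_on_const nz(2) e(1) vv(3)] by blast
    have "L0 holomorphic_on ball c e" "L1 holomorphic_on ball c e"
      using L0(2) L1(2) by (meson field_differentiable_at_within field_differentiable_def holomorphic_on_def)+
    then have "(\<lambda>x. exp (\<beta>0 * L0 x + \<beta>1 * L1 x)) holomorphic_on ball c e"
      by (intro holomorphic_intros)
    then obtain \<Phi> where "\<Phi> c = f"
      "\<forall>x\<in>ball c e. (\<Phi> has_field_derivative exp (\<beta>0 * L0 x + \<beta>1 * L1 x)) (at x)"
      by (rule primitive_on_ball)
    then show ?thesis
      using L0 L1 vv unfolding sec3_def branch3_def 
      by (intro exI[of _ "\<lambda>x. (L0 x, L1 x, \<Phi> x)"] conjI exI[of _ L0] exI[of _ L1] exI[of _ \<Phi>]) auto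
  qed
qed

section \<open>Deck transformations of the triples\<close>

fun deck :: "complex \<Rightarrow> complex \<Rightarrow> triple \<Rightarrow> triple \<Rightarrow> triple" where
  "deck \<beta>0 \<beta>1 (u0, u1, F) (l0, l1, f) = (l0 + u0, l1 + u1, exp (\<beta>0 * u0 + \<beta>1 * u1) * f + F)"

definition is_deck :: "triple \<Rightarrow> bool" where
  "is_deck d \<longleftrightarrow> exp (fst d) = 1 \<and> exp (fst (snd d)) = 1"

text \<open>Together with \<open>deck_inject\<close> this says that deck transformations act simply
  transitively on each fibre, so continuation around a loop is recorded by a single triple
  \<open>d\<close>.\<close>

lemma deck_exists:
  assumes "v \<in> fib3 x" "v' \<in> fib3 x"
  obtains d where "is_deck d" "v' = deck \<beta>0 \<beta>1 d v"
proof -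
  obtain l0 l1 f l0' l1' f' where "v = (l0, l1, f)" "v' = (l0', l1', f')"
    by (metis prod.exhaust)
  moreover have "x \<noteq> 0 \<and> x \<noteq> 1"
    using assms by (auto simp: fib3_def)
  ultimately show thesis
    using assms
    \<comment> \<open>The first two entries are the differences of the logarithms; the third solves
      B f + F = f' for F, where B is the factor that \<open>deck\<close> attaches to these
      differences.\<close>
    by (intro that[of "(l0' - l0, l1' - l1, f' - exp (\<beta>0 * (l0' - l0) + \<beta>1 * (l1' - l1)) * f)"])
       (auto simp: fib3_def is_deck_def exp_diff)
qed

lemma deck_inject: "deck \<beta>0 \<beta>1 d v = deck \<beta>0 \<beta>1 d' v \<Longrightarrow> d = d'"
  by (cases d; cases d'; cases v) auto

text \<open>Shifting the logarithms by periods multiplies the derivative of \<open>\<Phi>\<close> by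
  \<open>exp (\<beta>0 * u0 + \<beta>1 * u1)\<close>. This is the origin of the factor in
  \<open>deck\<close>; \<open>F\<close> is the constant of integration.\<close>

lemma sec3_deck:
  assumes "sec3 \<beta>0 \<beta>1 U \<Psi>" "is_deck d"
  shows "sec3 \<beta>0 \<beta>1 U (\<lambda>x. deck \<beta>0 \<beta>1 d (\<Psi> x))"
proof -
  obtain L0 L1 \<Phi> where A: "\<Psi> = (\<lambda>x. (L0 x, L1 x, \<Phi> x))" and A': "branch3 \<beta>0 \<beta>1 U L0 L1 \<Phi>"
    using assms(1) unfolding sec3_def by blast
  note A = A branch3D[OF A']
  obtain u0 u1 F where d: "d = (u0, u1, F)" by (metis prod.exhaust)
  have "((\<lambda>x. exp (\<beta>0 * u0 + \<beta>1 * u1) * \<Phi> x + F) has_field_derivative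
      exp (\<beta>0 * (L0 x + u0) + \<beta>1 * (L1 x + u1))) (at x)" if "x \<in> U" for x
    by (rule derivative_eq_intros A(7)[OF that] refl)+ (simp add: exp_add[symmetric] algebra_simps)
  moreover have "((\<lambda>x. L0 x + u0) has_field_derivative 1 / x) (at x)"
    "((\<lambda>x. L1 x + u1) has_field_derivative 1 / (x - 1)) (at x)" if "x \<in> U" for x
    using A(5,6)[OF that] by (auto intro!: derivative_eq_intros)
  ultimately show ?thesis
    using assms(2) A(2-4) unfolding sec3_def branch3_def d A(1)
    by (intro exI[of _ "\<lambda>x. L0 x + u0"] exI[of _ "\<lambda>x. L1 x + u1"]
          exI[of _ "\<lambda>x. exp (\<beta>0 * u0 + \<beta>1 * u1) * \<Phi> x + F"])
       (auto simp: is_deck_def exp_add)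
qed

lemma lift_deck:
  assumes "gs.lift \<beta>0 \<beta>1 g m" "is_deck d"
  shows "gs.lift \<beta>0 \<beta>1 g (\<lambda>t. deck \<beta>0 \<beta>1 d (m t))"
  unfolding gs.lift_def
proof
  fix t :: real assume "t \<in> {0..1}"
  then obtain U \<Psi> e where U: "sec3 \<beta>0 \<beta>1 U \<Psi>" "g t \<in> U" "e > 0" "m t = \<Psi> (g t)"
    "\<forall>s\<in>{0..1}. \<bar>s - t\<bar> < e \<longrightarrow> g s \<in> U \<and> m s = \<Psi> (g s)"
    using gs.liftE[OF assms(1)] by blast
  then show "\<exists>U \<Psi>. sec3 \<beta>0 \<beta>1 U \<Psi> \<and> g t \<in> U \<and> (\<exists>e>0. \<forall>s\<in>{0..1}. \<bar>s - t\<bar> < e \<longrightarrow>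
      g s \<in> U \<and> deck \<beta>0 \<beta>1 d (m s) = \<Psi> (g s))"
    using sec3_deck[OF U(1) assms(2)]
    by (intro exI[of _ U] exI[of _ "\<lambda>x. deck \<beta>0 \<beta>1 d (\<Psi> x)"] conjI exI[of _ e]) auto
qed

text \<open>On the way back along \<open>q\<close> the lift is the image under \<open>d\<close> of
  the lift on the way out. Hence a circle with a tail has the same deck transformation as the circle
  itself.\<close>

lemma lift_deck_conj:
  assumes q: "path q" "path_image q \<subseteq> - {0, 1}" and k: "path k"
    and ends: "pathfinish q = pathstart k" "pathfinish k = pathstart k"
    and mq: "gs.lift \<beta>0 \<beta>1 q mq" and mk: "gs.lift \<beta>0 \<beta>1 k mk" "mk 0 = mq 1" "mk 1 = deck \<beta>0 \<beta>1 d (mk 0)"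
    and d: "is_deck d"
  obtains m where "gs.lift \<beta>0 \<beta>1 (q +++ k +++ reversepath q) m" "m 0 = mq 0" "m 1 = deck \<beta>0 \<beta>1 d (mq 0)"
proof -
  let ?r = "\<lambda>t. deck \<beta>0 \<beta>1 d (mq (1 - t))"
  have "gs.lift \<beta>0 \<beta>1 (reversepath q) ?r"
    using lift_deck[OF gs.lift_reversepath[OF mq] d] .
  then have "gs.lift \<beta>0 \<beta>1 (k +++ reversepath q) (mk +++ ?r)"
    using q k ends mk by (intro gs.lift_join) (auto simp: mk)
  moreover have "(mk +++ ?r) 0 = mq 1"
    using mk by (simp add: joinpaths_def)
  ultimately have "gs.lift \<beta>0 \<beta>1 (q +++ k +++ reversepath q) (mq +++ mk +++ ?r)"
    using q k ends mq by (intro gs.lift_join[OF _ _ mq]) auto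
  then show thesis
    by (rule that) (auto simp: joinpaths_def)
qed

text \<open>The first two entries of a lift are continuous logarithms of \<open>g\<close> and
  \<open>g - 1\<close>, so they have the increments of any other continuous logarithms of these
  paths.\<close>

lemma lift_log_increments:
  assumes g: "path g" and m: "gs.lift \<beta>0 \<beta>1 g m"
    and s: "s \<in> {0..1}"
  shows "\<lbrakk>path l; \<And>t. t \<in> {0..1} \<Longrightarrow> exp (l t) = g t\<rbrakk> \<Longrightarrow> fst (m s) - fst (m 0) = l s - l 0"
    and "\<lbrakk>path l; \<And>t. t \<in> {0..1} \<Longrightarrow> exp (l t) = g t - 1\<rbrakk> \<Longrightarrow> fst (snd (m s)) - fst (snd (m 0)) = l s - l 0"
proof -
  have cont: "continuous_on {0..1} (\<lambda>t. fst (m t)) \<and> continuous_on {0..1} (\<lambda>t. fst (snd (m t)))"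
    unfolding continuous_on_eq_continuous_within ball_conj_distrib[symmetric]
  proof
    fix t :: real assume t: "t \<in> {0..1}"
    then obtain U \<Psi> e where U: "sec3 \<beta>0 \<beta>1 U \<Psi>" "g t \<in> U" "e > 0" "m t = \<Psi> (g t)"
      "\<forall>s\<in>{0..1}. \<bar>s - t\<bar> < e \<longrightarrow> g s \<in> U \<and> m s = \<Psi> (g s)"
      using gs.liftE[OF m] by blast
    from U(1) obtain L0 L1 \<Phi> where A: "\<Psi> = (\<lambda>x. (L0 x, L1 x, \<Phi> x))" and A': "branch3 \<beta>0 \<beta>1 U L0 L1 \<Phi>"
      unfolding sec3_def by blast
    note A = A branch3D(4,5)[OF A']
    have gt: "continuous (at t within {0..1}) g"
      using g t by (auto simp: path_def continuous_on_eq_continuous_within)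
    have "continuous (at (g t)) L0" "continuous (at (g t)) L1"
      using A(2,3) U(2) DERIV_isCont by blast+
    then have c: "continuous (at t within {0..1}) (\<lambda>s. L0 (g s))" "continuous (at t within {0..1}) (\<lambda>s. L1 (g s))"
      using gt continuous_within_compose3 by blast+
    have *: "L0 (g s) = fst (m s)" "L1 (g s) = fst (snd (m s))" if "s \<in> {0..1}" "dist s t < e" for s
      using U(5) that A(1) by (auto simp: dist_real_def)
    show "continuous (at t within {0..1}) (\<lambda>t. fst (m t)) \<and> continuous (at t within {0..1}) (\<lambda>t. fst (snd (m t)))"
      using continuous_transform_within[OF c(1) U(3) t *(1)] continuous_transform_within[OF c(2) U(3) t *(2)]
      by blast
  qed
  have mf: "exp (fst (m t)) = g t \<and> exp (fst (snd (m t))) = g t - 1" if "t \<in> {0..1}" for t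
    using gs.lift_fib[OF m that] by (auto simp: fib3_def)
  show "fst (m s) - fst (m 0) = l s - l 0" if "path l" "\<And>t. t \<in> {0..1} \<Longrightarrow> exp (l t) = g t"
    using that cont mf s by (intro continuous_log_increment_unique[of "\<lambda>t. fst (m t)"]) (auto simp: path_def)
  show "fst (snd (m s)) - fst (snd (m 0)) = l s - l 0" if "path l" "\<And>t. t \<in> {0..1} \<Longrightarrow> exp (l t) = g t - 1"
    using that cont mf s by (intro continuous_log_increment_unique[of "\<lambda>t. fst (snd (m t))"]) (auto simp: path_def)
qed

section \<open>Monodromy of the primitive around 0 and 1\<close>

text \<open>Replacing the third entry of \<open>m\<close> by \<open>H\<close> plus a constant gives
  another lift with the same start, so the two coincide by \<open>lift_unique\<close>. In
  \<open>H\<close> the primitive is tested on the branches through the actual values of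
  \<open>m\<close>, so it may depend on which branch the lift follows.\<close>

lemma lift_primitive:
  assumes g: "path g" and m: "gs.lift \<beta>0 \<beta>1 g m"
    and H: "\<And>t U L0 L1 \<Phi>. \<lbrakk>t \<in> {0..1}; branch3 \<beta>0 \<beta>1 U L0 L1 \<Phi>; g t \<in> U;
        m t = (L0 (g t), L1 (g t), \<Phi> (g t))\<rbrakk> \<Longrightarrow>
       \<exists>\<eta>>0. \<forall>x\<in>ball (g t) \<eta>. ((\<lambda>x. H (L0 x) (L1 x) x) has_field_derivative
          exp (\<beta>0 * L0 x + \<beta>1 * L1 x)) (at x)"
  shows "snd (snd (m 1)) - H (fst (m 1)) (fst (snd (m 1))) (g 1) =
         snd (snd (m 0)) - H (fst (m 0)) (fst (snd (m 0))) (g 0)"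
proof -
  define k where "k = snd (snd (m 0)) - H (fst (m 0)) (fst (snd (m 0))) (g 0)"
  define m' where "m' t = (fst (m t), fst (snd (m t)), H (fst (m t)) (fst (snd (m t))) (g t) + k)" for t
  have lm': "gs.lift \<beta>0 \<beta>1 g m'"
    unfolding gs.lift_def
  proof
    fix t :: real assume t: "t \<in> {0..1}"
    obtain U \<Psi> e where U: "sec3 \<beta>0 \<beta>1 U \<Psi>" "g t \<in> U" "e > 0" "m t = \<Psi> (g t)"
      "\<forall>s\<in>{0..1}. \<bar>s - t\<bar> < e \<longrightarrow> g s \<in> U \<and> m s = \<Psi> (g s)"
      using gs.liftE[OF m t] by blast
    obtain L0 L1 \<Phi> where A: "\<Psi> = (\<lambda>x. (L0 x, L1 x, \<Phi> x))" and A': "branch3 \<beta>0 \<beta>1 U L0 L1 \<Phi>"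
      using U(1) unfolding sec3_def by blast
    obtain \<eta> where \<eta>: "\<eta> > 0" "\<forall>x\<in>ball (g t) \<eta>. ((\<lambda>x. H (L0 x) (L1 x) x) has_field_derivative
          exp (\<beta>0 * L0 x + \<beta>1 * L1 x)) (at x)"
      using H[OF t A' U(2)] U(4) A by auto
    let ?V = "U \<inter> ball (g t) \<eta>"
    have "((\<lambda>x. H (L0 x) (L1 x) x + k) has_field_derivative exp (\<beta>0 * L0 x + \<beta>1 * L1 x)) (at x)"
      if "x \<in> ball (g t) \<eta>" for x
      using DERIV_add[OF \<eta>(2)[rule_format, OF that] DERIV_const[of k]] by simp
    then have "branch3 \<beta>0 \<beta>1 ?V L0 L1 (\<lambda>x. H (L0 x) (L1 x) x + k)"
      using A' unfolding branch3_def by blast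
    then have sec: "sec3 \<beta>0 \<beta>1 ?V (\<lambda>x. (L0 x, L1 x, H (L0 x) (L1 x) x + k))"
      unfolding sec3_def
      by (intro exI[of _ L0] exI[of _ L1] exI[of _ "\<lambda>x. H (L0 x) (L1 x) x + k"]) simp
    obtain e2 where e2: "e2 > 0" "\<And>s. s \<in> {0..1} \<Longrightarrow> \<bar>s - t\<bar> < e2 \<Longrightarrow> g s \<in> ball (g t) \<eta>"
      using continuous_near[OF g[unfolded path_def] t open_ball[of "g t" \<eta>]] \<eta>(1) by auto
    have "g s \<in> ?V \<and> m' s = (L0 (g s), L1 (g s), H (L0 (g s)) (L1 (g s)) (g s) + k)"
      if "s \<in> {0..1}" "\<bar>s - t\<bar> < min e e2" for s
      using U(5) e2(2)[of s] that A by (auto simp: m'_def)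
    then show "\<exists>U \<Psi>. sec3 \<beta>0 \<beta>1 U \<Psi> \<and> g t \<in> U \<and>
        (\<exists>e>0. \<forall>s\<in>{0..1}. \<bar>s - t\<bar> < e \<longrightarrow> g s \<in> U \<and> m' s = \<Psi> (g s))"
      using sec U(2,3) \<eta>(1) e2(1)
      by (intro exI[of _ ?V] exI[of _ "\<lambda>x. (L0 x, L1 x, H (L0 x) (L1 x) x + k)"] conjI
          exI[of _ "min e e2"]) auto
  qed
  have "m' 0 = m 0" unfolding m'_def k_def by (simp add: prod_eq_iff)
  then have "m' 1 = m 1"
    by (rule gs.lift_unique[OF g[unfolded path_def] lm' m]) simp
  then have "snd (snd (m' 1)) = snd (snd (m 1))" by simp
  then show ?thesis unfolding m'_def k_def by (simp add: algebra_simps)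
qed

text \<open>For these exponents the integrand is \<open>exp (- L0 x) = 1 / x\<close>, so the first
  logarithm is itself a primitive.\<close>

lemma lift_log_primitive:
  assumes "path g" "gs.lift (- 1) 0 g m"
  shows "snd (snd (m 1)) - snd (snd (m 0)) = fst (m 1) - fst (m 0)"
proof -
  have "snd (snd (m 1)) - fst (m 1) = snd (snd (m 0)) - fst (m 0)"
  proof (rule lift_primitive[OF assms, where H = "\<lambda>l0 l1 x. l0"])
    fix t :: real and U L0 L1 \<Phi>
    assume b: "branch3 (- 1) 0 U L0 L1 \<Phi>" and "g t \<in> U"
    then obtain \<eta> where "\<eta> > 0" "ball (g t) \<eta> \<subseteq> U"
      using branch3D(1) open_contains_ball by blast
    moreover have "(L0 has_field_derivative exp (- 1 * L0 x + 0 * L1 x)) (at x)" if "x \<in> U" for x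
      using branch3D(2,4)[OF b that] by (simp add: exp_minus inverse_eq_divide)
    ultimately show "\<exists>\<eta>>0. \<forall>x\<in>ball (g t) \<eta>. (L0 has_field_derivative exp (- 1 * L0 x + 0 * L1 x)) (at x)"
      by blast
  qed
  then show ?thesis by (simp add: algebra_simps)
qed

text \<open>The equation says that x^b K is a primitive of x^(b-1) G. Comparing coefficients gives
  \<open>c n = a n / (n + b)\<close>; the denominators have modulus at least
  \<open>Re b > 0\<close>, so convergence is inherited from the series of \<open>G\<close>.\<close>

lemma frobenius_solution:
  assumes G: "G holomorphic_on ball 0 1" and b: "Re b > 0"
  obtains K K' where "\<forall>x\<in>ball 0 1. (K has_field_derivative K' x) (at x) \<and> x * K' x + b * K x = G x"
proof -
  define a where "a n = (deriv ^^ n) G 0 / fact n" for n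
  define c where "c n = a n / (of_nat n + b)" for n
  have a: "(\<lambda>n. a n * x ^ n) sums G x" if "x \<in> ball 0 1" for x
    using holomorphic_power_series[OF G that] by (simp add: a_def)
  have nb: "Re b \<le> norm (of_nat n + b)" for n
    using complex_Re_le_cmod[of "of_nat n + b"] by simp
  then have nz: "of_nat n + b \<noteq> 0" for n
    using b by (metis norm_zero not_le)
  have c: "summable (\<lambda>n. c n * x ^ n)" if x: "norm x < 1" for x
  proof -
    obtain r where r: "norm x < r" "r < 1" using dense[OF x] by blast
    then have r0: "r > 0" using norm_ge_zero[of x] by linarith
    have "summable (\<lambda>n. a n * of_real r ^ n)"
      using a[of "of_real r"] r r0 sums_summable by simp
    then have "summable (\<lambda>n. norm (a n * x ^ n))"
      using powser_insidea[of a "of_real r" x] r r0 by simp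
    then have "summable (\<lambda>n. norm (a n * x ^ n) / Re b)"
      by (rule summable_divide)
    then show ?thesis
    proof (rule summable_comparison_test')
      fix n
      have "norm (c n * x ^ n) = norm (a n * x ^ n) / norm (of_nat n + b)"
        by (simp add: c_def norm_divide norm_mult)
      also have "\<dots> \<le> norm (a n * x ^ n) / Re b"
        using nb[of n] b by (intro divide_left_mono mult_pos_pos) (auto intro: less_le_trans simp: nz)
      finally show "norm (c n * x ^ n) \<le> norm (a n * x ^ n) / Re b" .
    qed
  qed
  define K where "K x = (\<Sum>n. c n * x ^ n)" for x
  define K' where "K' x = (\<Sum>n. diffs c n * x ^ n)" for x
  have "(K has_field_derivative K' x) (at x) \<and> x * K' x + b * K x = G x" if x: "x \<in> ball 0 1" for x
  proof
    have nx: "norm x < 1" using x by simp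
    show "(K has_field_derivative K' x) (at x)"
      unfolding K_def K'_def using termdiffs_strong'[OF c nx] .
    have "summable (\<lambda>n. diffs c n * x ^ n)"
      using termdiff_converges[OF nx c] .
    then have "(\<lambda>n. x * (of_nat n * c n * x ^ (n - Suc 0))) sums (x * K' x)"
      unfolding K'_def by (intro sums_mult diffs_equiv)
    moreover have "x * (of_nat n * c n * x ^ (n - Suc 0)) = of_nat n * c n * x ^ n" for n
      by (cases n) auto
    moreover have "(\<lambda>n. b * (c n * x ^ n)) sums (b * K x)"
      unfolding K_def using c[OF nx] by (intro sums_mult summable_sums)
    ultimately have "(\<lambda>n. of_nat n * c n * x ^ n + b * (c n * x ^ n)) sums (x * K' x + b * K x)"
      by (simp add: sums_add)
    moreover have "of_nat n * c n * x ^ n + b * (c n * x ^ n) = a n * x ^ n" for n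
    proof -
      have "of_nat n * c n * x ^ n + b * (c n * x ^ n) = (of_nat n + b) * c n * x ^ n"
        by (simp add: algebra_simps)
      then show ?thesis using nz[of n] by (simp add: c_def)
    qed
    ultimately show "x * K' x + b * K x = G x"
      using a[OF x] sums_unique2 by simp
  qed
  then show thesis using that by blast
qed

text \<open>The function \<open>t powr b * K t\<close> is a primitive of the integrand and vanishes
  at 0 because \<open>Re b > 0\<close>. The factor \<open>exp (\<beta> * w)\<close> records the
  chosen branch of the logarithm in the right-hand side of the equation for
  \<open>K\<close>.\<close>

lemma half_beta_integral:
  assumes b: "Re b > 0"
    and K: "\<forall>x\<in>ball 0 1. (K has_field_derivative K' x) (at x) \<and> x * K' x + b * K x = exp (\<beta> * (w + Ln (1 - x)))"
  shows "((\<lambda>t. exp (\<beta> * w) * (of_real t powr (b - 1) * of_real (1 - t) powr \<beta>)) has_integral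
     (1 / 2) powr b * K (1 / 2)) {0..1/2::real}"
proof -
  let ?P = "\<lambda>t::real. of_real t powr b * K (of_real t)"
  have "((\<lambda>t. exp (\<beta> * w) * (of_real t powr (b - 1) * of_real (1 - t) powr \<beta>)) has_integral
     ?P (1/2) - ?P 0) {0..1/2::real}"
  \<comment> \<open>At 0 the complex power is continuous but in general not differentiable, hence
    the version with derivatives in the interior.\<close>
  proof (rule fundamental_theorem_of_calculus_interior)
    have "continuous_on {0..1/2} (\<lambda>t::real. K (of_real t))"
    proof (rule continuous_on_compose2[of "ball 0 1" K])
      show "continuous_on (ball 0 1) K"
        using K by (auto intro!: continuous_at_imp_continuous_on DERIV_isCont)
    qed (auto intro!: continuous_intros)
    moreover have "continuous_on {0..1/2} (\<lambda>t::real. complex_of_real t powr b)"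
      using b by (intro continuous_on_powr_complex continuous_intros) auto
    ultimately show "continuous_on {0..1/2} ?P" by (rule continuous_on_mult[rotated])
  next
    fix t :: real assume t: "t \<in> {0<..<1/2}"
    have tb: "complex_of_real t \<in> ball 0 1" using t by simp
    have tn: "complex_of_real t \<notin> \<real>\<^sub>\<le>\<^sub>0" using t by (simp add: complex_nonpos_Reals_iff)
    have "((\<lambda>x. x powr b * K x) has_field_derivative
        b * of_real t powr (b - 1) * K (of_real t) + of_real t powr b * K' (of_real t)) (at (of_real t))"
      using K[rule_format, OF tb] tn
      by (auto intro!: derivative_eq_intros has_field_derivative_powr)
    moreover have "b * of_real t powr (b - 1) * K (of_real t) + of_real t powr b * K' (of_real t) =
        exp (\<beta> * w) * (of_real t powr (b - 1) * of_real (1 - t) powr \<beta>)"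
    proof -
      have "of_real t powr b = of_real t * of_real t powr (b - 1)"
        using t by (simp add: powr_diff)
      then have "b * of_real t powr (b - 1) * K (of_real t) + of_real t powr b * K' (of_real t) =
          of_real t powr (b - 1) * (of_real t * K' (of_real t) + b * K (of_real t))"
        by (simp add: algebra_simps)
      also have "\<dots> = of_real t powr (b - 1) * exp (\<beta> * (w + Ln (1 - of_real t)))"
        using K[rule_format, OF tb] by simp
      also have "exp (\<beta> * (w + Ln (1 - of_real t))) = exp (\<beta> * w) * of_real (1 - t) powr \<beta>"
        using t by (auto simp: powr_def exp_add distrib_left)
      finally show ?thesis by (simp add: mult_ac)
    qed
    ultimately have "((\<lambda>x. x powr b * K x) has_field_derivative
        exp (\<beta> * w) * (of_real t powr (b - 1) * of_real (1 - t) powr \<beta>)) (at (of_real t))"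
      by simp
    then show "(?P has_vector_derivative exp (\<beta> * w) * (of_real t powr (b - 1) * of_real (1 - t) powr \<beta>)) (at t)"
      by (rule has_vector_derivative_real_field)
  qed simp
  then show ?thesis by simp
qed


section \<open>Continuation of \<open>f\<close> along the circles about 0 and 1 through 1/2\<close>

lemma Ln_half: "Ln (1 / 2) = - complex_of_real (ln 2)"
  using Ln_of_real[of "1/2"] by (simp add: ln_div)

text \<open>Along the circle \<open>f\<close> differs by a constant from the primitive
  \<open>exp ((\<beta>0 + 1) * l0) * K x\<close>. One turn adds 2 pi i to \<open>l0\<close> and thus
  multiplies this primitive by \<open>exp (two_pi_i * \<beta>0)\<close>, which gives the increment
  of \<open>f\<close>.\<close>

lemma circle_zero_monodromy:
  assumes m: "gs.lift \<beta>0 \<beta>1 (circlepath 0 (1/2)) m" and m0: "m 0 = (v0, v1, f)"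
    and K: "\<forall>x\<in>ball 0 1. (K has_field_derivative K' x) (at x) \<and>
       x * K' x + (\<beta>0 + 1) * K x = exp (\<beta>1 * (v1 + of_real (ln 2) + Ln (1 - x)))"
  shows "m 1 = (v0 + two_pi_i, v1,
     f + (exp (two_pi_i * \<beta>0) - 1) * (exp ((\<beta>0 + 1) * v0) * K (1 / 2)))"
proof -
  let ?g = "circlepath 0 (1/2)"
  \<comment> \<open>The branch of log (x - 1) on the unit disc with value \<open>v1\<close> at 1/2,
    since Ln (1/2) = - ln 2.\<close>
  let ?L = "\<lambda>x. v1 + of_real (ln 2) + Ln (1 - x)"
  have g: "?g t = exp (two_pi_i * of_real t) / 2" for t
    by (simp add: circlepath)
  have ng: "norm (?g t) = 1 / 2" for t
    by (simp add: g norm_divide)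
  have g01: "?g 0 = 1 / 2" "?g 1 = 1 / 2" by (simp_all add: g)
  have v: "exp v0 = 1 / 2" "exp v1 = - 1 / 2"
    using gs.lift_fib[OF m, of 0] m0 g01 by (auto simp: fib3_def)
  have nn: "1 - x \<notin> \<real>\<^sub>\<le>\<^sub>0" if "x \<in> ball 0 1" for x :: complex
    using that complex_Re_le_cmod[of x] by (auto simp: complex_nonpos_Reals_iff)
  have gb: "?g t \<in> ball 0 1" for t using ng[of t] by simp
  have L: "exp (?L x) = x - 1" "(?L has_field_derivative 1 / (x - 1)) (at x)" if "x \<in> ball 0 1" for x
  proof -
    have x1: "1 - x \<noteq> 0" "x - 1 \<noteq> 0" using that by auto
    then show "exp (?L x) = x - 1" by (simp add: exp_add v exp_of_real)
    have "1 / (1 - x) * - 1 = 1 / (x - 1)" using x1 by (simp add: field_simps)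
    then show "(?L has_field_derivative 1 / (x - 1)) (at x)"
      using nn[OF that] by (auto intro!: derivative_eq_intros simp: inverse_eq_divide)
  qed
  have l0: "fst (m s) = v0 + two_pi_i * of_real s" if s: "s \<in> {0..1}" for s
  proof -
    have "path (\<lambda>s. v0 + two_pi_i * of_real s)"
      unfolding path_def by (intro continuous_intros)
    then have "fst (m s) - v0 = two_pi_i * of_real s"
      using lift_log_increments(1)[OF path_circlepath m s, of "\<lambda>s. v0 + two_pi_i * of_real s"] m0
      by (simp add: g exp_add v)
    then show ?thesis by (simp add: algebra_simps)
  qed
  have l1: "fst (snd (m s)) = ?L (?g s)" if s: "s \<in> {0..1}" for s
  proof -
    have "path (\<lambda>s. ?L (?g s))"
      using path_circlepath[of 0 "1/2"] nn[OF gb] unfolding path_def by (intro continuous_intros) auto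
    then have "fst (snd (m s)) - fst (snd (m 0)) = ?L (?g s) - ?L (?g 0)"
      using lift_log_increments(2)[OF path_circlepath m s, of "\<lambda>s. ?L (?g s)"] L(1)[OF gb]
      by blast
    moreover have "?L (?g 0) = v1" by (simp add: g01 Ln_half)
    ultimately have "fst (snd (m s)) - v1 = ?L (?g s) - v1" using m0 by (simp only: fst_conv snd_conv)
    then show ?thesis by (metis diff_add_cancel)
  qed
  have "snd (snd (m 1)) - exp ((\<beta>0 + 1) * fst (m 1)) * K (?g 1) =
        snd (snd (m 0)) - exp ((\<beta>0 + 1) * fst (m 0)) * K (?g 0)"
  proof (rule lift_primitive[OF path_circlepath m, where H = "\<lambda>l0 l1 x. exp ((\<beta>0 + 1) * l0) * K x"])
    fix t :: real and U L0 L1 \<Phi>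
    assume t: "t \<in> {0..1}" and br: "branch3 \<beta>0 \<beta>1 U L0 L1 \<Phi>" and U: "?g t \<in> U"
      and mt: "m t = (L0 (?g t), L1 (?g t), \<Phi> (?g t))"
    have "open (U \<inter> ball 0 1)" using branch3D(1)[OF br] by auto
    then obtain \<eta> where \<eta>: "\<eta> > 0" "ball (?g t) \<eta> \<subseteq> U \<inter> ball 0 1"
      using U gb open_contains_ball by (metis IntI)
    \<comment> \<open>By \<open>l1\<close> the lift runs on the branch \<open>?L\<close>, so
      \<open>L1\<close> equals it near \<open>?g t\<close> and the equation for \<open>K\<close>,
      which is written with \<open>?L\<close>, can be used.\<close>
    have L1: "L1 x = ?L x" if x: "x \<in> ball (?g t) \<eta>" for x
    proof (rule has_field_derivative_eq_on_convex[OF convex_ball[of "?g t" \<eta>],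
          where f = L1 and g = ?L and d = "\<lambda>x. 1 / (x - 1)" and x = "?g t"])
      show "(L1 has_field_derivative 1 / (z - 1)) (at z)" "(?L has_field_derivative 1 / (z - 1)) (at z)"
        if "z \<in> ball (?g t) \<eta>" for z
        using branch3D(5)[OF br] L(2) \<eta>(2) that by blast+
      show "L1 (?g t) = ?L (?g t)" using l1[OF t] mt by simp
    qed (use x \<eta>(1) in auto)
    have "((\<lambda>x. exp ((\<beta>0 + 1) * L0 x) * K x) has_field_derivative exp (\<beta>0 * L0 x + \<beta>1 * L1 x)) (at x)"
      if x: "x \<in> ball (?g t) \<eta>" for x
    proof -
      have xU: "x \<in> U" "x \<in> ball 0 1" using x \<eta>(2) by auto
      have e: "exp (L0 x) = x" using branch3D(2)[OF br xU(1)] .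
      then have x0: "x \<noteq> 0" by (metis exp_not_eq_zero)
      have "((\<lambda>x. exp ((\<beta>0 + 1) * L0 x) * K x) has_field_derivative
          exp ((\<beta>0 + 1) * L0 x) * ((\<beta>0 + 1) * (1 / x)) * K x + K' x * exp ((\<beta>0 + 1) * L0 x)) (at x)"
        using branch3D(4)[OF br xU(1)] K[rule_format, OF xU(2)]
        by (auto intro!: derivative_eq_intros)
      moreover have "exp ((\<beta>0 + 1) * L0 x) * ((\<beta>0 + 1) * (1 / x)) * K x + K' x * exp ((\<beta>0 + 1) * L0 x) =
          exp ((\<beta>0 + 1) * L0 x) / x * (x * K' x + (\<beta>0 + 1) * K x)"
        using x0 by (simp add: field_simps)
      moreover have "exp ((\<beta>0 + 1) * L0 x) / x = exp (\<beta>0 * L0 x)"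
        using x0 e by (simp add: distrib_right exp_add)
      moreover have "x * K' x + (\<beta>0 + 1) * K x = exp (\<beta>1 * L1 x)"
        using K[rule_format, OF xU(2)] L1[OF x] by simp
      ultimately show ?thesis by (simp add: exp_add)
    qed
    then show "\<exists>\<eta>>0. \<forall>x\<in>ball (?g t) \<eta>. ((\<lambda>x. exp ((\<beta>0 + 1) * L0 x) * K x) has_field_derivative
        exp (\<beta>0 * L0 x + \<beta>1 * L1 x)) (at x)"
      using \<eta>(1) by blast
  qed
  moreover have "exp ((\<beta>0 + 1) * (v0 + two_pi_i)) = exp ((\<beta>0 + 1) * v0) * exp (two_pi_i * \<beta>0)"
    by (simp add: ring_distribs exp_add mult_ac)
  ultimately show ?thesis
    using l0[of 1] l1[of 1] m0 by (simp add: prod_eq_iff g01 Ln_half algebra_simps)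
qed

text \<open>The argument of \<open>circle_zero_monodromy\<close> in the local coordinate 1 - x. The
  negative radius lets the circle about 1 start at 1/2, where the circle about 0 starts, so that
  both can be lifted from one triple.\<close>

lemma circle_one_monodromy:
  assumes m: "gs.lift \<beta>0 \<beta>1 (circlepath 1 (- (1/2))) m" and m0: "m 0 = (v0, v1, f)"
    and K: "\<forall>x\<in>ball 0 1. (K has_field_derivative K' x) (at x) \<and>
       x * K' x + (\<beta>1 + 1) * K x = exp (\<beta>0 * (v0 + of_real (ln 2) + Ln (1 - x)))"
  shows "m 1 = (v0, v1 + two_pi_i,
     f + (exp (two_pi_i * \<beta>1) - 1) * (exp ((\<beta>1 + 1) * v1) * K (1 / 2)))"
proof -
  let ?g = "circlepath 1 (- (1/2))"
  let ?L = "\<lambda>x. v0 + of_real (ln 2) + Ln x"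
  have g: "?g t = 1 - exp (two_pi_i * of_real t) / 2" for t
    by (simp add: circlepath)
  have ng: "norm (1 - ?g t) = 1 / 2" for t
    by (simp add: g norm_divide)
  have g01: "?g 0 = 1 / 2" "?g 1 = 1 / 2" by (simp_all add: g)
  have v: "exp v0 = 1 / 2" "exp v1 = - 1 / 2"
    using gs.lift_fib[OF m, of 0] m0 g01 by (auto simp: fib3_def)
  have nn: "x \<notin> \<real>\<^sub>\<le>\<^sub>0" if "x \<in> ball 1 1" for x :: complex
    using that complex_Re_le_cmod[of "1 - x"] by (auto simp: complex_nonpos_Reals_iff dist_norm)
  have gb: "?g t \<in> ball 1 1" for t using ng[of t] by (simp add: dist_norm)
  have L: "exp (?L x) = x" "(?L has_field_derivative 1 / x) (at x)" if "x \<in> ball 1 1" for x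
  proof -
    have x1: "x \<noteq> 0" using that by auto
    then show "exp (?L x) = x" by (simp add: exp_add v exp_of_real)
    show "(?L has_field_derivative 1 / x) (at x)"
      using nn[OF that] by (auto intro!: derivative_eq_intros simp: inverse_eq_divide)
  qed
  have l1: "fst (snd (m s)) = v1 + two_pi_i * of_real s" if s: "s \<in> {0..1}" for s
  proof -
    have "path (\<lambda>s. v1 + two_pi_i * of_real s)"
      unfolding path_def by (intro continuous_intros)
    then have "fst (snd (m s)) - v1 = two_pi_i * of_real s"
      using lift_log_increments(2)[OF path_circlepath m s, of "\<lambda>s. v1 + two_pi_i * of_real s"] m0
      by (simp add: g exp_add v)
    then show ?thesis by (simp add: algebra_simps)
  qed
  have l0: "fst (m s) = ?L (?g s)" if s: "s \<in> {0..1}" for s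
  proof -
    have "path (\<lambda>s. ?L (?g s))"
      using path_circlepath[of 1 "- (1/2)"] nn[OF gb] unfolding path_def by (intro continuous_intros) auto
    then have "fst (m s) - fst (m 0) = ?L (?g s) - ?L (?g 0)"
      using lift_log_increments(1)[OF path_circlepath m s, of "\<lambda>s. ?L (?g s)"] L(1)[OF gb]
      by blast
    moreover have "?L (?g 0) = v0" by (simp add: g01 Ln_half)
    ultimately have "fst (m s) - v0 = ?L (?g s) - v0" using m0 by (simp only: fst_conv snd_conv)
    then show ?thesis by (metis diff_add_cancel)
  qed
  have "snd (snd (m 1)) - exp ((\<beta>1 + 1) * fst (snd (m 1))) * K (1 - ?g 1) =
        snd (snd (m 0)) - exp ((\<beta>1 + 1) * fst (snd (m 0))) * K (1 - ?g 0)"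
  proof (rule lift_primitive[OF path_circlepath m, where H = "\<lambda>l0 l1 x. exp ((\<beta>1 + 1) * l1) * K (1 - x)"])
    fix t :: real and U L0 L1 \<Phi>
    assume t: "t \<in> {0..1}" and br: "branch3 \<beta>0 \<beta>1 U L0 L1 \<Phi>" and U: "?g t \<in> U"
      and mt: "m t = (L0 (?g t), L1 (?g t), \<Phi> (?g t))"
    have "open (U \<inter> ball 1 1)" using branch3D(1)[OF br] by auto
    then obtain \<eta> where \<eta>: "\<eta> > 0" "ball (?g t) \<eta> \<subseteq> U \<inter> ball 1 1"
      using U gb open_contains_ball by (metis IntI)
    have L0: "L0 x = ?L x" if x: "x \<in> ball (?g t) \<eta>" for x
    proof (rule has_field_derivative_eq_on_convex[OF convex_ball[of "?g t" \<eta>],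
          where f = L0 and g = ?L and d = "\<lambda>x. 1 / x" and x = "?g t"])
      show "(L0 has_field_derivative 1 / z) (at z)" "(?L has_field_derivative 1 / z) (at z)"
        if "z \<in> ball (?g t) \<eta>" for z
        using branch3D(4)[OF br] L(2) \<eta>(2) that by blast+
      show "L0 (?g t) = ?L (?g t)" using l0[OF t] mt by simp
    qed (use x \<eta>(1) in auto)
    have "((\<lambda>x. exp ((\<beta>1 + 1) * L1 x) * K (1 - x)) has_field_derivative exp (\<beta>0 * L0 x + \<beta>1 * L1 x)) (at x)"
      if x: "x \<in> ball (?g t) \<eta>" for x
    proof -
      have xU: "x \<in> U" "x \<in> ball 1 1" using x \<eta>(2) by auto
      have y: "1 - x \<in> ball 0 1" using xU(2) by (simp add: dist_norm norm_minus_commute)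
      have e: "exp (L1 x) = x - 1" using branch3D(3)[OF br xU(1)] .
      then have x0: "x - 1 \<noteq> 0" by (metis exp_not_eq_zero)
      have "((\<lambda>x. 1 - x) has_field_derivative - 1) (at x)"
        by (auto intro!: derivative_eq_intros)
      then have dK: "((\<lambda>x. K (1 - x)) has_field_derivative K' (1 - x) * - 1) (at x)"
        using K[rule_format, OF y] by (intro DERIV_chain2) auto
      have "((\<lambda>x. exp ((\<beta>1 + 1) * L1 x) * K (1 - x)) has_field_derivative
          exp ((\<beta>1 + 1) * L1 x) * ((\<beta>1 + 1) * (1 / (x - 1))) * K (1 - x) + (K' (1 - x) * - 1) * exp ((\<beta>1 + 1) * L1 x)) (at x)"
        using branch3D(5)[OF br xU(1)] dK
        by (auto intro!: derivative_eq_intros)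
      moreover have "exp ((\<beta>1 + 1) * L1 x) * ((\<beta>1 + 1) * (1 / (x - 1))) * K (1 - x) + (K' (1 - x) * - 1) * exp ((\<beta>1 + 1) * L1 x) =
          exp ((\<beta>1 + 1) * L1 x) / (x - 1) * ((1 - x) * K' (1 - x) + (\<beta>1 + 1) * K (1 - x))"
        using x0 by (simp add: field_simps)
      moreover have "exp ((\<beta>1 + 1) * L1 x) / (x - 1) = exp (\<beta>1 * L1 x)"
        using x0 e by (simp add: distrib_right exp_add)
      moreover have "(1 - x) * K' (1 - x) + (\<beta>1 + 1) * K (1 - x) = exp (\<beta>0 * L0 x)"
        using K[rule_format, OF y] L0[OF x] by simp
      moreover have "exp (\<beta>0 * L0 x + \<beta>1 * L1 x) = exp (\<beta>1 * L1 x) * exp (\<beta>0 * L0 x)"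
        by (simp add: exp_add)
      ultimately show ?thesis by simp
    qed
    then show "\<exists>\<eta>>0. \<forall>x\<in>ball (?g t) \<eta>. ((\<lambda>x. exp ((\<beta>1 + 1) * L1 x) * K (1 - x)) has_field_derivative
        exp (\<beta>0 * L0 x + \<beta>1 * L1 x)) (at x)"
      using \<eta>(1) by blast
  qed
  moreover have "exp ((\<beta>1 + 1) * (v1 + two_pi_i)) = exp ((\<beta>1 + 1) * v1) * exp (two_pi_i * \<beta>1)"
    by (simp add: ring_distribs exp_add mult_ac)
  ultimately show ?thesis
    using l0[of 1] l1[of 1] m0 by (simp add: prod_eq_iff g01 Ln_half algebra_simps)
qed


text \<open>\<open>X\<close> and \<open>Z\<close> are the values at 1/2 of the primitives that
  vanish at 0 and at 1. An affine map with factor different from 1 has one fixed point, which forces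
  both to equal \<open>f - s\<close>. Up to a common nonzero factor, \<open>X\<close> is the
  integral over [0, 1/2] and \<open>- Z\<close> the integral over [1/2, 1], and
  \<open>X - Z = 0\<close>.\<close>

lemma beta_integral_zero_if_circles_multiplicative:
  assumes \<beta>: "Re \<beta>0 > 0" "Re \<beta>1 > 0"
    and ne: "exp (two_pi_i * \<beta>0) \<noteq> 1" "exp (two_pi_i * \<beta>1) \<noteq> 1"
    and m: "gs.lift \<beta>0 \<beta>1 (circlepath 0 (1/2)) m" "m 0 = (v0, v1, f)"
      "snd (snd (m 1)) - s = exp (\<beta>0 * (fst (m 1) - v0) + \<beta>1 * (fst (snd (m 1)) - v1)) * (f - s)"
    and m': "gs.lift \<beta>0 \<beta>1 (circlepath 1 (- (1/2))) m'" "m' 0 = (v0, v1, f)"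
      "snd (snd (m' 1)) - s = exp (\<beta>0 * (fst (m' 1) - v0) + \<beta>1 * (fst (snd (m' 1)) - v1)) * (f - s)"
  shows "((\<lambda>t. of_real t powr \<beta>0 * of_real (1 - t) powr \<beta>1) has_integral 0) {0..1::real}"
proof -
  let ?\<phi> = "\<lambda>t::real. complex_of_real t powr \<beta>0 * of_real (1 - t) powr \<beta>1"
  \<comment> \<open>Adding ln 2 turns the logarithms at 1/2 into a logarithm \<open>w0\<close> of 1
    and a logarithm \<open>w1\<close> of -1.\<close>
  define w0 w1 where "w0 = v0 + of_real (ln 2)" and "w1 = v1 + of_real (ln 2)"
  have v: "exp v0 = 1 / 2" "exp v1 = - 1 / 2"
    using gs.lift_fib[OF m(1), of 0] m(2) by (auto simp: fib3_def circlepath)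
  have w: "exp w0 = 1" "exp w1 = - 1"
    by (simp_all add: w0_def w1_def exp_add v exp_of_real)
  have nn: "1 - x \<notin> \<real>\<^sub>\<le>\<^sub>0" if "x \<in> ball 0 1" for x :: complex
    using that complex_Re_le_cmod[of x] by (auto simp: complex_nonpos_Reals_iff)
  have hol: "(\<lambda>x. exp (b * (w + Ln (1 - x)))) holomorphic_on ball 0 1" for b w
    using nn by (intro holomorphic_intros) auto
  have b: "Re (\<beta>0 + 1) > 0" "Re (\<beta>1 + 1) > 0" using \<beta> by simp_all
  obtain K K' where K: "\<forall>x\<in>ball 0 1. (K has_field_derivative K' x) (at x) \<and>
      x * K' x + (\<beta>0 + 1) * K x = exp (\<beta>1 * (w1 + Ln (1 - x)))"
    using frobenius_solution[OF hol b(1)] by blast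
  obtain J J' where J: "\<forall>x\<in>ball 0 1. (J has_field_derivative J' x) (at x) \<and>
      x * J' x + (\<beta>1 + 1) * J x = exp (\<beta>0 * (w0 + Ln (1 - x)))"
    using frobenius_solution[OF hol b(2)] by blast
  have cancel: "x = f - s" if "y = f + (B - 1) * x" "y - s = B * (f - s)" "B \<noteq> 1" for x y B
  proof -
    have "(B - 1) * (f - s) = y - f" by (simp add: left_diff_distrib that(2)[symmetric])
    also have "\<dots> = (B - 1) * x" using that(1) by simp
    finally show ?thesis using that(3) by simp
  qed
  define X where "X = exp ((\<beta>0 + 1) * v0) * K (1 / 2)"
  define Z where "Z = exp ((\<beta>1 + 1) * v1) * J (1 / 2)"
  have m1: "m 1 = (v0 + two_pi_i, v1, f + (exp (two_pi_i * \<beta>0) - 1) * X)"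
    unfolding X_def by (rule circle_zero_monodromy[OF m(1,2) K[unfolded w1_def]])
  have X: "X = f - s"
    by (rule cancel[OF refl _ ne(1)]) (use m(3) in \<open>simp add: m1 mult.commute\<close>)
  have m1': "m' 1 = (v0, v1 + two_pi_i, f + (exp (two_pi_i * \<beta>1) - 1) * Z)"
    unfolding Z_def by (rule circle_one_monodromy[OF m'(1,2) J[unfolded w0_def]])
  have Z: "Z = f - s"
    by (rule cancel[OF refl _ ne(2)]) (use m'(3) in \<open>simp add: m1' mult.commute\<close>)
  have half: "exp (c * (x + of_real (ln 2))) * (1 / 2) powr c = exp (c * x)" for c x :: complex
  proof -
    have "(1 / 2 :: complex) powr c = exp (- (c * of_real (ln 2)))"
      by (simp add: powr_def Ln_half)
    then show ?thesis by (simp add: exp_add[symmetric] distrib_left)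
  qed
  have I0: "((\<lambda>t. exp (\<beta>1 * w1) * ?\<phi> t) has_integral (1 / 2) powr (\<beta>0 + 1) * K (1 / 2)) {0..1/2}"
    using half_beta_integral[OF b(1) K] by simp
  have "((\<lambda>t. exp ((\<beta>0 + 1) * w0) * (exp (\<beta>1 * w1) * ?\<phi> t)) has_integral X) {0..1/2}"
    using has_integral_mult_right[OF I0, of "exp ((\<beta>0 + 1) * w0)"] half[of "\<beta>0 + 1" v0]
    by (simp add: X_def w0_def flip: mult.assoc)
  moreover have "exp ((\<beta>0 + 1) * w0) = exp (\<beta>0 * w0)"
    by (simp add: distrib_right exp_add w)
  ultimately have A: "((\<lambda>t. exp (\<beta>0 * w0) * exp (\<beta>1 * w1) * ?\<phi> t) has_integral X) {0..1/2}"
    by (simp add: mult.assoc)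
  have "((\<lambda>t. exp (\<beta>0 * w0) * (of_real t powr \<beta>1 * of_real (1 - t) powr \<beta>0)) has_integral
     (1 / 2) powr (\<beta>1 + 1) * J (1 / 2)) {0..1/2::real}"
    using half_beta_integral[OF b(2) J] by simp
  \<comment> \<open>The reflection t -> 1 - t maps [0, 1/2] onto [1/2, 1] and exchanges the two
    powers.\<close>
  moreover have "(\<lambda>x::real. (1 / - 1) *\<^sub>R x + - ((1 / - 1) *\<^sub>R 1)) ` cbox 0 (1/2) = {1/2..1}"
    by (simp add: image_affinity_atLeastAtMost[of "- 1" 1, simplified])
  ultimately have I1: "((\<lambda>t. exp (\<beta>0 * w0) * ?\<phi> t) has_integral (1 / 2) powr (\<beta>1 + 1) * J (1 / 2)) {1/2..1}"
    using has_integral_affinity[of "\<lambda>t. exp (\<beta>0 * w0) * (of_real t powr \<beta>1 * of_real (1 - t) powr \<beta>0)"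
        "(1 / 2) powr (\<beta>1 + 1) * J (1 / 2)" 0 "1/2" "- 1" 1]
    by (simp add: mult_ac)
  have "((\<lambda>t. exp ((\<beta>1 + 1) * w1) * (exp (\<beta>0 * w0) * ?\<phi> t)) has_integral Z) {1/2..1}"
    using has_integral_mult_right[OF I1, of "exp ((\<beta>1 + 1) * w1)"] half[of "\<beta>1 + 1" v1]
    by (simp add: Z_def w1_def flip: mult.assoc)
  \<comment> \<open>Here \<open>exp w1 = - 1\<close> produces the minus sign: the second primitive
    is integrated from 1 down to 1/2.\<close>
  moreover have "exp ((\<beta>1 + 1) * w1) = - exp (\<beta>1 * w1)"
    by (simp add: distrib_right exp_add w)
  ultimately have "((\<lambda>t. - (exp (\<beta>0 * w0) * exp (\<beta>1 * w1) * ?\<phi> t)) has_integral Z) {1/2..1}"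
    by (simp add: mult_ac)
  from has_integral_neg[OF this]
  have "((\<lambda>t. exp (\<beta>0 * w0) * exp (\<beta>1 * w1) * ?\<phi> t) has_integral - Z) {1/2..1}"
    by simp
  with A have "((\<lambda>t. exp (\<beta>0 * w0) * exp (\<beta>1 * w1) * ?\<phi> t) has_integral (X + - Z)) {0..1}"
    by (intro has_integral_combine[of 0 "1/2" 1]) auto
  then have "((\<lambda>t. exp (\<beta>0 * w0) * exp (\<beta>1 * w1) * ?\<phi> t) has_integral 0) {0..1}"
    using X Z by simp
  moreover have "(\<phi> has_integral 0) A" if "((\<lambda>t. c * \<phi> t) has_integral 0) A" "c \<noteq> 0"
    for c :: complex and \<phi> and A :: "real set"
    using has_integral_mult_right[OF that(1), of "inverse c"] that(2) by (simp flip: mult.assoc)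
  ultimately show ?thesis by simp
qed

text \<open>\<open>\<phi>\<close> is orthogonal to all polynomials and uniformly approximated by
  them. So the integral of its square is at most \<open>M * e\<close> for every
  \<open>e > 0\<close>.\<close>

lemma vanishing_moments_real:
  fixes \<phi> :: "real \<Rightarrow> real"
  assumes c: "continuous_on {0..1} \<phi>" and z: "\<And>n. integral {0..1} (\<lambda>t. t ^ n * \<phi> t) = 0"
    and t: "t \<in> {0..1}"
  shows "\<phi> t = 0"
proof -
  have int: "f integrable_on {0..1}" if "continuous_on {0..1} f" for f :: "real \<Rightarrow> real"
    using that integrable_continuous_interval by blast
  have poly: "integral {0..1} (\<lambda>t. p t * \<phi> t) = 0" if rp: "real_polynomial_function p" for p
  proof -
    obtain a n where p: "p = (\<lambda>x. \<Sum>i\<le>n. a i * x ^ i)"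
      using rp unfolding real_polynomial_function_iff_sum by blast
    have "integral {0..1} (\<lambda>t. p t * \<phi> t) = integral {0..1} (\<lambda>t. \<Sum>i\<le>n. a i * (t ^ i * \<phi> t))"
      by (simp add: p sum_distrib_right mult.assoc)
    also have "\<dots> = (\<Sum>i\<le>n. integral {0..1} (\<lambda>t. a i * (t ^ i * \<phi> t)))"
      using c by (intro integral_sum int continuous_intros) auto
    also have "\<dots> = 0" using z by simp
    finally show ?thesis .
  qed
  obtain M where M: "\<And>t. t \<in> {0..1} \<Longrightarrow> \<bar>\<phi> t\<bar> \<le> M" "M > 0"
  proof -
    have "bounded (\<phi> ` {0..1})" using c compact_continuous_image compact_imp_bounded by blast
    then obtain B where "B > 0" "\<forall>x\<in>\<phi> ` {0..1}. norm x \<le> B" unfolding bounded_pos by blast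
    then show thesis by (intro that[of B]) auto
  qed
  have bound: "\<bar>integral {0..1} (\<lambda>t. \<phi> t * \<phi> t)\<bar> \<le> M * e" if e: "e > 0" for e
  proof -
    obtain p where p: "real_polynomial_function p" "\<And>x. x \<in> {0..1} \<Longrightarrow> \<bar>\<phi> x - p x\<bar> < e"
      using Stone_Weierstrass_real_polynomial_function[OF compact_Icc c e] by blast
    have cp: "continuous_on {0..1} p"
      using p(1) continuous_on_polymonial_function real_polynomial_function_eq by blast
    have "integral {0..1} (\<lambda>t. \<phi> t * \<phi> t) = integral {0..1} (\<lambda>t. \<phi> t * \<phi> t) - integral {0..1} (\<lambda>t. p t * \<phi> t)"
      using poly[OF p(1)] by simp
    also have "\<dots> = integral {0..1} (\<lambda>t. \<phi> t * \<phi> t - p t * \<phi> t)"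
      using c cp by (intro integral_diff[symmetric] int continuous_intros)
    also have "norm \<dots> \<le> M * e * (1 - 0)"
    proof (rule integral_bound)
      show "continuous_on {0..1} (\<lambda>t. \<phi> t * \<phi> t - p t * \<phi> t)"
        using c cp by (intro continuous_intros)
      fix x :: real assume x: "x \<in> {0..1}"
      have "norm (\<phi> x * \<phi> x - p x * \<phi> x) = \<bar>\<phi> x\<bar> * \<bar>\<phi> x - p x\<bar>"
        by (simp add: abs_mult[symmetric] algebra_simps)
      also have "\<dots> \<le> M * e"
        using M(1)[OF x] M(2) p(2)[OF x] by (intro mult_mono) auto
      finally show "norm (\<phi> x * \<phi> x - p x * \<phi> x) \<le> M * e" .
    qed simp
    finally show ?thesis by simp
  qed
  have "integral {0..1} (\<lambda>t. \<phi> t * \<phi> t) = 0" (is "?I = 0")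
  proof (rule ccontr)
    assume "?I \<noteq> 0"
    then have "\<bar>?I\<bar> > 0" "\<bar>?I\<bar> / (2 * M) > 0" using M(2) by auto
    with bound[OF this(2)] M(2) show False by simp
  qed
  moreover have "continuous_on {0..1} (\<lambda>t. \<phi> t * \<phi> t)" using c by (intro continuous_intros)
  ultimately have "\<forall>t\<in>{0..1}. \<phi> t * \<phi> t = 0"
    using integral_eq_0_iff[of 0 1 "\<lambda>t. \<phi> t * \<phi> t"] by simp
  then show ?thesis using t by auto
qed

text \<open>A shift by \<open>n\<close> multiplies the integrand by \<open>t ^ n\<close>. If every
  shift gave 0, all moments of its real and imaginary parts would vanish, and the integrand would be
  0 at t = 1/2.\<close>

lemma beta_integral_shift_nonzero:
  assumes "Re \<beta>0 > 0" "Re \<beta>1 > 0"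
  obtains n :: nat where
    "\<not> ((\<lambda>t. of_real t powr (\<beta>0 + of_nat n) * of_real (1 - t) powr \<beta>1) has_integral 0) {0..1::real}"
proof (rule ccontr)
  let ?\<phi> = "\<lambda>t::real. complex_of_real t powr \<beta>0 * of_real (1 - t) powr \<beta>1"
  assume "\<not> thesis"
  then have *: "((\<lambda>t. of_real t powr (\<beta>0 + of_nat n) * of_real (1 - t) powr \<beta>1) has_integral 0) {0..1::real}" for n
    using that by blast
  have eq: "complex_of_real t powr (\<beta>0 + of_nat n) * of_real (1 - t) powr \<beta>1 = of_real (t ^ n) * ?\<phi> t" for n t
    by (cases "t = 0") (auto simp: powr_add powr_nat)
  have "((\<lambda>t. of_real (t ^ n) * ?\<phi> t) has_integral 0) {0..1}" for n
    using *[of n] unfolding eq .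
  from has_integral_Re[OF this] has_integral_Im[OF this]
  have z: "integral {0..1} (\<lambda>t. t ^ n * Re (?\<phi> t)) = 0" "integral {0..1} (\<lambda>t. t ^ n * Im (?\<phi> t)) = 0" for n
    by (auto simp flip: of_real_power simp: integral_unique)
  have c: "continuous_on {0..1} ?\<phi>"
    using assms by (intro continuous_intros) auto
  have "Re (?\<phi> (1/2)) = 0"
    by (rule vanishing_moments_real[of "\<lambda>t. Re (?\<phi> t)", OF continuous_on_Re[OF c] z(1)]) simp
  moreover have "Im (?\<phi> (1/2)) = 0"
    by (rule vanishing_moments_real[of "\<lambda>t. Im (?\<phi> t)", OF continuous_on_Im[OF c] z(2)]) simp
  ultimately have "?\<phi> (1/2) = 0" by (simp only: complex_eq_iff) simp
  then show False by simp
qed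

section \<open>The coordinate sending three points of the sphere to 0, 1 and infinity\<close>

text \<open>Homogeneous coordinates [\<open>hnum\<close> : \<open>hden\<close>], normalised so that
  \<open>hden\<close> is 0 or 1. With them the formulas below are the same whether or not infinity
  is among the three points.\<close>

fun hnum :: "cp1 \<Rightarrow> complex" where
  "hnum (CFin z) = z" | "hnum CInf = 1"

fun hden :: "cp1 \<Rightarrow> complex" where
  "hden (CFin z) = 1" | "hden CInf = 0"

text \<open>The linear form in the homogeneous coordinates of \<open>x\<close> that vanishes at \<open>a\<close>.\<close>

definition lin :: "cp1 \<Rightarrow> cp1 \<Rightarrow> complex" where
  "lin a x = hden a * hnum x - hnum a * hden x"

lemma lin_eq_0_iff: "lin a x = 0 \<longleftrightarrow> x = a"
  by (cases a; cases x) (auto simp: lin_def)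

lemma lin_CFin: "lin a (CFin z) = hden a * z - hnum a"
  by (simp add: lin_def)

lemma lin_chart_inf: "lin a (chart_inf w) = (hden a - hnum a * w) / (if w = 0 then 1 else w)"
  by (auto simp: lin_def chart_inf_def field_simps)

definition hpoint :: "complex \<Rightarrow> complex \<Rightarrow> cp1" where
  "hpoint x y = (if y = 0 then CInf else CFin (x / y))"

lemma lin_hpoint:
  "x \<noteq> 0 \<or> y \<noteq> 0 \<Longrightarrow> lin a (hpoint x y) = (hden a * x - hnum a * y) / (if y = 0 then x else y)"
  by (auto simp: lin_def hpoint_def field_simps)

text \<open>The preimage of an open set is the union of two open parts: where \<open>g\<close> is
  nonzero it is seen in the chart \<open>CFin\<close>, where \<open>f\<close> is nonzero in
  \<open>chart_inf\<close>.\<close>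

lemma continuous_on_hpoint:
  assumes "open T" "continuous_on T f" "continuous_on T g" and nz: "\<And>t. t \<in> T \<Longrightarrow> f t \<noteq> 0 \<or> g t \<noteq> 0"
  shows "continuous_on T (\<lambda>t. hpoint (f t) (g t))"
  unfolding continuous_on_open_vimage[OF assms(1)]
proof (intro allI impI)
  fix U :: "cp1 set" assume U: "open U"
  let ?A = "T \<inter> g -` (- {0})" and ?B = "T \<inter> f -` (- {0})"
  have AB: "open ?A" "open ?B"
    using assms by (auto intro!: continuous_open_preimage)
  have "continuous_on ?A (\<lambda>t. f t / g t)" "continuous_on ?B (\<lambda>t. g t / f t)"
    using assms(2,3) by (auto intro!: continuous_intros intro: continuous_on_subset)
  then have "open (?A \<inter> (\<lambda>t. f t / g t) -` (CFin -` U))" "open (?B \<inter> (\<lambda>t. g t / f t) -` (chart_inf -` U))"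
    using AB U by (auto intro!: continuous_open_preimage simp: open_cp1_def)
  moreover have "(\<lambda>t. hpoint (f t) (g t)) -` U \<inter> T =
      (?A \<inter> (\<lambda>t. f t / g t) -` (CFin -` U)) \<union> (?B \<inter> (\<lambda>t. g t / f t) -` (chart_inf -` U))"
    using nz by (auto simp: hpoint_def chart_inf_def split: if_splits)
  ultimately show "open ((\<lambda>t. hpoint (f t) (g t)) -` U \<inter> T)"
    by (simp add: open_Un)
qed

lemma open_Compl_finite_cp1:
  assumes "finite D"
  shows "open (- D :: cp1 set)"
proof -
  have "open (- {a})" for a :: cp1
  proof (cases a)
    case (CFin z)
    have "CFin -` (- {CFin z}) = - {z}" by auto
    moreover have "chart_inf -` (- {CFin z}) = (if z = 0 then UNIV else - {inverse z})"
      by (auto simp: chart_inf_def split: if_splits)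
    ultimately show ?thesis using CFin by (simp add: open_cp1_def open_Compl)
  next
    case CInf
    have "CFin -` (- {CInf}) = UNIV" "chart_inf -` (- {CInf}) = - {0}"
      by (auto simp: chart_inf_def)
    then show ?thesis using CInf by (simp add: open_cp1_def open_Compl)
  qed
  then have "open (\<Inter>a\<in>D. - {a})" using assms by (intro open_INT) auto
  moreover have "(\<Inter>a\<in>D. - {a}) = - D" by auto
  ultimately show ?thesis by simp
qed

lemma cp1_holomorphic_on_imp_continuous_on:
  assumes "open U" "cp1_holomorphic_on f U"
  shows "continuous_on U f"
  unfolding continuous_on_open_vimage[OF assms(1)]
proof (intro allI impI)
  fix V :: "complex set" assume V: "open V"
  have "open (CFin -` U)" "open (chart_inf -` U)" using assms(1) by (auto simp: open_cp1_def)
  moreover have "continuous_on (CFin -` U) (\<lambda>z. f (CFin z))" "continuous_on (chart_inf -` U) (\<lambda>z. f (chart_inf z))"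
    using assms(2) by (auto simp: cp1_holomorphic_on_def holomorphic_on_imp_continuous_on)
  ultimately have "open (CFin -` U \<inter> (\<lambda>z. f (CFin z)) -` V)" "open (chart_inf -` U \<inter> (\<lambda>z. f (chart_inf z)) -` V)"
    using V by (auto intro!: continuous_open_preimage)
  moreover have "CFin -` (f -` V \<inter> U) = CFin -` U \<inter> (\<lambda>z. f (CFin z)) -` V"
    "chart_inf -` (f -` V \<inter> U) = chart_inf -` U \<inter> (\<lambda>z. f (chart_inf z)) -` V" by auto
  ultimately show "open (f -` V \<inter> U)" by (simp add: open_cp1_def)
qed

lemma cp1_holomorphic_on_subset: "cp1_holomorphic_on f U \<Longrightarrow> V \<subseteq> U \<Longrightarrow> cp1_holomorphic_on f V"
  unfolding cp1_holomorphic_on_def by (meson holomorphic_on_subset vimage_mono)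

lemma cp1_holomorphic_on_compose:
  assumes "cp1_holomorphic_on f U" "h holomorphic_on V" "f ` U \<subseteq> V"
  shows "cp1_holomorphic_on (\<lambda>x. h (f x)) U"
proof -
  have "(\<lambda>z. f (CFin z)) ` (CFin -` U) \<subseteq> V" "(\<lambda>z. f (chart_inf z)) ` (chart_inf -` U) \<subseteq> V"
    using assms(3) by auto
  then show ?thesis
    using assms(1,2) holomorphic_on_compose_gen[of _ _ h V]
    unfolding cp1_holomorphic_on_def o_def by blast
qed

locale three_points =
  fixes a1 a2 a3 :: cp1
  assumes distinct: "a1 \<noteq> a2" "a2 \<noteq> a3" "a1 \<noteq> a3"
begin

abbreviation "D \<equiv> {a1, a2, a3}"

text \<open>The factor that makes \<open>tau a2 = 1\<close>; the sign comes from the antisymmetry of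
  \<open>lin\<close>.\<close>

definition scal :: complex where "scal = - lin a3 a2 / lin a2 a1"

definition tau :: "cp1 \<Rightarrow> complex" where "tau x = scal * lin a1 x / lin a3 x"

text \<open>The solution \<open>x\<close> of \<open>t * lin a3 x = scal * lin a1 x\<close> in
  homogeneous coordinates. It brings loops and neighbourhoods from the t-plane back to the
  sphere.\<close>

definition sigma :: "complex \<Rightarrow> cp1" where
  "sigma t = hpoint (t * hnum a3 - scal * hnum a1) (t * hden a3 - scal * hden a1)"

lemma scal_nonzero: "scal \<noteq> 0"
  using distinct by (simp add: scal_def lin_eq_0_iff)

lemma tau_minus_1:
  assumes "x \<noteq> a3"
  shows "tau x - 1 = lin a1 a3 / lin a2 a1 * lin a2 x / lin a3 x"
proof -
  have nz: "lin a3 x \<noteq> 0" "lin a2 a1 \<noteq> 0" using assms distinct by (simp_all add: lin_eq_0_iff)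
  \<comment> \<open>The three-term Pluecker relation for \<open>a1\<close>, \<open>a2\<close>,
    \<open>a3\<close> and \<open>x\<close>.\<close>
  have "- lin a3 a2 * lin a1 x - lin a2 a1 * lin a3 x = lin a1 a3 * lin a2 x"
    by (simp add: lin_def algebra_simps)
  then show ?thesis using nz by (simp add: tau_def scal_def field_simps)
qed

lemma tau_in: "x \<notin> D \<Longrightarrow> tau x \<in> - {0, 1}"
  using tau_minus_1[of x] scal_nonzero distinct lin_eq_0_iff
  by (auto simp: tau_def)

lemma tau_CFin: "tau (CFin z) = scal * (hden a1 * z - hnum a1) / (hden a3 * z - hnum a3)"
  by (simp add: tau_def lin_CFin)

lemma tau_chart_inf: "tau (chart_inf w) = scal * (hden a1 - hnum a1 * w) / (hden a3 - hnum a3 * w)"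
  by (simp add: tau_def lin_chart_inf)

lemma tau_holomorphic: "cp1_holomorphic_on tau (- {a3})"
proof -
  have "hden a3 * z - hnum a3 \<noteq> 0" if "CFin z \<noteq> a3" for z
    using that lin_eq_0_iff[of a3 "CFin z"] by (simp add: lin_CFin)
  moreover have "hden a3 - hnum a3 * w \<noteq> 0" if "chart_inf w \<noteq> a3" for w
    using that lin_eq_0_iff[of a3 "chart_inf w"] by (auto simp: lin_chart_inf split: if_splits)
  ultimately show ?thesis
    unfolding cp1_holomorphic_on_def tau_CFin tau_chart_inf
    by (auto intro!: holomorphic_intros)
qed

lemma open_Compl_D: "open (- D)"
  by (rule open_Compl_finite_cp1) simp

lemma tau_continuous: "continuous_on (- D) tau"
  using tau_holomorphic open_Compl_D
  by (auto intro!: cp1_holomorphic_on_imp_continuous_on intro: cp1_holomorphic_on_subset)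

lemma sigma_aux: "t * hnum a3 - scal * hnum a1 \<noteq> 0 \<or> t * hden a3 - scal * hden a1 \<noteq> 0"
proof (rule ccontr)
  assume *: "\<not> ?thesis"
  have "scal * lin a1 a3 = hnum a3 * (t * hden a3 - scal * hden a1) * (- 1) + hden a3 * (t * hnum a3 - scal * hnum a1)"
    by (simp add: lin_def algebra_simps)
  then show False using * scal_nonzero distinct lin_eq_0_iff by auto
qed

lemma lin_sigma:
  fixes t
  defines "r \<equiv> (if t * hden a3 - scal * hden a1 = 0 then t * hnum a3 - scal * hnum a1 else t * hden a3 - scal * hden a1)"
  shows "r \<noteq> 0" "lin a1 (sigma t) = t * lin a1 a3 / r" "lin a3 (sigma t) = scal * lin a1 a3 / r"
proof -
  show "r \<noteq> 0" using sigma_aux[of t] by (auto simp: r_def)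
  have e: "lin a (sigma t) = (hden a * (t * hnum a3 - scal * hnum a1) - hnum a * (t * hden a3 - scal * hden a1)) / r" for a
    unfolding sigma_def lin_hpoint[OF sigma_aux] r_def by simp
  show "lin a1 (sigma t) = t * lin a1 a3 / r" "lin a3 (sigma t) = scal * lin a1 a3 / r"
    unfolding e by (simp_all add: lin_def algebra_simps)
qed

lemma tau_sigma: "tau (sigma t) = t"
proof -
  have "lin a1 a3 \<noteq> 0" using distinct by (simp add: lin_eq_0_iff)
  then show ?thesis using scal_nonzero lin_sigma[of t] by (simp add: tau_def)
qed

lemma sigma_not_a3: "sigma t \<noteq> a3"
proof -
  have "lin a1 a3 \<noteq> 0" using distinct by (simp add: lin_eq_0_iff)
  then have "lin a3 (sigma t) \<noteq> 0" using scal_nonzero lin_sigma[of t] by simp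
  then show ?thesis by (simp add: lin_eq_0_iff)
qed

lemma tau_inject:
  assumes "x \<noteq> a3" "y \<noteq> a3" "tau x = tau y"
  shows "x = y"
proof -
  have "lin a3 x \<noteq> 0" "lin a3 y \<noteq> 0" using assms lin_eq_0_iff by auto
  then have "lin a1 x * lin a3 y = lin a1 y * lin a3 x"
    using assms(3) scal_nonzero by (simp add: tau_def field_simps)
  moreover have "lin a1 x * lin a3 y - lin a1 y * lin a3 x = lin a1 a3 * lin x y"
    by (simp add: lin_def algebra_simps)
  ultimately have "lin a1 a3 * lin x y = 0" by simp
  then show ?thesis using distinct by (simp add: lin_eq_0_iff)
qed

lemma sigma_tau: "x \<noteq> a3 \<Longrightarrow> sigma (tau x) = x"
  by (metis sigma_not_a3 tau_inject tau_sigma)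

lemma sigma_in: "t \<in> - {0, 1} \<Longrightarrow> sigma t \<in> - D"
proof -
  assume t: "t \<in> - {0, 1}"
  have "tau a1 = 0" "tau a2 = 1"
    using tau_minus_1[of a2] distinct lin_eq_0_iff[of a1 a1] lin_eq_0_iff[of a2 a2] by (auto simp: tau_def)
  then show ?thesis using t tau_sigma[of t] sigma_not_a3[of t] by auto
qed

lemma sigma_continuous: "continuous_on UNIV sigma"
  unfolding sigma_def using sigma_aux by (intro continuous_on_hpoint continuous_intros) auto

end

section \<open>The differential equation\<close>

lemma eventually_nhds_CFin:
  assumes "\<forall>\<^sub>F z in nhds z0. P (CFin z)"
  shows "\<forall>\<^sub>F x in nhds (CFin z0). P x"
proof -
  obtain V where V: "open V" "z0 \<in> V" "\<And>z. z \<in> V \<Longrightarrow> P (CFin z)"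
    using assms by (auto simp: eventually_nhds)
  have "open ((- {0}) \<inter> inverse -` V :: complex set)"
    using V(1) by (intro continuous_open_preimage continuous_intros) auto
  moreover have "chart_inf -` (CFin ` V) = (- {0}) \<inter> inverse -` V"
    by (auto simp: chart_inf_def split: if_splits)
  moreover have "CFin -` (CFin ` V) = V" by auto
  ultimately have "open (CFin ` V)" using V(1) by (simp add: open_cp1_def)
  then show ?thesis using V unfolding eventually_nhds by blast
qed

lemma eventually_nhds_CInf:
  assumes "\<forall>\<^sub>F w in nhds 0. P (chart_inf w)"
  shows "\<forall>\<^sub>F x in nhds CInf. P x"
proof -
  obtain V where V: "open V" "0 \<in> V" "\<And>z. z \<in> V \<Longrightarrow> P (chart_inf z)"
    using assms by (auto simp: eventually_nhds)
  have "open ((- {0}) \<inter> inverse -` V :: complex set)"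
    using V(1) by (intro continuous_open_preimage continuous_intros) auto
  moreover have "CFin z \<in> chart_inf ` V \<longleftrightarrow> z \<noteq> 0 \<and> inverse z \<in> V" for z
  proof
    assume "z \<noteq> 0 \<and> inverse z \<in> V"
    moreover from this have "CFin z = chart_inf (inverse z)" by (simp add: chart_inf_def)
    ultimately show "CFin z \<in> chart_inf ` V" by blast
  qed (auto simp: chart_inf_def split: if_splits)
  then have "CFin -` (chart_inf ` V) = (- {0}) \<inter> inverse -` V" by auto
  moreover have "chart_inf -` (chart_inf ` V) = V"
    by (auto simp: chart_inf_def split: if_splits)
  ultimately have "open (chart_inf ` V)" using V(1) by (simp add: open_cp1_def)
  moreover have "CInf \<in> chart_inf ` V" using V(2) by (auto simp: chart_inf_def image_iff intro!: bexI[of _ 0])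
  ultimately show ?thesis using V(3) unfolding eventually_nhds by blast
qed

locale riemann_data = three_points +
  fixes \<alpha>0 \<alpha>1 \<beta>0 \<beta>1 :: complex
begin

text \<open>The logarithmic derivative of a product of powers of the three linear forms, with
  exponents \<open>c1\<close>, \<open>c2\<close>, \<open>c3\<close>. A point at infinity contributes
  0, because its \<open>hden\<close> is 0. Away from the points, \<open>pf2\<close> is minus the
  derivative.\<close>

definition pf :: "complex \<Rightarrow> complex \<Rightarrow> complex \<Rightarrow> complex \<Rightarrow> complex" where
  "pf c1 c2 c3 z = c1 * hden a1 / (hden a1 * z - hnum a1) + c2 * hden a2 / (hden a2 * z - hnum a2)
     + c3 * hden a3 / (hden a3 * z - hnum a3)"

definition pf2 :: "complex \<Rightarrow> complex \<Rightarrow> complex \<Rightarrow> complex \<Rightarrow> complex" where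
  "pf2 c1 c2 c3 z = c1 * (hden a1)\<^sup>2 / (hden a1 * z - hnum a1)\<^sup>2 + c2 * (hden a2)\<^sup>2 / (hden a2 * z - hnum a2)\<^sup>2
     + c3 * (hden a3)\<^sup>2 / (hden a3 * z - hnum a3)\<^sup>2"

text \<open>The exponents at \<open>a3\<close>: both t and t - 1 have a simple pole there, and for
  the derivative of f with respect to z the factor dt/dz adds a double pole, hence the -2. The sums
  0 and -2 of the three exponents make infinity an ordinary point when it is not in
  \<open>D\<close>.\<close>

definition \<alpha>2 :: complex where "\<alpha>2 = - \<alpha>0 - \<alpha>1"
definition \<beta>2 :: complex where "\<beta>2 = - 2 - \<beta>0 - \<beta>1"

abbreviation "th \<equiv> pf \<alpha>0 \<alpha>1 \<alpha>2"
abbreviation "et \<equiv> pf \<beta>0 \<beta>1 \<beta>2"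
abbreviation "th2 \<equiv> pf2 \<alpha>0 \<alpha>1 \<alpha>2"

text \<open>The equation satisfied by \<open>u\<close> and \<open>u \<phi>\<close> when \<open>u' = th u\<close> and \<open>\<phi>'' = et \<phi>'\<close>; here \<open>th' = - th2\<close>.\<close>

definition cb1 :: "complex \<Rightarrow> complex" where "cb1 z = - (2 * th z + et z)"
definition cb2 :: "complex \<Rightarrow> complex" where "cb2 z = th2 z + th z * (th z + et z)"

lemma lin_form_nonzero: "CFin z \<noteq> a \<Longrightarrow> hden a * z - hnum a \<noteq> 0"
  using lin_eq_0_iff[of a "CFin z"] by (simp add: lin_CFin)

lemma pf_derivative:
  assumes "CFin z \<notin> D"
  shows "(pf c1 c2 c3 has_field_derivative - pf2 c1 c2 c3 z) (at z)"
proof -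
  have *: "((\<lambda>z. c * hden a / (hden a * z - hnum a)) has_field_derivative
      - (c * (hden a)\<^sup>2 / (hden a * z - hnum a)\<^sup>2)) (at z)" if "CFin z \<noteq> a" for a c
    using lin_form_nonzero[OF that]
    by (auto intro!: derivative_eq_intros simp: power2_eq_square)
  show ?thesis
    using DERIV_add[OF DERIV_add[OF *[of a1 c1] *[of a2 c2]] *[of a3 c3]] assms
    unfolding pf_def[abs_def] pf2_def by simp
qed

lemma pf_local:
  obtains u g u' g' where "g analytic_on {c}" "g' analytic_on {c}"
    "\<And>z. pf c1 c2 c3 z = u / (z - c) + g z" "\<And>z. pf2 c1 c2 c3 z = u' / (z - c)\<^sup>2 + g' z"
proof -
  have *: "\<exists>u g g'. g analytic_on {c} \<and> g' analytic_on {c} \<and>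
      (\<forall>z. k * hden a / (hden a * z - hnum a) = u / (z - c) + g z) \<and>
      (\<forall>z. k * (hden a)\<^sup>2 / (hden a * z - hnum a)\<^sup>2 = u / (z - c)\<^sup>2 + g' z)" for k a
  proof (cases "a = CFin c")
    case True
    then show ?thesis by (intro exI[of _ k] exI[of _ "\<lambda>_. 0"]) auto
  next
    case False
    then have "hden a * c - hnum a \<noteq> 0" using lin_form_nonzero[of c a] by blast
    then show ?thesis
      by (intro exI[of _ 0] exI[of _ "\<lambda>z. k * hden a / (hden a * z - hnum a)"]
          exI[of _ "\<lambda>z. k * (hden a)\<^sup>2 / (hden a * z - hnum a)\<^sup>2"]) (auto intro!: analytic_intros)
  qed
  obtain u1 g1 g1' where 1: "g1 analytic_on {c}" "g1' analytic_on {c}"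
      "\<forall>z. c1 * hden a1 / (hden a1 * z - hnum a1) = u1 / (z - c) + g1 z"
      "\<forall>z. c1 * (hden a1)\<^sup>2 / (hden a1 * z - hnum a1)\<^sup>2 = u1 / (z - c)\<^sup>2 + g1' z"
    using *[of c1 a1] by blast
  obtain u2 g2 g2' where 2: "g2 analytic_on {c}" "g2' analytic_on {c}"
      "\<forall>z. c2 * hden a2 / (hden a2 * z - hnum a2) = u2 / (z - c) + g2 z"
      "\<forall>z. c2 * (hden a2)\<^sup>2 / (hden a2 * z - hnum a2)\<^sup>2 = u2 / (z - c)\<^sup>2 + g2' z"
    using *[of c2 a2] by blast
  obtain u3 g3 g3' where 3: "g3 analytic_on {c}" "g3' analytic_on {c}"
      "\<forall>z. c3 * hden a3 / (hden a3 * z - hnum a3) = u3 / (z - c) + g3 z"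
      "\<forall>z. c3 * (hden a3)\<^sup>2 / (hden a3 * z - hnum a3)\<^sup>2 = u3 / (z - c)\<^sup>2 + g3' z"
    using *[of c3 a3] by blast
  show thesis
  proof (rule that[of "\<lambda>z. g1 z + g2 z + g3 z" "\<lambda>z. g1' z + g2' z + g3' z" "u1 + u2 + u3" "u1 + u2 + u3"])
    show "pf c1 c2 c3 z = (u1 + u2 + u3) / (z - c) + (g1 z + g2 z + g3 z)" for z
      by (simp add: pf_def 1 2 3 add_divide_distrib)
    show "pf2 c1 c2 c3 z = (u1 + u2 + u3) / (z - c)\<^sup>2 + (g1' z + g2' z + g3' z)" for z
      by (simp add: pf2_def 1 2 3 add_divide_distrib)
  qed (use 1 2 3 in \<open>auto intro!: analytic_intros\<close>)
qed

lemma ordinary_finite: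
  assumes "CFin c \<notin> D"
  shows "ordinary_point cb1 cb2 (CFin c)"
proof -
  have "pf c1 c2 c3 analytic_on {c}" "pf2 c1 c2 c3 analytic_on {c}" for c1 c2 c3
    using assms lin_form_nonzero unfolding pf_def[abs_def] pf2_def[abs_def]
    by (auto intro!: analytic_intros)
  then show ?thesis
    unfolding ordinary_point.simps cb1_def[abs_def] cb2_def[abs_def] by (auto intro!: analytic_intros)
qed

lemma fuchsian_finite: "fuchsian_point cb1 cb2 (CFin c)"
proof -
  obtain u g u' g' where T: "g analytic_on {c}" "g' analytic_on {c}"
    "\<And>z. th z = u / (z - c) + g z" "\<And>z. th2 z = u' / (z - c)\<^sup>2 + g' z"
    using pf_local[of c \<alpha>0 \<alpha>1 \<alpha>2] by metis
  obtain v h v' h' where E: "h analytic_on {c}" "h' analytic_on {c}"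
    "\<And>z. et z = v / (z - c) + h z" "\<And>z. pf2 \<beta>0 \<beta>1 \<beta>2 z = v' / (z - c)\<^sup>2 + h' z"
    using pf_local[of c \<beta>0 \<beta>1 \<beta>2] by metis
  have ev: "\<forall>\<^sub>F z in at c. z \<noteq> c" by (simp add: eventually_at_filter)
  have pole: "th z = (u + (z - c) * g z) / (z - c)" "et z = (v + (z - c) * h z) / (z - c)"
    "th2 z = (u' + (z - c)\<^sup>2 * g' z) / (z - c)\<^sup>2" if "z \<noteq> c" for z
    using that by (simp_all add: T E add_divide_distrib)
  have "pole_order_le 1 cb1 c"
    unfolding pole_order_le_def
  proof (intro exI conjI)
    show "(\<lambda>z. - (2 * (u + (z - c) * g z) + (v + (z - c) * h z))) analytic_on {c}"
      using T E by (auto intro!: analytic_intros)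
    have "cb1 z = - (2 * (u + (z - c) * g z) + (v + (z - c) * h z)) / (z - c) ^ 1" if "z \<noteq> c" for z
    proof -
      have "- (2 * (x / d) + y / d) = - (2 * x + y) / d" for x y d :: complex
        by (simp add: add_divide_distrib diff_divide_distrib)
      then show ?thesis unfolding cb1_def pole[OF that] power_one_right .
    qed
    with ev show "\<forall>\<^sub>F z in at c. cb1 z = - (2 * (u + (z - c) * g z) + (v + (z - c) * h z)) / (z - c) ^ 1"
      by (auto elim: eventually_mono)
  qed
  moreover have "pole_order_le 2 cb2 c"
    unfolding pole_order_le_def
  proof (intro exI conjI)
    show "(\<lambda>z. u' + (z - c)\<^sup>2 * g' z + (u + (z - c) * g z) * (u + (z - c) * g z + (v + (z - c) * h z))) analytic_on {c}"
      using T E by (auto intro!: analytic_intros)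
    have "cb2 z = (u' + (z - c)\<^sup>2 * g' z + (u + (z - c) * g z) * (u + (z - c) * g z + (v + (z - c) * h z))) / (z - c)\<^sup>2"
      if "z \<noteq> c" for z
      unfolding cb2_def pole[OF that]
      by (simp only: add_divide_distrib[symmetric] times_divide_times_eq power2_eq_square)
    with ev show "\<forall>\<^sub>F z in at c. cb2 z = (u' + (z - c)\<^sup>2 * g' z + (u + (z - c) * g z) * (u + (z - c) * g z + (v + (z - c) * h z))) / (z - c)\<^sup>2"
      by (auto elim: eventually_mono)
  qed
  ultimately show ?thesis by simp
qed

text \<open>What remains of \<open>pf\<close> at \<open>1 / w\<close> after dividing by
  \<open>w\<close>, see \<open>pf_inverse\<close>; it is analytic at 0 even if one of the points is
  infinity, whose term is then 0.\<close>

definition pw :: "complex \<Rightarrow> complex \<Rightarrow> complex \<Rightarrow> complex \<Rightarrow> complex" where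
  "pw c1 c2 c3 w = c1 * hden a1 / (hden a1 - hnum a1 * w) + c2 * hden a2 / (hden a2 - hnum a2 * w)
     + c3 * hden a3 / (hden a3 - hnum a3 * w)"

definition pw2 :: "complex \<Rightarrow> complex \<Rightarrow> complex \<Rightarrow> complex \<Rightarrow> complex" where
  "pw2 c1 c2 c3 w = c1 * (hden a1)\<^sup>2 / (hden a1 - hnum a1 * w)\<^sup>2 + c2 * (hden a2)\<^sup>2 / (hden a2 - hnum a2 * w)\<^sup>2
     + c3 * (hden a3)\<^sup>2 / (hden a3 - hnum a3 * w)\<^sup>2"

lemma pw_analytic: "pw c1 c2 c3 analytic_on {0}" "pw2 c1 c2 c3 analytic_on {0}"
proof -
  have "(\<lambda>w. c * hden a / (hden a - hnum a * w)) analytic_on {0} \<and>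
      (\<lambda>w. c * (hden a)\<^sup>2 / (hden a - hnum a * w)\<^sup>2) analytic_on {0}" for a c
    by (cases "hden a = 0") (auto intro!: analytic_intros)
  then show "pw c1 c2 c3 analytic_on {0}" "pw2 c1 c2 c3 analytic_on {0}"
    unfolding pw_def[abs_def] pw2_def[abs_def] by (auto intro!: analytic_on_add)
qed

lemma pf_inverse:
  assumes "w \<noteq> 0"
  shows "pf c1 c2 c3 (1 / w) = w * pw c1 c2 c3 w" "pf2 c1 c2 c3 (1 / w) = w\<^sup>2 * pw2 c1 c2 c3 w"
proof -
  have e: "hden a * (1 / w) - hnum a = (hden a - hnum a * w) / w" for a
    using assms by (simp add: field_simps)
  show "pf c1 c2 c3 (1 / w) = w * pw c1 c2 c3 w" "pf2 c1 c2 c3 (1 / w) = w\<^sup>2 * pw2 c1 c2 c3 w"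
    unfolding pf_def pw_def pf2_def pw2_def e by (simp_all add: distrib_left power_divide mult_ac)
qed

abbreviation "thw \<equiv> pw \<alpha>0 \<alpha>1 \<alpha>2"
abbreviation "etw \<equiv> pw \<beta>0 \<beta>1 \<beta>2"
abbreviation "thw2 \<equiv> pw2 \<alpha>0 \<alpha>1 \<alpha>2"

lemma coeff_inf:
  assumes "w \<noteq> 0"
  shows "coeff1_inf cb1 w = (2 + 2 * thw w + etw w) / w"
    "coeff2_inf cb2 w = (thw2 w + thw w * (thw w + etw w)) / w\<^sup>2"
proof -
  show "coeff1_inf cb1 w = (2 + 2 * thw w + etw w) / w"
    using assms by (simp add: coeff1_inf_def cb1_def pf_inverse[OF assms] field_simps power2_eq_square)
  have "cb2 (1 / w) = w\<^sup>2 * (thw2 w + thw w * (thw w + etw w))"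
    unfolding cb2_def pf_inverse[OF assms] by (simp add: algebra_simps power2_eq_square)
  moreover have "w ^ 4 = w\<^sup>2 * w\<^sup>2" by (simp flip: power_add)
  ultimately show "coeff2_inf cb2 w = (thw2 w + thw w * (thw w + etw w)) / w\<^sup>2"
    using assms nonzero_mult_divide_mult_cancel_left[of "w\<^sup>2" "thw2 w + thw w * (thw w + etw w)" "w\<^sup>2"]
    by (simp only: coeff2_inf_def) simp
qed

lemma fuchsian_inf: "fuchsian_point cb1 cb2 CInf"
proof -
  have ev: "\<forall>\<^sub>F z in at 0. z \<noteq> (0::complex)" by (simp add: eventually_at_filter)
  have "pole_order_le 1 (coeff1_inf cb1) 0"
    unfolding pole_order_le_def
  proof (intro exI conjI)
    show "(\<lambda>w. 2 + 2 * thw w + etw w) analytic_on {0}" by (intro analytic_intros pw_analytic)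
    show "\<forall>\<^sub>F w in at 0. coeff1_inf cb1 w = (2 + 2 * thw w + etw w) / (w - 0) ^ 1"
      using ev by eventually_elim (simp add: coeff_inf)
  qed
  moreover have "pole_order_le 2 (coeff2_inf cb2) 0"
    unfolding pole_order_le_def
  proof (intro exI conjI)
    show "(\<lambda>w. thw2 w + thw w * (thw w + etw w)) analytic_on {0}" by (intro analytic_intros pw_analytic)
    show "\<forall>\<^sub>F w in at 0. coeff2_inf cb2 w = (thw2 w + thw w * (thw w + etw w)) / (w - 0)\<^sup>2"
      using ev by eventually_elim (simp add: coeff_inf)
  qed
  ultimately show ?thesis by simp
qed

text \<open>Write \<open>1 / (1 - A * w)\<close> as \<open>1 + w * q A w\<close>. The constant terms
  add up to 0 in \<open>thw\<close> and \<open>thw2\<close> and to -2 in \<open>etw\<close>, which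
  cancels the poles displayed in \<open>coeff_inf\<close>.\<close>

lemma ordinary_inf:
  assumes "CInf \<notin> D"
  shows "ordinary_point cb1 cb2 CInf"
proof -
  have B: "hden a1 = 1" "hden a2 = 1" "hden a3 = 1"
    using assms by (cases a1; cases a2; cases a3; simp)+
  define q where "q A w = A / (1 - A * w)" for A w :: complex
  define T where "T w = \<alpha>0 * q (hnum a1) w + \<alpha>1 * q (hnum a2) w + \<alpha>2 * q (hnum a3) w" for w
  define E where "E w = \<beta>0 * q (hnum a1) w + \<beta>1 * q (hnum a2) w + \<beta>2 * q (hnum a3) w" for w
  define Q where "Q w = \<alpha>0 * (q (hnum a1) w)\<^sup>2 + \<alpha>1 * (q (hnum a2) w)\<^sup>2 + \<alpha>2 * (q (hnum a3) w)\<^sup>2" for w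
  have qa: "q A analytic_on {0}" for A
    unfolding q_def[abs_def] by (auto intro!: analytic_intros)
  have an: "T analytic_on {0}" "E analytic_on {0}" "Q analytic_on {0}"
    unfolding T_def[abs_def] E_def[abs_def] Q_def[abs_def] by (intro analytic_intros qa)+
  have nz: "\<forall>\<^sub>F w in at 0. 1 - A * w \<noteq> 0" for A :: complex
  proof -
    have "((\<lambda>w. 1 - A * w) \<longlongrightarrow> 1 - A * 0) (at 0)" by (intro tendsto_intros)
    then show ?thesis by (rule tendsto_imp_eventually_ne) simp
  qed
  have ev: "\<forall>\<^sub>F w in at 0. w \<noteq> 0 \<and> 1 - hnum a1 * w \<noteq> 0 \<and> 1 - hnum a2 * w \<noteq> 0 \<and> 1 - hnum a3 * w \<noteq> 0"
    using nz by (intro eventually_conj) (auto simp: eventually_at_filter)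
  have main: "coeff1_inf cb1 w = 2 * T w + E w \<and> coeff2_inf cb2 w = Q w + T w * (T w + E w)"
    if w: "w \<noteq> 0" "1 - hnum a1 * w \<noteq> 0" "1 - hnum a2 * w \<noteq> 0" "1 - hnum a3 * w \<noteq> 0" for w
  proof -
    have e: "c / (1 - A * w) = c * (1 + w * q A w)" "c / (1 - A * w)\<^sup>2 = c * (1 + w * q A w)\<^sup>2"
      if "1 - A * w \<noteq> 0" for A c
    proof -
      have "1 + w * q A w = 1 / (1 - A * w)" using that by (simp add: q_def field_simps)
      then show "c / (1 - A * w) = c * (1 + w * q A w)" "c / (1 - A * w)\<^sup>2 = c * (1 + w * q A w)\<^sup>2"
        by (simp_all add: power_divide)
    qed
    have t: "thw w = w * T w" and et: "etw w = - 2 + w * E w" and t2: "thw2 w = 2 * w * T w + w\<^sup>2 * Q w"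
      unfolding pw_def pw2_def B mult_1 mult_1_right power_one e[OF w(2)] e[OF w(3)] e[OF w(4)]
      by (simp_all add: T_def E_def Q_def \<alpha>2_def \<beta>2_def algebra_simps power2_eq_square)
    have "coeff1_inf cb1 w = 2 * T w + E w"
      unfolding coeff_inf[OF w(1)] t et using w(1) by (simp add: field_simps)
    moreover have "coeff2_inf cb2 w = Q w + T w * (T w + E w)"
      unfolding coeff_inf[OF w(1)] t et t2 using w(1) by (simp add: field_simps power2_eq_square)
    ultimately show ?thesis by blast
  qed
  have "pole_order_le 0 (coeff1_inf cb1) 0"
    unfolding pole_order_le_def
  proof (intro exI conjI)
    show "(\<lambda>w. 2 * T w + E w) analytic_on {0}" by (intro analytic_intros an)
    show "\<forall>\<^sub>F w in at 0. coeff1_inf cb1 w = (2 * T w + E w) / (w - 0) ^ 0"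
      using ev by eventually_elim (use main in simp)
  qed
  moreover have "pole_order_le 0 (coeff2_inf cb2) 0"
    unfolding pole_order_le_def
  proof (intro exI conjI)
    show "(\<lambda>w. Q w + T w * (T w + E w)) analytic_on {0}" by (intro analytic_intros an)
    show "\<forall>\<^sub>F w in at 0. coeff2_inf cb2 w = (Q w + T w * (T w + E w)) / (w - 0) ^ 0"
      using ev by eventually_elim (use main in simp)
  qed
  ultimately show ?thesis by simp
qed

lemma riemann_equation_D: "riemann_equation D cb1 cb2"
proof -
  have "ordinary_point cb1 cb2 x" if "x \<in> - D" for x
    using that ordinary_finite ordinary_inf by (cases x) auto
  moreover have "fuchsian_point cb1 cb2 x" for x
    using fuchsian_finite fuchsian_inf by (cases x) auto
  moreover have "card D = 3" using distinct by simp
  ultimately show ?thesis unfolding riemann_equation_def by blast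
qed

end

section \<open>Solutions and their continuation\<close>

context riemann_data
begin

definition yv :: "triple \<Rightarrow> complex^2" where
  "yv v = (\<chi> j. exp (\<alpha>0 * fst v + \<alpha>1 * fst (snd v)) * (if j = 1 then 1 else snd (snd v)))"

definition germ :: "(complex \<Rightarrow> triple) \<Rightarrow> complex^2^2 \<Rightarrow> cp1 \<Rightarrow> complex^2" where
  "germ \<Psi> R x = yv (\<Psi> (tau x)) v* R"

text \<open>Removing \<open>D\<close> takes care of \<open>a3\<close>, where division by 0 gives
  \<open>tau\<close> the default value 0.\<close>

definition tau_dom :: "complex set \<Rightarrow> cp1 set" where
  "tau_dom V = - D \<inter> tau -` V"

lemma open_tau_dom: "open V \<Longrightarrow> open (tau_dom V)"
  using tau_continuous open_Compl_D unfolding tau_dom_def by (intro continuous_open_preimage)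

lemma germ_component:
  "germ (\<lambda>t. (L0 t, L1 t, \<Phi> t)) R x $ j =
     exp (\<alpha>0 * L0 (tau x) + \<alpha>1 * L1 (tau x)) * (R $ 1 $ j + R $ 2 $ j * \<Phi> (tau x))"
  by (simp add: germ_def yv_def vector_matrix_mult_def sum_2 algebra_simps)

lemma branch3_holomorphic:
  assumes "branch3 \<beta>0 \<beta>1 V L0 L1 \<Phi>"
  shows "L0 holomorphic_on V" "L1 holomorphic_on V" "\<Phi> holomorphic_on V"
  using branch3D(4-6)[OF assms]
  by (meson field_differentiable_at_within field_differentiable_def holomorphic_on_def)+

lemma germ_holomorphic:
  assumes b: "branch3 \<beta>0 \<beta>1 V L0 L1 \<Phi>"
  shows "cp1_holomorphic_on (\<lambda>x. exp (\<alpha>0 * L0 (tau x) + \<alpha>1 * L1 (tau x)) * (c0 + c1 * \<Phi> (tau x))) (tau_dom V)"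
proof (rule cp1_holomorphic_on_compose[of tau "tau_dom V"
      "\<lambda>t. exp (\<alpha>0 * L0 t + \<alpha>1 * L1 t) * (c0 + c1 * \<Phi> t)" V])
  show "cp1_holomorphic_on tau (tau_dom V)"
    using tau_holomorphic cp1_holomorphic_on_subset by (auto simp: tau_dom_def)
  show "(\<lambda>t. exp (\<alpha>0 * L0 t + \<alpha>1 * L1 t) * (c0 + c1 * \<Phi> t)) holomorphic_on V"
    using branch3_holomorphic[OF b] by (intro holomorphic_intros)
qed (auto simp: tau_dom_def)

lemma sec3_germ_holomorphic:
  assumes "sec3 \<beta>0 \<beta>1 V \<Psi>"
  shows "cp1_holomorphic_on (\<lambda>x. germ \<Psi> R x $ j) (tau_dom V)"
proof -
  obtain L0 L1 \<Phi> where "\<Psi> = (\<lambda>x. (L0 x, L1 x, \<Phi> x))" "branch3 \<beta>0 \<beta>1 V L0 L1 \<Phi>"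
    using assms unfolding sec3_def by blast
  then show ?thesis using germ_holomorphic by (simp add: germ_component)
qed

lemma germ_eventually_eq:
  assumes "sec3 \<beta>0 \<beta>1 U \<Psi>" "sec3 \<beta>0 \<beta>1 V \<Psi>'" "x \<notin> D" "tau x \<in> U" "tau x \<in> V" "\<Psi> (tau x) = \<Psi>' (tau x)"
  shows "\<forall>\<^sub>F y in nhds x. \<Psi> (tau y) = \<Psi>' (tau y)"
proof -
  obtain \<eta> where \<eta>: "\<eta> > 0" and "ball (tau x) \<eta> \<subseteq> U \<inter> V"
    and \<eta>': "\<forall>s\<in>ball (tau x) \<eta>. \<forall>y\<in>ball (tau x) \<eta>. \<Psi> s = \<Psi>' s \<longrightarrow> \<Psi> y = \<Psi>' y"
    using gs.sec_eq_ball[OF assms(1,2,4,5)] by blast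
  have "open (tau_dom (ball (tau x) \<eta>))" "x \<in> tau_dom (ball (tau x) \<eta>)"
    using open_tau_dom assms(3) \<eta> by (auto simp: tau_dom_def)
  moreover have "\<Psi> (tau y) = \<Psi>' (tau y)" if "y \<in> tau_dom (ball (tau x) \<eta>)" for y
    using that \<eta> \<eta>'[rule_format, of "tau x" "tau y"] assms(6) unfolding tau_dom_def by simp
  ultimately show ?thesis unfolding eventually_nhds by blast
qed

text \<open>At each time take the germ of a section that the lift follows there. Sections with the
  same value at one point agree nearby by \<open>germ_eventually_eq\<close>, and this makes the
  germs at neighbouring times compatible.\<close>

lemma continuation_of_lift:
  assumes g: "path g" "path_image g \<subseteq> - D" and m: "gs.lift \<beta>0 \<beta>1 (tau \<circ> g) m"
    and 0: "sec3 \<beta>0 \<beta>1 V0 \<Psi>0" "tau (g 0) \<in> V0" "\<Psi>0 (tau (g 0)) = m 0"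
    and 1: "sec3 \<beta>0 \<beta>1 V1 \<Psi>1" "tau (g 1) \<in> V1" "\<Psi>1 (tau (g 1)) = m 1"
  shows "continuation_along g (germ \<Psi>0 R) (germ \<Psi>1 R)"
proof -
  have "\<forall>t\<in>{0..1}. \<exists>W. sec3 \<beta>0 \<beta>1 (fst W) (fst (snd W)) \<and> tau (g t) \<in> fst W \<and> snd (snd W) > 0 \<and>
     (\<forall>s\<in>{0..1}. \<bar>s - t\<bar> < snd (snd W) \<longrightarrow> tau (g s) \<in> fst W \<and> m s = fst (snd W) (tau (g s)))"
  proof
    fix t :: real assume t: "t \<in> {0..1}"
    obtain U \<Psi> e where U: "sec3 \<beta>0 \<beta>1 U \<Psi>" "(tau \<circ> g) t \<in> U" "e > 0" "m t = \<Psi> ((tau \<circ> g) t)"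
      "\<forall>s\<in>{0..1}. \<bar>s - t\<bar> < e \<longrightarrow> (tau \<circ> g) s \<in> U \<and> m s = \<Psi> ((tau \<circ> g) s)"
      using gs.liftE[OF m t] by blast
    then show "\<exists>W. sec3 \<beta>0 \<beta>1 (fst W) (fst (snd W)) \<and> tau (g t) \<in> fst W \<and> snd (snd W) > 0 \<and>
     (\<forall>s\<in>{0..1}. \<bar>s - t\<bar> < snd (snd W) \<longrightarrow> tau (g s) \<in> fst W \<and> m s = fst (snd W) (tau (g s)))"
      by (intro exI[of _ "(U, \<Psi>, e)"]) auto
  qed
  from bchoice[OF this] obtain W where W: "\<forall>t\<in>{0..1}. sec3 \<beta>0 \<beta>1 (fst (W t)) (fst (snd (W t))) \<and>
      tau (g t) \<in> fst (W t) \<and> snd (snd (W t)) > 0 \<and> (\<forall>s\<in>{0..1}. \<bar>s - t\<bar> < snd (snd (W t)) \<longrightarrow>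
        tau (g s) \<in> fst (W t) \<and> m s = fst (snd (W t)) (tau (g s)))" by blast
  define U P e where "U t = fst (W t)" and "P t = fst (snd (W t))" and "e t = snd (snd (W t))" for t
  have sec: "sec3 \<beta>0 \<beta>1 (U t) (P t)" and inU: "tau (g t) \<in> U t" and e: "e t > 0"
    and near: "\<And>s. s \<in> {0..1} \<Longrightarrow> \<bar>s - t\<bar> < e t \<Longrightarrow> tau (g s) \<in> U t \<and> m s = P t (tau (g s))"
    if "t \<in> {0..1}" for t
    using W[rule_format, OF that] unfolding U_def P_def e_def by blast+
  have mP: "m t = P t (tau (g t))" if "t \<in> {0..1}" for t
    using near[OF that that] e[OF that] by simp
  have gD: "g t \<notin> D" if "t \<in> {0..1}" for t
    using g(2) that unfolding path_image_def by blast
  show ?thesis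
    unfolding continuation_along_def
  proof (intro exI[of _ "\<lambda>t. germ (P t) R"] conjI ballI)
    have "\<forall>\<^sub>F x in nhds (g 0). P 0 (tau x) = \<Psi>0 (tau x)"
      using mP[of 0] 0 by (intro germ_eventually_eq[OF sec[of 0] 0(1)] gD inU) auto
    then show "\<forall>\<^sub>F x in nhds (pathstart g). germ (P 0) R x = germ \<Psi>0 R x"
      unfolding pathstart_def by eventually_elim (simp add: germ_def)
    have "\<forall>\<^sub>F x in nhds (g 1). P 1 (tau x) = \<Psi>1 (tau x)"
      using mP[of 1] 1 by (intro germ_eventually_eq[OF sec[of 1] 1(1)] gD inU) auto
    then show "\<forall>\<^sub>F x in nhds (pathfinish g). germ (P 1) R x = germ \<Psi>1 R x"
      unfolding pathfinish_def by eventually_elim (simp add: germ_def)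
    fix t :: real assume t: "t \<in> {0..1}"
    have "g s \<in> tau_dom (U t) \<and> (\<forall>\<^sub>F x in nhds (g s). germ (P s) R x = germ (P t) R x)"
      if s: "s \<in> {0..1}" "\<bar>s - t\<bar> < e t" for s
    proof
      show "g s \<in> tau_dom (U t)" using near[OF t s] gD[OF s(1)] by (simp add: tau_dom_def)
      have "\<forall>\<^sub>F x in nhds (g s). P s (tau x) = P t (tau x)"
        using near[OF t s] mP[OF s(1)] by (intro germ_eventually_eq[OF sec[OF s(1)] sec[OF t]] gD s inU) auto
      then show "\<forall>\<^sub>F x in nhds (g s). germ (P s) R x = germ (P t) R x"
        by eventually_elim (simp add: germ_def)
    qed
    then show "\<exists>V. open V \<and> g t \<in> V \<and> (\<forall>j. cp1_holomorphic_on (\<lambda>x. germ (P t) R x $ j) V) \<and>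
       (\<exists>e>0. \<forall>s\<in>{0..1}. \<bar>s - t\<bar> < e \<longrightarrow> g s \<in> V \<and> (\<forall>\<^sub>F x in nhds (g s). germ (P s) R x = germ (P t) R x))"
      using open_tau_dom[OF gs.sec_open[OF sec[OF t]]] sec3_germ_holomorphic[OF sec[OF t]] e[OF t] inU[OF t] gD[OF t]
      by (intro exI[of _ "tau_dom (U t)"] conjI exI[of _ "e t"]) (auto simp: tau_dom_def)
  qed
qed

text \<open>The determinant of the Moebius map \<open>tau\<close>, which is the numerator of its
  derivative.\<close>

definition kap :: complex where "kap = - scal * lin a1 a3"

lemma kap_nonzero: "kap \<noteq> 0"
  using scal_nonzero distinct by (simp add: kap_def lin_eq_0_iff)

lemma tau_derivative:
  assumes "CFin z \<notin> D"
  shows "((\<lambda>z. tau (CFin z)) has_field_derivative kap / (hden a3 * z - hnum a3)\<^sup>2) (at z)"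
    "kap / (hden a3 * z - hnum a3)\<^sup>2 / tau (CFin z) =
       hden a1 / (hden a1 * z - hnum a1) - hden a3 / (hden a3 * z - hnum a3)"
    "kap / (hden a3 * z - hnum a3)\<^sup>2 / (tau (CFin z) - 1) =
       hden a2 / (hden a2 * z - hnum a2) - hden a3 / (hden a3 * z - hnum a3)"
proof -
  define p q r where "p = hden a1 * z - hnum a1" and "q = hden a2 * z - hnum a2" and "r = hden a3 * z - hnum a3"
  have nz: "p \<noteq> 0" "q \<noteq> 0" "r \<noteq> 0"
    using assms lin_form_nonzero unfolding p_def q_def r_def by auto
  have d: "lin a2 a1 \<noteq> 0" "lin a1 a3 \<noteq> 0" "lin a3 a2 \<noteq> 0" using distinct by (simp_all add: lin_eq_0_iff)
  have k: "kap = scal * (hden a1 * r - hden a3 * p)"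
    by (simp add: kap_def p_def r_def lin_def algebra_simps)
  have k2: "kap = lin a1 a3 / lin a2 a1 * (hden a2 * r - hden a3 * q)"
  proof -
    have "hden a2 * r - hden a3 * q = lin a3 a2"
      by (simp add: q_def r_def lin_def algebra_simps)
    then show ?thesis by (simp add: kap_def scal_def)
  qed
  show "((\<lambda>z. tau (CFin z)) has_field_derivative kap / (hden a3 * z - hnum a3)\<^sup>2) (at z)"
    unfolding tau_CFin using nz unfolding k r_def p_def
    by (auto intro!: derivative_eq_intros simp: power2_eq_square algebra_simps)
  have t: "tau (CFin z) = scal * p / r" by (simp add: tau_CFin p_def r_def)
  have t1: "tau (CFin z) - 1 = lin a1 a3 / lin a2 a1 * q / r"
    using tau_minus_1[of "CFin z"] assms by (simp add: lin_CFin q_def r_def)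
  have gen: "s * (x * r - y * p) / r\<^sup>2 / (s * p / r) = x / p - y / r"
    if "s \<noteq> 0" "p \<noteq> 0" "r \<noteq> 0" for s x y p r :: complex
    using that by (simp add: field_simps power2_eq_square)
  show "kap / (hden a3 * z - hnum a3)\<^sup>2 / tau (CFin z) =
       hden a1 / (hden a1 * z - hnum a1) - hden a3 / (hden a3 * z - hnum a3)"
    unfolding t k using gen[OF scal_nonzero nz(1,3)] unfolding p_def r_def .
  show "kap / (hden a3 * z - hnum a3)\<^sup>2 / (tau (CFin z) - 1) =
       hden a2 / (hden a2 * z - hnum a2) - hden a3 / (hden a3 * z - hnum a3)"
    unfolding t1 k2 using gen[of "lin a1 a3 / lin a2 a1", OF _ nz(2,3)] d unfolding q_def r_def by simp
qed

text \<open>\<open>tau\<close> has the logarithmic derivative with residues 1 at \<open>a1\<close>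
  and -1 at \<open>a3\<close>, and \<open>tau - 1\<close> the one with 1 at \<open>a2\<close> and -1
  at \<open>a3\<close>. Weighted by the exponents they add up to \<open>th\<close>; for
  \<open>w\<close> the square in the denominator of \<open>tau'\<close> supplies the -2 in
  \<open>\<beta>2\<close>.\<close>

lemma solution_derivatives:
  assumes b: "branch3 \<beta>0 \<beta>1 V L0 L1 \<Phi>" and z: "CFin z \<in> tau_dom V"
  defines "u \<equiv> \<lambda>z. exp (\<alpha>0 * L0 (tau (CFin z)) + \<alpha>1 * L1 (tau (CFin z)))"
    and "w \<equiv> \<lambda>z. exp (\<beta>0 * L0 (tau (CFin z)) + \<beta>1 * L1 (tau (CFin z))) * (kap / (hden a3 * z - hnum a3)\<^sup>2)"
  shows "(u has_field_derivative th z * u z) (at z)"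
    "((\<lambda>z. \<Phi> (tau (CFin z))) has_field_derivative w z) (at z)"
    "(w has_field_derivative et z * w z) (at z)"
    "w z \<noteq> 0"
proof -
  have zD: "CFin z \<notin> D" and zV: "tau (CFin z) \<in> V" using z by (auto simp: tau_dom_def)
  let ?t = "\<lambda>z. tau (CFin z)" and ?d = "kap / (hden a3 * z - hnum a3)\<^sup>2"
  have r: "hden a3 * z - hnum a3 \<noteq> 0" using zD lin_form_nonzero by auto
  note td = tau_derivative[OF zD]
  have L0: "((\<lambda>z. L0 (?t z)) has_field_derivative hden a1 / (hden a1 * z - hnum a1) - hden a3 / (hden a3 * z - hnum a3)) (at z)"
    using DERIV_chain2[OF branch3D(4)[OF b zV] td(1)] td(2) by (simp add: mult.commute divide_inverse)
  have L1: "((\<lambda>z. L1 (?t z)) has_field_derivative hden a2 / (hden a2 * z - hnum a2) - hden a3 / (hden a3 * z - hnum a3)) (at z)"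
    using DERIV_chain2[OF branch3D(5)[OF b zV] td(1)] td(3) by (simp add: mult.commute divide_inverse)
  show "(u has_field_derivative th z * u z) (at z)"
    unfolding u_def
    by (rule derivative_eq_intros L0 L1 refl)+ (simp add: pf_def \<alpha>2_def algebra_simps diff_divide_distrib)
  show "((\<lambda>z. \<Phi> (?t z)) has_field_derivative w z) (at z)"
    unfolding w_def using DERIV_chain2[OF branch3D(6)[OF b zV] td(1)] .
  have "((\<lambda>z. kap / (hden a3 * z - hnum a3)\<^sup>2) has_field_derivative
      - 2 * hden a3 / (hden a3 * z - hnum a3) * ?d) (at z)"
  proof -
    have A: "((\<lambda>x. kap / x\<^sup>2) has_field_derivative - 2 / x * (kap / x\<^sup>2)) (at x)" if "x \<noteq> 0" for x
      using that by (auto intro!: derivative_eq_intros simp: field_simps power2_eq_square)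
    have B: "((\<lambda>z. hden a3 * z - hnum a3) has_field_derivative hden a3) (at z)"
      by (auto intro!: derivative_eq_intros)
    have "((\<lambda>z. kap / (hden a3 * z - hnum a3)\<^sup>2) has_field_derivative
        - 2 / (hden a3 * z - hnum a3) * ?d * hden a3) (at z)"
      by (rule DERIV_chain2[OF A[OF r] B])
    then show ?thesis by (simp add: mult_ac)
  qed
  note W = this
  show "(w has_field_derivative et z * w z) (at z)"
    unfolding w_def
    by (rule derivative_eq_intros L0 L1 W refl)+ (simp add: pf_def \<beta>2_def algebra_simps diff_divide_distrib add_divide_distrib)
  show "w z \<noteq> 0" using kap_nonzero r by (simp add: w_def)
qed

end

section \<open>The two-dimensional space of local solutions\<close>

context riemann_data
begin

definition bsol :: "(complex \<Rightarrow> complex) \<Rightarrow> (complex \<Rightarrow> complex) \<Rightarrow> (complex \<Rightarrow> complex) \<Rightarrow> complex \<Rightarrow> complex \<Rightarrow> cp1 \<Rightarrow> complex" where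
  "bsol L0 L1 \<Phi> c0 c1 x = exp (\<alpha>0 * L0 (tau x) + \<alpha>1 * L1 (tau x)) * (c0 + c1 * \<Phi> (tau x))"

lemma local_solution_bsol:
  assumes b: "branch3 \<beta>0 \<beta>1 V L0 L1 \<Phi>" and p: "p \<in> tau_dom V"
  shows "local_solution cb1 cb2 p (bsol L0 L1 \<Phi> c0 c1)"
proof -
  define u where "u z = exp (\<alpha>0 * L0 (tau (CFin z)) + \<alpha>1 * L1 (tau (CFin z)))" for z
  define w where "w z = exp (\<beta>0 * L0 (tau (CFin z)) + \<beta>1 * L1 (tau (CFin z))) * (kap / (hden a3 * z - hnum a3)\<^sup>2)" for z
  define f where "f z = bsol L0 L1 \<Phi> c0 c1 (CFin z)" for z
  let ?N = "CFin -` tau_dom V"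
  have N: "open ?N" using open_tau_dom[OF branch3D(1)[OF b]] by (simp add: open_cp1_def)
  have d: "(u has_field_derivative th z * u z) (at z)" "((\<lambda>z. \<Phi> (tau (CFin z))) has_field_derivative w z) (at z)"
    "(w has_field_derivative et z * w z) (at z)" if "z \<in> ?N" for z
    using solution_derivatives[OF b, of z] that unfolding u_def[abs_def] w_def[abs_def] by auto
  have f: "f = (\<lambda>z. u z * (c0 + c1 * \<Phi> (tau (CFin z))))"
    by (simp add: f_def bsol_def u_def fun_eq_iff)
  have f1: "(f has_field_derivative th z * f z + c1 * (u z * w z)) (at z)" if "z \<in> ?N" for z
    unfolding f by (rule derivative_eq_intros d[OF that] refl)+ (simp add: algebra_simps)
  have D1: "deriv f z = th z * f z + c1 * (u z * w z)" if "z \<in> ?N" for z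
    using f1[OF that] by (rule DERIV_imp_deriv)
  have D2: "deriv (deriv f) z = - th2 z * f z + th z * deriv f z + c1 * ((th z + et z) * (u z * w z))" if z: "z \<in> ?N" for z
  proof -
    have "CFin z \<notin> D" using z by (simp add: tau_dom_def)
    then have "((\<lambda>z. th z * f z + c1 * (u z * w z)) has_field_derivative
        - th2 z * f z + th z * deriv f z + c1 * ((th z + et z) * (u z * w z))) (at z)"
      unfolding D1[OF z]
      by - (rule derivative_eq_intros pf_derivative f1[OF z] d[OF z] refl | assumption | (simp add: algebra_simps; fail))+
    then have "(deriv f has_field_derivative
        - th2 z * f z + th z * deriv f z + c1 * ((th z + et z) * (u z * w z))) (at z)"
      by (rule has_field_derivative_transform_within_open[OF _ N z]) (simp add: D1)
    then show ?thesis by (rule DERIV_imp_deriv)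
  qed
  have ode: "deriv (deriv f) z + cb1 z * deriv f z + cb2 z * f z = 0" if z: "z \<in> ?N" for z
    unfolding D2[OF z] D1[OF z] cb1_def cb2_def by (simp add: algebra_simps)
  have hol: "cp1_holomorphic_on (bsol L0 L1 \<Phi> c0 c1) (tau_dom V)"
    using germ_holomorphic[OF b] unfolding bsol_def[abs_def] .
  show ?thesis
    unfolding local_solution_def Let_def
  proof (intro exI[of _ "tau_dom V"] conjI allI impI)
    show "open (tau_dom V)" using open_tau_dom[OF branch3D(1)[OF b]] .
    fix z assume "CFin z \<in> tau_dom V"
    then show "deriv (deriv (\<lambda>z. bsol L0 L1 \<Phi> c0 c1 (CFin z))) z + cb1 z * deriv (\<lambda>z. bsol L0 L1 \<Phi> c0 c1 (CFin z)) z
        + cb2 z * bsol L0 L1 \<Phi> c0 c1 (CFin z) = 0"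
      using ode[of z] unfolding f_def[abs_def] by simp
  qed (use p hol in auto)
qed

text \<open>Reduction of order. With d for differentiation the operator factors as (d -
  \<open>th\<close> - \<open>et\<close>)(d - \<open>th\<close>), because \<open>th' = - th2\<close>.
  Since \<open>u * w\<close> is annihilated by the left factor, \<open>(f' - th f) / (u * w)\<close>
  is a constant \<open>c1\<close>, and then \<open>f / u - c1 * \<phi>\<close> is a constant
  \<open>c0\<close>.\<close>

lemma ode_form:
  assumes b: "branch3 \<beta>0 \<beta>1 V L0 L1 \<Phi>" and W: "open W" "connected W" "W \<subseteq> CFin -` tau_dom V"
    and f: "f holomorphic_on W" and ode: "\<And>z. z \<in> W \<Longrightarrow> deriv (deriv f) z + cb1 z * deriv f z + cb2 z * f z = 0"
  obtains c0 c1 where "\<forall>z\<in>W. f z = bsol L0 L1 \<Phi> c0 c1 (CFin z)"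
proof -
  define u where "u z = exp (\<alpha>0 * L0 (tau (CFin z)) + \<alpha>1 * L1 (tau (CFin z)))" for z
  define w where "w z = exp (\<beta>0 * L0 (tau (CFin z)) + \<beta>1 * L1 (tau (CFin z))) * (kap / (hden a3 * z - hnum a3)\<^sup>2)" for z
  define \<phi> where "\<phi> z = \<Phi> (tau (CFin z))" for z
  have d: "(u has_field_derivative th z * u z) (at z)" "(\<phi> has_field_derivative w z) (at z)"
    "(w has_field_derivative et z * w z) (at z)" "w z \<noteq> 0" "u z \<noteq> 0" if "z \<in> W" for z
    using solution_derivatives[OF b, of z] that W(3) unfolding u_def[abs_def] w_def[abs_def] \<phi>_def[abs_def] by auto
  have f1: "(f has_field_derivative deriv f z) (at z)" "(deriv f has_field_derivative deriv (deriv f) z) (at z)" if "z \<in> W" for z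
    using f W(1) that by (auto intro!: holomorphic_derivI holomorphic_deriv)
  have const: "h constant_on W" if "\<And>z. z \<in> W \<Longrightarrow> (h has_field_derivative 0) (at z)" for h
    using that W(1,2)
    by (intro DERIV_zero_connected_constant_on[of W "{}"])
       (auto intro!: continuous_at_imp_continuous_on DERIV_isCont)
  have "((\<lambda>z. (deriv f z - th z * f z) / (u z * w z)) has_field_derivative 0) (at z)" if z: "z \<in> W" for z
  proof -
    have zD: "CFin z \<notin> D" using z W(3) by (auto simp: tau_dom_def)
    have A: "((\<lambda>z. deriv f z - th z * f z) has_field_derivative (th z + et z) * (deriv f z - th z * f z)) (at z)"
    proof -
      have "deriv (deriv f) z = - cb1 z * deriv f z - cb2 z * f z"
        using ode[OF z] by (simp add: eq_neg_iff_add_eq_0 algebra_simps)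
      then have "deriv (deriv f) z - (- th2 z * f z + deriv f z * th z) = (th z + et z) * (deriv f z - th z * f z)"
        by (simp add: cb1_def cb2_def algebra_simps)
      moreover have "((\<lambda>z. deriv f z - th z * f z) has_field_derivative
          deriv (deriv f) z - (- th2 z * f z + deriv f z * th z)) (at z)"
        using DERIV_diff[OF f1(2)[OF z] DERIV_mult'[OF pf_derivative[OF zD] f1(1)[OF z]]]
        by (simp add: mult.commute add.commute)
      ultimately show ?thesis by simp
    qed
    have B: "((\<lambda>z. u z * w z) has_field_derivative (th z + et z) * (u z * w z)) (at z)"
      by (rule derivative_eq_intros d(1,3)[OF z] refl)+ (simp add: algebra_simps)
    have "u z * w z \<noteq> 0" using d(4,5)[OF z] by simp
    from DERIV_divide[OF A B this] show ?thesis by (simp add: mult_ac)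
  qed
  from const[OF this] obtain c1 where c1: "\<forall>z\<in>W. (deriv f z - th z * f z) / (u z * w z) = c1"
    unfolding constant_on_def by blast
  have "((\<lambda>z. f z / u z - c1 * \<phi> z) has_field_derivative 0) (at z)" if z: "z \<in> W" for z
  proof -
    have "deriv f z - th z * f z = c1 * (u z * w z)"
      using c1[rule_format, OF z] d(4,5)[OF z] by (simp add: field_simps)
    then have "(deriv f z * u z - f z * (th z * u z)) / (u z * u z) - c1 * w z = 0"
      using d(5)[OF z] by (simp add: field_simps)
    then show ?thesis
      using DERIV_diff[OF DERIV_divide[OF f1(1)[OF z] d(1)[OF z] d(5)[OF z]] DERIV_cmult[OF d(2)[OF z], of c1]] by simp
  qed
  from const[OF this] obtain c0 where c0: "\<forall>z\<in>W. f z / u z - c1 * \<phi> z = c0"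
    unfolding constant_on_def by blast
  have "f z = u z * (c0 + c1 * \<phi> z)" if "z \<in> W" for z
    using c0[rule_format, OF that] d(5)[OF that] by (auto simp: field_simps)
  then show thesis by (intro that[of c0 c1]) (simp add: bsol_def u_def \<phi>_def)
qed

text \<open>At a finite point \<open>ode_form\<close> is applied on a disc. At infinity the equation
  is given only at the finite points nearby, so \<open>ode_form\<close> is applied on a punctured
  neighbourhood and the identity extends to infinity by continuity.\<close>

lemma solution_form:
  assumes b: "branch3 \<beta>0 \<beta>1 V L0 L1 \<Phi>" and p: "p \<in> tau_dom V" and y: "local_solution cb1 cb2 p y"
  obtains c0 c1 where "\<forall>\<^sub>F x in nhds p. y x = bsol L0 L1 \<Phi> c0 c1 x"
proof -
  obtain U where U: "open U" "p \<in> U" "cp1_holomorphic_on y U"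
    and ode: "\<And>z. CFin z \<in> U \<Longrightarrow> deriv (deriv (\<lambda>z. y (CFin z))) z + cb1 z * deriv (\<lambda>z. y (CFin z)) z + cb2 z * y (CFin z) = 0"
    using y unfolding local_solution_def Let_def by blast
  define U' where "U' = U \<inter> tau_dom V"
  have U': "open U'" "p \<in> U'" using U p open_tau_dom[OF branch3D(1)[OF b]] by (auto simp: U'_def)
  have o: "open (CFin -` U')" "open (chart_inf -` U')" using U'(1) by (auto simp: open_cp1_def)
  have hol: "(\<lambda>z. y (CFin z)) holomorphic_on (CFin -` U')"
    using U(3) unfolding cp1_holomorphic_on_def U'_def by (auto elim: holomorphic_on_subset)
  have form: "\<exists>c0 c1. \<forall>z\<in>W. y (CFin z) = bsol L0 L1 \<Phi> c0 c1 (CFin z)"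
    if W: "open W" "connected W" "W \<subseteq> CFin -` U'" for W
  proof -
    have "W \<subseteq> CFin -` tau_dom V" using W(3) by (auto simp: U'_def)
    moreover have "(\<lambda>z. y (CFin z)) holomorphic_on W" using hol W(3) holomorphic_on_subset by blast
    moreover have "CFin z \<in> U" if "z \<in> W" for z using that W(3) by (auto simp: U'_def)
    ultimately show ?thesis using ode_form[OF b W(1,2)] ode by metis
  qed
  show thesis
  proof (cases p)
    case (CFin z0)
    then obtain r where r: "r > 0" "ball z0 r \<subseteq> CFin -` U'"
      using o(1) U'(2) open_contains_ball by (metis vimageI)
    then obtain c0 c1 where "\<forall>z\<in>ball z0 r. y (CFin z) = bsol L0 L1 \<Phi> c0 c1 (CFin z)"
      using form[of "ball z0 r"] by auto
    then have "\<forall>\<^sub>F z in nhds z0. y (CFin z) = bsol L0 L1 \<Phi> c0 c1 (CFin z)"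
      using r(1) unfolding eventually_nhds by (intro exI[of _ "ball z0 r"]) auto
    then show thesis by (intro that[of c0 c1]) (simp only: CFin eventually_nhds_CFin)
  next
    case CInf
    have "0 \<in> chart_inf -` U'" using CInf U'(2) by (simp add: chart_inf_def)
    then obtain r where r: "r > 0" "ball 0 r \<subseteq> chart_inf -` U'"
      using o(2) open_contains_ball by blast
    \<comment> \<open>A punctured neighbourhood of infinity in the coordinate z. It is not convex
      but connected, which is why \<open>ode_form\<close> asks for connectedness.\<close>
    let ?W = "inverse ` (ball 0 r - {0 :: complex})"
    have "connected ?W"
      by (intro connected_continuous_image continuous_intros connected_punctured_ball) auto
    moreover have W: "?W = (- {0}) \<inter> inverse -` ball 0 r"
    proof
      show "(- {0}) \<inter> inverse -` ball 0 r \<subseteq> ?W"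
      proof
        fix z :: complex assume "z \<in> (- {0}) \<inter> inverse -` ball 0 r"
        then have "inverse z \<in> ball 0 r - {0}" "z = inverse (inverse z)" by auto
        then show "z \<in> ?W" by (rule rev_image_eqI)
      qed
    qed auto
    have "open ((- {0}) \<inter> inverse -` ball 0 r :: complex set)"
      by (intro continuous_open_preimage continuous_intros) auto
    moreover have "?W \<subseteq> CFin -` U'"
    proof
      fix z assume "z \<in> ?W"
      then obtain v where v: "v \<in> ball 0 r" "v \<noteq> 0" "z = inverse v" by blast
      then have "chart_inf v \<in> U'" using r(2) by auto
      then show "z \<in> CFin -` U'" using v by (simp add: chart_inf_def)
    qed
    ultimately obtain c0 c1 where c: "\<forall>z\<in>?W. y (CFin z) = bsol L0 L1 \<Phi> c0 c1 (CFin z)"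
      using form[of ?W] W by metis
    let ?h = "\<lambda>v. y (chart_inf v) - bsol L0 L1 \<Phi> c0 c1 (chart_inf v)"
    have h0: "?h v = 0" if "v \<in> ball 0 r" "v \<noteq> 0" for v
    proof -
      have "inverse v \<in> ?W" using that by blast
      then show ?thesis using c that by (simp add: chart_inf_def)
    qed
    have "cp1_holomorphic_on (bsol L0 L1 \<Phi> c0 c1) (tau_dom V)"
      using germ_holomorphic[OF b] unfolding bsol_def[abs_def] .
    then have "?h holomorphic_on ball 0 r"
      using U(3) r(2) unfolding cp1_holomorphic_on_def U'_def
      by (intro holomorphic_on_diff) (auto elim!: holomorphic_on_subset)
    then have "isCont ?h 0"
      using r(1) by (intro continuous_on_interior[OF holomorphic_on_imp_continuous_on]) auto
    then have "(?h \<longlongrightarrow> ?h 0) (at 0)" by (simp add: isCont_def)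
    moreover have "(?h \<longlongrightarrow> 0) (at 0)"
    proof (rule tendsto_eventually)
      show "\<forall>\<^sub>F v in at 0. ?h v = 0"
        unfolding eventually_at using r(1) h0 by (intro exI[of _ r]) (auto simp: dist_commute)
    qed
    ultimately have "?h 0 = 0" using tendsto_unique[OF at_neq_bot] by blast
    then have "?h v = 0" if "v \<in> ball 0 r" for v using h0 that by blast
    then have "\<forall>\<^sub>F v in nhds 0. y (chart_inf v) = bsol L0 L1 \<Phi> c0 c1 (chart_inf v)"
      using r(1) unfolding eventually_nhds by (intro exI[of _ "ball 0 r"]) auto
    then show thesis by (intro that[of c0 c1]) (simp only: CInf eventually_nhds_CInf)
  qed
qed

lemma germ_sum:
  "(\<Sum>j\<in>UNIV. c $ j * germ (\<lambda>t. (L0 t, L1 t, \<Phi> t)) R x $ j) =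
     bsol L0 L1 \<Phi> ((R *v c) $ 1) ((R *v c) $ 2) x"
  by (simp add: germ_component bsol_def matrix_vector_mult_def sum_2 algebra_simps)

text \<open>For independence, \<open>sigma\<close> carries a vanishing combination to
  \<open>k0 + k1 * \<Phi> = 0\<close> near \<open>tau p\<close>; differentiation gives
  \<open>k1 = 0\<close>, since the derivative of \<open>\<Phi>\<close> is an exponential. Spanning
  is \<open>solution_form\<close>.\<close>

lemma solution_basis_germ:
  assumes s: "sec3 \<beta>0 \<beta>1 V \<Psi>" and p: "p \<in> tau_dom V" and R: "invertible R"
  shows "solution_basis cb1 cb2 p (germ \<Psi> R)"
proof -
  obtain L0 L1 \<Phi> where \<Psi>: "\<Psi> = (\<lambda>x. (L0 x, L1 x, \<Phi> x))" and b: "branch3 \<beta>0 \<beta>1 V L0 L1 \<Phi>"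
    using s unfolding sec3_def by blast
  obtain R' where R': "R ** R' = mat 1" "R' ** R = mat 1" using R unfolding invertible_def by blast
  show ?thesis
    unfolding solution_basis_def
  proof (intro conjI allI impI)
    show "local_solution cb1 cb2 p (\<lambda>x. germ \<Psi> R x $ j)" for j
      using local_solution_bsol[OF b p] unfolding \<Psi> germ_component bsol_def[abs_def] .
  next
    fix c :: "complex^2"
    assume "\<forall>\<^sub>F x in nhds p. (\<Sum>j\<in>UNIV. c $ j * germ \<Psi> R x $ j) = 0"
    then obtain N where N: "open N" "p \<in> N"
      "\<And>x. x \<in> N \<Longrightarrow> bsol L0 L1 \<Phi> ((R *v c) $ 1) ((R *v c) $ 2) x = 0"
      unfolding \<Psi> germ_sum eventually_nhds by blast
    define k0 k1 where "k0 = (R *v c) $ 1" and "k1 = (R *v c) $ 2"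
    have pa3: "p \<noteq> a3" using p by (auto simp: tau_dom_def)
    have "open (sigma -` N)"
      using sigma_continuous N(1) open_vimage by blast
    then have o: "open (sigma -` N \<inter> V)" using branch3D(1)[OF b] by auto
    have c: "tau p \<in> sigma -` N \<inter> V" using p N(2) sigma_tau[OF pa3] by (auto simp: tau_dom_def)
    have z: "k0 + k1 * \<Phi> t = 0" if "t \<in> sigma -` N \<inter> V" for t
      using N(3)[of "sigma t"] that tau_sigma[of t] by (simp add: bsol_def k0_def k1_def)
    have "((\<lambda>t. k0 + k1 * \<Phi> t) has_field_derivative k1 * exp (\<beta>0 * L0 (tau p) + \<beta>1 * L1 (tau p))) (at (tau p))"
      using branch3D(6)[OF b, of "tau p"] c by (auto intro!: derivative_eq_intros)
    moreover have "((\<lambda>t. k0 + k1 * \<Phi> t) has_field_derivative 0) (at (tau p))"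
      by (rule has_field_derivative_transform_within_open[OF DERIV_const[of 0] o c]) (simp add: z)
    ultimately have "k1 * exp (\<beta>0 * L0 (tau p) + \<beta>1 * L1 (tau p)) = 0" by (rule DERIV_unique)
    then have "k1 = 0" by simp
    moreover from this have "k0 = 0" using z[OF c] by simp
    ultimately have "R *v c = 0"
      unfolding k0_def k1_def by (simp add: vec_eq_iff forall_2)
    then have "R' *v (R *v c) = 0" by simp
    then show "c = 0" by (simp add: matrix_vector_mul_assoc R')
  next
    fix y assume "local_solution cb1 cb2 p y"
    then obtain c0 c1 where c: "\<forall>\<^sub>F x in nhds p. y x = bsol L0 L1 \<Phi> c0 c1 x"
      using solution_form[OF b p] by blast
    let ?k = "(\<chi> j. if j = 1 then c0 else c1) :: complex^2"
    have "R *v (R' *v ?k) = ?k" by (simp add: matrix_vector_mul_assoc R')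
    then show "\<exists>c. \<forall>\<^sub>F x in nhds p. y x = (\<Sum>j\<in>UNIV. c $ j * germ \<Psi> R x $ j)"
      unfolding \<Psi> germ_sum using c by (intro exI[of _ "R' *v ?k"]) simp
  qed
qed

end

section \<open>The monodromy representation\<close>

lemma continuous_on_chart_inf: "continuous_on UNIV chart_inf"
proof -
  have "chart_inf = (\<lambda>u. hpoint 1 u)" by (auto simp: fun_eq_iff chart_inf_def hpoint_def inverse_eq_divide)
  moreover have "continuous_on UNIV (\<lambda>u. hpoint 1 u)"
    by (intro continuous_on_hpoint) (auto intro: continuous_intros)
  ultimately show ?thesis by simp
qed

lemma continuous_on_CFin: "continuous_on UNIV CFin"
proof -
  have eq: "CFin = (\<lambda>z. hpoint z 1)" by (auto simp: fun_eq_iff hpoint_def)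
  have "continuous_on UNIV (\<lambda>z. hpoint z 1)"
    by (intro continuous_on_hpoint) (auto intro: continuous_intros)
  then show ?thesis by (subst eq)
qed

text \<open>A coordinate centred at \<open>a\<close>, finite or not, in which every
  \<open>circle_at\<close> and \<open>disc_at\<close> is the image of a circle or disc about
  0.\<close>

fun chart_at :: "cp1 \<Rightarrow> complex \<Rightarrow> cp1" where
  "chart_at (CFin c) u = CFin (c + u)"
| "chart_at CInf u = chart_inf u"

lemma chart_at_continuous: "continuous_on UNIV (chart_at a)"
proof (cases a)
  case (CFin c)
  have "chart_at a = (\<lambda>u. CFin (c + u))" by (simp add: CFin fun_eq_iff)
  moreover have "continuous_on UNIV (\<lambda>u. CFin (c + u))"
    by (rule continuous_on_compose2[OF continuous_on_CFin]) (auto intro: continuous_intros)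
  ultimately show ?thesis by simp
next
  case CInf
  then have "chart_at a = chart_inf" by (simp add: fun_eq_iff)
  then show ?thesis using continuous_on_chart_inf by simp
qed

lemma chart_at_0: "chart_at a 0 = a"
  by (cases a) (auto simp: chart_inf_def)

lemma chart_at_inject: "chart_at a u = chart_at a v \<Longrightarrow> u = v"
  by (cases a) (auto simp: chart_inf_def split: if_splits)

lemma circle_at_chart: "circle_at a r = chart_at a \<circ> circlepath 0 r"
  by (cases a) (auto simp: fun_eq_iff circlepath)

lemma disc_at_chart: "disc_at a r = chart_at a ` cball 0 r"
proof (cases a)
  case (CFin c)
  have "cball c r = (\<lambda>u. c + u) ` cball 0 r" by (simp add: image_add_cball)
  moreover have "chart_at (CFin c) = (\<lambda>u. CFin (c + u))" by auto
  ultimately show ?thesis by (simp only: CFin disc_at.simps image_image)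
next
  case CInf
  then show ?thesis by (auto simp: image_iff)
qed

text \<open>A continuous function without zeros on a disc has a continuous logarithm there, which
  returns to its value after one turn. An additional factor \<open>u\<close> contributes 2 pi
  i.\<close>

lemma circle_log_increment:
  assumes G: "continuous_on (cball 0 r) G" "\<And>u. u \<in> cball 0 r \<Longrightarrow> G u \<noteq> 0" and r: "r > 0"
  shows "\<exists>l. path l \<and> (\<forall>s\<in>{0..1}. exp (l s) = G (circlepath 0 r s)) \<and> l 1 - l 0 = 0"
    and "\<exists>l. path l \<and> (\<forall>s\<in>{0..1}. exp (l s) = circlepath 0 r s * G (circlepath 0 r s)) \<and> l 1 - l 0 = two_pi_i"
proof -
  obtain L where L: "continuous_on (cball 0 r) L" "\<And>u. u \<in> cball 0 r \<Longrightarrow> G u = exp (L u)"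
    using continuous_logarithm_on_cball[OF G] by blast
  have im: "circlepath 0 r s \<in> cball 0 r" for s
    using r by (simp add: circlepath norm_mult)
  have cont: "continuous_on {0..1} (\<lambda>s. L (circlepath 0 r s))"
    by (rule continuous_on_compose2[OF L(1)]) (use path_circlepath[of 0 r] im in \<open>auto simp: path_def\<close>)
  have e: "circlepath 0 r 0 = r" "circlepath 0 r 1 = r" by (simp_all add: circlepath)
  show "\<exists>l. path l \<and> (\<forall>s\<in>{0..1}. exp (l s) = G (circlepath 0 r s)) \<and> l 1 - l 0 = 0"
    using cont L(2)[OF im] by (intro exI[of _ "\<lambda>s. L (circlepath 0 r s)"]) (auto simp: path_def e)
  show "\<exists>l. path l \<and> (\<forall>s\<in>{0..1}. exp (l s) = circlepath 0 r s * G (circlepath 0 r s)) \<and> l 1 - l 0 = two_pi_i"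
  proof (intro exI[of _ "\<lambda>s. of_real (ln r) + two_pi_i * of_real s + L (circlepath 0 r s)"] conjI ballI)
    show "path (\<lambda>s. of_real (ln r) + two_pi_i * of_real s + L (circlepath 0 r s))"
      unfolding path_def by (intro continuous_intros cont)
    fix s :: real
    have "exp (complex_of_real (ln r)) = of_real r" using r by (simp add: exp_of_real)
    then show "exp (of_real (ln r) + two_pi_i * of_real s + L (circlepath 0 r s)) = circlepath 0 r s * G (circlepath 0 r s)"
      unfolding exp_add L(2)[OF im] by (simp add: circlepath)
  qed (simp add: e)
qed

section \<open>The representation \<open>chi\<close> obtained by lifting loops at
  \<open>p\<close>\<close>

locale monodromy_data = riemann_data +
  fixes p :: cp1
  assumes p: "p \<notin> D"
begin

abbreviation pi1 :: "(real \<Rightarrow> cp1) set monoid" where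
  "pi1 \<equiv> fundamental_group (- D) p"

abbreviation cls :: "(real \<Rightarrow> cp1) \<Rightarrow> (real \<Rightarrow> cp1) set" where
  "cls \<equiv> loop_class (- D)"

definition base :: triple where "base = (Ln (tau p), Ln (tau p - 1), 0)"

lemma base_fib: "base \<in> fib3 (tau p)"
proof -
  have "tau p \<noteq> 0" "tau p - 1 \<noteq> 0" using tau_in[OF p] by auto
  then show ?thesis by (simp add: base_def fib3_def)
qed

definition has_deck :: "(real \<Rightarrow> cp1) \<Rightarrow> triple \<Rightarrow> bool" where
  "has_deck g d \<longleftrightarrow> is_deck d \<and> (\<exists>m. gs.lift \<beta>0 \<beta>1 (tau \<circ> g) m \<and> m 0 = base \<and> m 1 = deck \<beta>0 \<beta>1 d base)"

lemma tau_path: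
  assumes "path g" "path_image g \<subseteq> - D"
  shows "path (tau \<circ> g)" "path_image (tau \<circ> g) \<subseteq> - {0, 1}"
proof -
  show "path (tau \<circ> g)"
    using assms tau_continuous by (intro path_continuous_image) (auto elim: continuous_on_subset)
  show "path_image (tau \<circ> g) \<subseteq> - {0, 1}"
  proof
    fix x assume "x \<in> path_image (tau \<circ> g)"
    then obtain y where y: "y \<in> path_image g" "x = tau y" unfolding path_image_compose by blast
    then have "y \<notin> D" using assms(2) by blast
    then show "x \<in> - {0, 1}" using tau_in y(2) by simp
  qed
qed

lemma loopsD:
  assumes "g \<in> loops (- D) p"
  shows "path g" "path_image g \<subseteq> - D" "g 0 = p" "g 1 = p"
  using assms unfolding loops_def pathstart_def pathfinish_def by blast+

lemma has_deck_exists: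
  assumes g: "g \<in> loops (- D) p"
  shows "\<exists>d. has_deck g d"
proof -
  note l = loopsD[OF g]
  have "base \<in> fib3 (pathstart (tau \<circ> g))" using base_fib l(3) by (simp add: pathstart_def)
  then obtain m where m: "gs.lift \<beta>0 \<beta>1 (tau \<circ> g) m" "m 0 = base"
    using gs.lift_exists[OF tau_path[OF l(1,2)]] by blast
  have "m 1 \<in> fib3 (tau p)" using gs.lift_fib[OF m(1), of 1] l(4) by simp
  then obtain d where "is_deck d" "m 1 = deck \<beta>0 \<beta>1 d base"
    using deck_exists[OF base_fib] by blast
  then show ?thesis using m unfolding has_deck_def by blast
qed

lemma has_deck_unique:
  assumes g: "g \<in> loops (- D) p" and "has_deck g d" "has_deck g d'"
  shows "d = d'"
proof -
  obtain m m' where m: "gs.lift \<beta>0 \<beta>1 (tau \<circ> g) m" "m 0 = base" "m 1 = deck \<beta>0 \<beta>1 d base"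
    and m': "gs.lift \<beta>0 \<beta>1 (tau \<circ> g) m'" "m' 0 = base" "m' 1 = deck \<beta>0 \<beta>1 d' base"
    using assms(2,3) unfolding has_deck_def by blast
  have c: "continuous_on {0..1} (tau \<circ> g)" using tau_path[OF loopsD(1,2)[OF g]] by (simp add: path_def)
  have "m 1 = m' 1"
    by (rule gs.lift_unique[OF c m(1) m'(1)]) (simp_all add: m m')
  then have "deck \<beta>0 \<beta>1 d base = deck \<beta>0 \<beta>1 d' base" using m(3) m'(3) by simp
  then show ?thesis by (rule deck_inject)
qed

lemma has_deck_homotopic:
  assumes "homotopic_paths (- D) g h" "has_deck g d"
  shows "has_deck h d"
proof -
  obtain m where m: "gs.lift \<beta>0 \<beta>1 (tau \<circ> g) m" "m 0 = base" "m 1 = deck \<beta>0 \<beta>1 d base"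
    using assms(2) unfolding has_deck_def by blast
  have "homotopic_paths (- {0, 1}) (tau \<circ> g) (tau \<circ> h)"
    using assms(1) tau_continuous tau_in by (intro homotopic_paths_continuous_image) auto
  from gs.lift_homotopic[OF this m(1)]
  obtain m' where "gs.lift \<beta>0 \<beta>1 (tau \<circ> h) m'" "m' 0 = m 0" "m' 1 = m 1" by blast
  then show ?thesis using assms(2) m unfolding has_deck_def by auto
qed

fun dcomp :: "triple \<Rightarrow> triple \<Rightarrow> triple" where
  "dcomp (u0, u1, F) (u0', u1', F') = (u0 + u0', u1 + u1', exp (\<beta>0 * u0 + \<beta>1 * u1) * F' + F)"

lemma deck_dcomp: "deck \<beta>0 \<beta>1 (dcomp d d') v = deck \<beta>0 \<beta>1 d (deck \<beta>0 \<beta>1 d' v)"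
  by (cases d; cases d'; cases v) (simp add: algebra_simps exp_add)

lemma is_deck_dcomp: "is_deck d \<Longrightarrow> is_deck d' \<Longrightarrow> is_deck (dcomp d d')"
  by (cases d; cases d') (simp add: is_deck_def exp_add)

text \<open>The lift of \<open>h\<close> starting at \<open>deck \<beta>0 \<beta>1 d base\<close> is
  the image under \<open>d\<close> of the lift starting at \<open>base\<close>. So the first loop
  acts outermost, and the order of composition is that of the loops: this makes \<open>chi\<close> a
  homomorphism and not an antihomomorphism.\<close>

lemma has_deck_join:
  assumes g: "g \<in> loops (- D) p" and h: "h \<in> loops (- D) p" and "has_deck g d" "has_deck h d'"
  shows "has_deck (g +++ h) (dcomp d d')"
proof -
  obtain m m' where m: "gs.lift \<beta>0 \<beta>1 (tau \<circ> g) m" "m 0 = base" "m 1 = deck \<beta>0 \<beta>1 d base"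
    and m': "gs.lift \<beta>0 \<beta>1 (tau \<circ> h) m'" "m' 0 = base" "m' 1 = deck \<beta>0 \<beta>1 d' base"
    and dd: "is_deck d" "is_deck d'"
    using assms(3,4) unfolding has_deck_def by blast
  have "gs.lift \<beta>0 \<beta>1 ((tau \<circ> g) +++ (tau \<circ> h)) (m +++ (\<lambda>t. deck \<beta>0 \<beta>1 d (m' t)))"
    using lift_deck[OF m'(1) dd(1)] m m' tau_path[OF loopsD(1,2)[OF g]] tau_path[OF loopsD(1,2)[OF h]]
      loopsD[OF g] loopsD[OF h]
    by (intro gs.lift_join) (auto simp: pathstart_def pathfinish_def)
  moreover have "(tau \<circ> g) +++ (tau \<circ> h) = tau \<circ> (g +++ h)" by (simp add: path_compose_join)
  moreover have "(m +++ (\<lambda>t. deck \<beta>0 \<beta>1 d (m' t))) 0 = base"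
    "(m +++ (\<lambda>t. deck \<beta>0 \<beta>1 d (m' t))) 1 = deck \<beta>0 \<beta>1 (dcomp d d') base"
    using m m' by (auto simp: joinpaths_def deck_dcomp)
  ultimately show ?thesis using is_deck_dcomp[OF dd] unfolding has_deck_def by metis
qed

text \<open>Rows of solutions transform by \<open>yv (deck d v) = yv v v* M\<close>; this is \<open>M\<^sup>-\<^sup>1\<close>.\<close>

definition gmat :: "triple \<Rightarrow> complex^2^2" where
  "gmat d = (let A = exp (\<alpha>0 * fst d + \<alpha>1 * fst (snd d)); B = exp (\<beta>0 * fst d + \<beta>1 * fst (snd d)) in
     \<chi> i j. if i = 1 then (if j = 1 then 1 / A else - snd (snd d) / (A * B)) else (if j = 1 then 0 else 1 / (A * B)))"

lemma gmat_entries: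
  "gmat d $ 1 $ 1 = 1 / exp (\<alpha>0 * fst d + \<alpha>1 * fst (snd d))"
  "gmat d $ 1 $ 2 = - snd (snd d) / (exp (\<alpha>0 * fst d + \<alpha>1 * fst (snd d)) * exp (\<beta>0 * fst d + \<beta>1 * fst (snd d)))"
  "gmat d $ 2 $ 1 = 0"
  "gmat d $ 2 $ 2 = 1 / (exp (\<alpha>0 * fst d + \<alpha>1 * fst (snd d)) * exp (\<beta>0 * fst d + \<beta>1 * fst (snd d)))"
  by (simp_all add: gmat_def Let_def)

lemma yv_deck: "yv v = yv (deck \<beta>0 \<beta>1 d v) v* gmat d"
proof -
  obtain u0 u1 F l0 l1 f where d: "d = (u0, u1, F)" and v: "v = (l0, l1, f)" by (metis prod.exhaust)
  define A B E where "A = exp (\<alpha>0 * u0 + \<alpha>1 * u1)" and "B = exp (\<beta>0 * u0 + \<beta>1 * u1)" and "E = exp (\<alpha>0 * l0 + \<alpha>1 * l1)"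
  have nz: "A \<noteq> 0" "B \<noteq> 0" by (simp_all add: A_def B_def)
  have y: "yv (deck \<beta>0 \<beta>1 d v) $ 1 = E * A" "yv (deck \<beta>0 \<beta>1 d v) $ 2 = E * A * (B * f + F)"
    "yv v $ 1 = E" "yv v $ 2 = E * f"
    by (simp_all add: yv_def d v A_def B_def E_def exp_add ring_distribs)
  have g: "gmat d $ 1 $ 1 = 1 / A" "gmat d $ 1 $ 2 = - F / (A * B)" "gmat d $ 2 $ 1 = 0" "gmat d $ 2 $ 2 = 1 / (A * B)"
    by (simp_all add: gmat_entries d A_def B_def)
  show ?thesis
    using nz by (simp add: vec_eq_iff forall_2 vector_matrix_mult_def sum_2 y g field_simps)
qed

lemma gmat_dcomp: "gmat (dcomp d d') = gmat d ** gmat d'"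
proof -
  obtain u0 u1 F u0' u1' F' where d: "d = (u0, u1, F)" "d' = (u0', u1', F')" by (metis prod.exhaust)
  define A B A' B' where "A = exp (\<alpha>0 * u0 + \<alpha>1 * u1)" and "B = exp (\<beta>0 * u0 + \<beta>1 * u1)"
    and "A' = exp (\<alpha>0 * u0' + \<alpha>1 * u1')" and "B' = exp (\<beta>0 * u0' + \<beta>1 * u1')"
  have nz: "A \<noteq> 0" "B \<noteq> 0" "A' \<noteq> 0" "B' \<noteq> 0" by (simp_all add: A_def B_def A'_def B'_def)
  have e: "exp (\<alpha>0 * (u0 + u0') + \<alpha>1 * (u1 + u1')) = A * A'" "exp (\<beta>0 * (u0 + u0') + \<beta>1 * (u1 + u1')) = B * B'"
    by (simp_all add: A_def B_def A'_def B'_def exp_add ring_distribs)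
  have g: "gmat d $ 1 $ 1 = 1 / A" "gmat d $ 1 $ 2 = - F / (A * B)" "gmat d $ 2 $ 1 = 0" "gmat d $ 2 $ 2 = 1 / (A * B)"
    "gmat d' $ 1 $ 1 = 1 / A'" "gmat d' $ 1 $ 2 = - F' / (A' * B')" "gmat d' $ 2 $ 1 = 0" "gmat d' $ 2 $ 2 = 1 / (A' * B')"
    by (simp_all add: gmat_entries d A_def B_def A'_def B'_def)
  have h: "gmat (dcomp d d') $ 1 $ 1 = 1 / (A * A')" "gmat (dcomp d d') $ 1 $ 2 = - (B * F' + F) / (A * A' * (B * B'))"
    "gmat (dcomp d d') $ 2 $ 1 = 0" "gmat (dcomp d d') $ 2 $ 2 = 1 / (A * A' * (B * B'))"
    by (simp_all add: gmat_entries d e B_def)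
  show ?thesis
    using nz by (simp add: vec_eq_iff forall_2 matrix_matrix_mult_def sum_2 g h field_simps)
qed

lemma invertible_gmat: "invertible (gmat d)"
  by (simp add: invertible_det_nz det_2 gmat_entries)

definition chi :: "(real \<Rightarrow> cp1) set \<Rightarrow> complex^2^2" where
  "chi C = gmat (SOME d. \<exists>g\<in>C \<inter> loops (- D) p. has_deck g d)"

text \<open>The choice in \<open>chi\<close> is unambiguous: homotopic loops have the same deck
  transformation, and each loop has only one.\<close>

lemma chi_loop_class:
  assumes g: "g \<in> loops (- D) p" and m: "has_deck g d"
  shows "chi (cls g) = gmat d"
proof -
  have self: "g \<in> cls g \<inter> loops (- D) p"
    using g by (auto simp: loop_class_def loops_def)
  let ?P = "\<lambda>d. \<exists>h\<in>cls g \<inter> loops (- D) p. has_deck h d"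
  have "?P (SOME d. ?P d)" using self m by (intro someI[of ?P d]) blast
  then obtain h where h: "homotopic_paths (- D) g h" "h \<in> loops (- D) p" "has_deck h (SOME d. ?P d)"
    by (auto simp: loop_class_def)
  have "has_deck h d" using has_deck_homotopic[OF h(1) m] .
  then have "(SOME d. ?P d) = d" using has_deck_unique[OF h(2)] h(3) by blast
  then show ?thesis by (simp add: chi_def)
qed

lemma chi_hom: "chi \<in> hom pi1 GL"
proof (rule homI)
  fix x assume "x \<in> carrier pi1"
  then show "chi x \<in> carrier GL" unfolding chi_def GL_def by (simp add: invertible_gmat)
next
  have carr: "carrier pi1 = cls ` loops (- D) p"
    by (simp add: fundamental_group_def)
  fix x y assume "x \<in> carrier pi1" "y \<in> carrier pi1"
  then obtain g h where g: "g \<in> loops (- D) p" "x = cls g" and h: "h \<in> loops (- D) p" "y = cls h"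
    unfolding carr by blast
  obtain d d' where d: "has_deck g d" "has_deck h d'" using has_deck_exists g(1) h(1) by blast
  show "chi (x \<otimes>\<^bsub>pi1\<^esub> y) = chi x \<otimes>\<^bsub>GL\<^esub> chi y"
    unfolding g(2) h(2) loop_class_mult[OF g(1) h(1)]
      chi_loop_class[OF loops_join[OF g(1) h(1)] has_deck_join[OF g(1) h(1) d]]
      chi_loop_class[OF g(1) d(1)] chi_loop_class[OF h(1) d(2)]
    by (simp add: GL_def gmat_dcomp)
qed

text \<open>\<open>R\<close> is a change of basis: the row \<open>germ \<Psi> R\<close> continues to
  \<open>germ ?\<Psi>' R\<close>, and \<open>yv_deck\<close> expresses the first through the second
  by the matrix \<open>R' ** gmat d ** R\<close>.\<close>

lemma realizes_conjugate:
  assumes R: "R ** R' = mat 1" "R' ** R = mat 1"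
    and \<rho>: "\<And>g. g \<in> loops (- D) p \<Longrightarrow> \<rho> (cls g) = R' ** chi (cls g) ** R"
  shows "realizes D p cb1 cb2 \<rho>"
proof -
  have tp: "tau p \<in> - {0, 1}" using tau_in[OF p] .
  obtain e where e: "e > 0" "ball (tau p) e \<subseteq> - {0, 1}"
    by (rule openE[OF gs.open_S tp])
  from gs.sec_exists[OF base_fib this]
  obtain \<Psi> where \<Psi>: "sec3 \<beta>0 \<beta>1 (ball (tau p) e) \<Psi>" "\<Psi> (tau p) = base" by blast
  have pd: "p \<in> tau_dom (ball (tau p) e)" using p e by (simp add: tau_dom_def)
  have "invertible R" using R unfolding invertible_def by blast
  then have sb: "solution_basis cb1 cb2 p (germ \<Psi> R)" by (rule solution_basis_germ[OF \<Psi>(1) pd])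
  have "monodromy_matrix (germ \<Psi> R) g (\<rho> (cls g))" if g: "g \<in> loops (- D) p" for g
  proof -
    note l = loopsD[OF g]
    obtain d where d: "has_deck g d" using has_deck_exists[OF g] by blast
    then obtain m where m: "gs.lift \<beta>0 \<beta>1 (tau \<circ> g) m" "m 0 = base" "m 1 = deck \<beta>0 \<beta>1 d base" and dd: "is_deck d"
      unfolding has_deck_def by blast
    let ?\<Psi>' = "\<lambda>x. deck \<beta>0 \<beta>1 d (\<Psi> x)"
    have "continuation_along g (germ \<Psi> R) (germ ?\<Psi>' R)"
      by (rule continuation_of_lift[OF l(1,2) m(1) \<Psi>(1) _ _ sec3_deck[OF \<Psi>(1) dd]])
         (use e l m \<Psi>(2) in auto)
    moreover have "germ \<Psi> R x = germ ?\<Psi>' R x v* (R' ** gmat d ** R)" for x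
    proof -
      have "germ ?\<Psi>' R x v* (R' ** gmat d ** R) = yv (?\<Psi>' (tau x)) v* (R ** (R' ** gmat d ** R))"
        unfolding germ_def by (simp add: vector_matrix_mul_assoc)
      also have "R ** (R' ** gmat d ** R) = gmat d ** R"
        by (simp add: matrix_mul_assoc R)
      also have "yv (?\<Psi>' (tau x)) v* (gmat d ** R) = germ \<Psi> R x"
        unfolding germ_def using yv_deck[of "\<Psi> (tau x)" d] by (simp add: vector_matrix_mul_assoc[symmetric])
      finally show ?thesis by simp
    qed
    ultimately show ?thesis
      unfolding monodromy_matrix_def \<rho>[OF g] chi_loop_class[OF g d] by (auto intro!: exI[of _ "germ ?\<Psi>' R"])
  qed
  then show ?thesis using sb unfolding realizes_def by blast
qed

end

text \<open>The linear form of \<open>b\<close> in the coordinate \<open>u\<close> at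
  \<open>a\<close>. It differs from \<open>lin\<close> by a factor that is the same for all
  \<open>b\<close> and cancels in the quotients \<open>tau\<close> and
  \<open>tau - 1\<close>.\<close>

fun chart_den :: "cp1 \<Rightarrow> cp1 \<Rightarrow> complex \<Rightarrow> complex" where
  "chart_den b (CFin c) u = hden b * (c + u) - hnum b"
| "chart_den b CInf u = hden b - hnum b * u"

lemma chart_den_eq_0_iff: "chart_den b a u = 0 \<longleftrightarrow> chart_at a u = b"
proof (cases a)
  case (CFin c)
  then show ?thesis using lin_eq_0_iff[of b "CFin (c + u)"] by (simp add: lin_CFin)
next
  case CInf
  then show ?thesis using lin_eq_0_iff[of b "chart_inf u"] by (auto simp: lin_chart_inf split: if_splits)
qed

lemma continuous_on_chart_den: "continuous_on A (chart_den b a)"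
proof (cases a)
  case (CFin c)
  then have "chart_den b a = (\<lambda>u. hden b * (c + u) - hnum b)" by (simp add: fun_eq_iff)
  then show ?thesis by (simp add: continuous_intros)
next
  case CInf
  then have "chart_den b a = (\<lambda>u. hden b - hnum b * u)" by (simp add: fun_eq_iff)
  then show ?thesis by (simp add: continuous_intros)
qed

lemma chart_den_self: "chart_den a a u = (if a = CInf then - 1 else 1) * u"
  by (cases a) auto

lemma lin_chart_quotient: "lin b (chart_at a u) / lin b' (chart_at a u) = chart_den b a u / chart_den b' a u"
  by (cases a) (auto simp: lin_CFin lin_chart_inf)

section \<open>Local monodromy at \<open>a1\<close> and \<open>a2\<close>\<close>

context monodromy_data
begin

text \<open>The loop is homotopic to a circle with a tail, and by \<open>lift_deck_conj\<close> its
  deck transformation is that of the lifted circle. The shifts are thus the increments of the two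
  logarithms along the circle; \<open>F\<close> depends on the tail as well and is left
  open.\<close>

lemma loop_around_deck:
  assumes g: "g \<in> loops (- D) p" and la: "loop_around D p a g" and m: "has_deck g d"
    and logs: "\<And>r. \<lbrakk>r > 0; disc_at a r \<inter> D = {a}\<rbrakk> \<Longrightarrow>
      (\<exists>l. path l \<and> (\<forall>s\<in>{0..1}. exp (l s) = tau (circle_at a r s)) \<and> l 1 - l 0 = U0) \<and>
      (\<exists>l. path l \<and> (\<forall>s\<in>{0..1}. exp (l s) = tau (circle_at a r s) - 1) \<and> l 1 - l 0 = U1)"
  shows "fst d = U0" "fst (snd d) = U1"
proof -
  obtain r q where r: "r > 0" "disc_at a r \<inter> D = {a}"
    and q: "path q" "path_image q \<subseteq> - D" "pathstart q = p" "pathfinish q = pathstart (circle_at a r)"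
    and hom: "homotopic_paths (- D) g (q +++ circle_at a r +++ reversepath q)"
    using la unfolding loop_around_def by blast
  let ?k = "circle_at a r"
  let ?w = "q +++ ?k +++ reversepath q"
  have k: "path ?k" unfolding circle_at_chart
    by (intro path_continuous_image path_circlepath) (rule continuous_on_subset[OF chart_at_continuous], simp)
  have kc: "pathstart ?k = pathfinish ?k"
    unfolding circle_at_chart by (simp add: pathstart_compose pathfinish_compose)
  have "?k s \<in> - D" for s
  proof
    assume "?k s \<in> D"
    have s: "circlepath 0 r s \<in> cball 0 r" "circlepath 0 r s \<noteq> 0" using r(1) by (auto simp: circlepath norm_mult)
    then have "?k s \<in> disc_at a r" unfolding disc_at_chart circle_at_chart by simp
    then have "?k s = a" using r(2) \<open>?k s \<in> D\<close> by blast
    then have "chart_at a (circlepath 0 r s) = chart_at a 0" by (simp add: circle_at_chart chart_at_0)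
    then show False using chart_at_inject s(2) by blast
  qed
  then have kD: "path_image ?k \<subseteq> - D" unfolding path_image_def by blast
  have w: "?w \<in> loops (- D) p"
    using g homotopic_paths_imp_path[OF hom] homotopic_paths_imp_subset[OF hom] q(3)
    by (simp add: loops_def)
  have mw: "has_deck ?w d" using has_deck_homotopic[OF hom m] .
  note tq = tau_path[OF q(1,2)] and tk = tau_path[OF k kD]
  have "base \<in> fib3 (pathstart (tau \<circ> q))" using base_fib q(3) by (simp add: pathstart_compose)
  from gs.lift_exists[OF tq this] obtain mq where mq: "gs.lift \<beta>0 \<beta>1 (tau \<circ> q) mq" "mq 0 = base" by blast
  have qk: "pathfinish (tau \<circ> q) = pathstart (tau \<circ> ?k)" "pathfinish (tau \<circ> ?k) = pathstart (tau \<circ> ?k)"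
    using q(4) kc by (simp_all add: pathstart_compose pathfinish_compose)
  have "mq 1 \<in> fib3 (pathstart (tau \<circ> ?k))"
    using gs.lift_fib[OF mq(1), of 1] qk(1) by (simp add: pathfinish_def)
  from gs.lift_exists[OF tk this] obtain mk where mk: "gs.lift \<beta>0 \<beta>1 (tau \<circ> ?k) mk" "mk 0 = mq 1" by blast
  have "mk 0 \<in> fib3 (pathstart (tau \<circ> ?k))" "mk 1 \<in> fib3 (pathstart (tau \<circ> ?k))"
    using gs.lift_fib[OF mk(1), of 0] gs.lift_fib[OF mk(1), of 1] qk(2) by (simp_all add: pathstart_def pathfinish_def)
  from deck_exists[OF this] obtain d' where d': "is_deck d'" "mk 1 = deck \<beta>0 \<beta>1 d' (mk 0)" by blast
  obtain m' where "gs.lift \<beta>0 \<beta>1 ((tau \<circ> q) +++ (tau \<circ> ?k) +++ reversepath (tau \<circ> q)) m'"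
    "m' 0 = mq 0" "m' 1 = deck \<beta>0 \<beta>1 d' (mq 0)"
    using lift_deck_conj[OF tq tk(1) qk mq(1) mk d'(2,1)] by blast
  moreover have "(tau \<circ> q) +++ (tau \<circ> ?k) +++ reversepath (tau \<circ> q) = tau \<circ> ?w"
    by (simp add: path_compose_join path_compose_reversepath)
  ultimately have "has_deck ?w d'" using d'(1) mq(2) unfolding has_deck_def by metis
  then have dd: "d = d'" using has_deck_unique[OF w mw] by blast
  have dec: "fst d' = fst (mk 1) - fst (mk 0)" "fst (snd d') = fst (snd (mk 1)) - fst (snd (mk 0))"
    unfolding d'(2) by (cases d'; cases "mk 0"; simp)+
  obtain l where l: "path l" "\<forall>s\<in>{0..1}. exp (l s) = tau (?k s)" "l 1 - l 0 = U0"
    using logs[OF r] by blast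
  obtain l' where l': "path l'" "\<forall>s\<in>{0..1}. exp (l' s) = tau (?k s) - 1" "l' 1 - l' 0 = U1"
    using logs[OF r] by blast
  show "fst d = U0"
    using lift_log_increments(1)[OF tk(1) mk(1) _ l(1), of 1] l(2,3) dec dd by simp
  show "fst (snd d) = U1"
    using lift_log_increments(2)[OF tk(1) mk(1) _ l'(1), of 1] l'(2,3) dec dd by simp
qed

lemma tau_chart: "tau (chart_at a u) = scal * (chart_den a1 a u / chart_den a3 a u)"
  unfolding lin_chart_quotient[symmetric] by (simp add: tau_def)

lemma tau_chart_minus_1:
  "chart_at a u \<noteq> a3 \<Longrightarrow> tau (chart_at a u) - 1 = lin a1 a3 / lin a2 a1 * (chart_den a2 a u / chart_den a3 a u)"
  unfolding lin_chart_quotient[symmetric] by (simp add: tau_minus_1)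

text \<open>The disc contains no other point of \<open>D\<close>. In the chart at \<open>a1\<close>,
  \<open>tau\<close> is therefore \<open>u\<close> times a function without zeros and
  \<open>tau - 1\<close> has no zeros; at \<open>a2\<close> the roles are exchanged.
  \<open>\<epsilon>\<close> is the sign from \<open>chart_den_self\<close>.\<close>

lemma circle_tau_logs:
  assumes r: "r > 0" and disc: "disc_at a r \<inter> D = {a}"
  shows "a = a1 \<Longrightarrow> (\<exists>l. path l \<and> (\<forall>s\<in>{0..1}. exp (l s) = tau (circle_at a r s)) \<and> l 1 - l 0 = two_pi_i) \<and>
      (\<exists>l. path l \<and> (\<forall>s\<in>{0..1}. exp (l s) = tau (circle_at a r s) - 1) \<and> l 1 - l 0 = 0)"
    and "a = a2 \<Longrightarrow> (\<exists>l. path l \<and> (\<forall>s\<in>{0..1}. exp (l s) = tau (circle_at a r s)) \<and> l 1 - l 0 = 0) \<and>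
      (\<exists>l. path l \<and> (\<forall>s\<in>{0..1}. exp (l s) = tau (circle_at a r s) - 1) \<and> l 1 - l 0 = two_pi_i)"
proof -
  define k where "k = lin a1 a3 / lin a2 a1"
  define \<epsilon> :: complex where "\<epsilon> = (if a = CInf then - 1 else 1)"
  have nz: "k \<noteq> 0" "\<epsilon> \<noteq> 0" using distinct by (simp_all add: k_def \<epsilon>_def lin_eq_0_iff)
  have other: "chart_den b a u \<noteq> 0" if "b \<in> D" "b \<noteq> a" "u \<in> cball 0 r" for b u
  proof
    assume "chart_den b a u = 0"
    then have "b \<in> disc_at a r" using that(3) unfolding chart_den_eq_0_iff disc_at_chart by blast
    then show False using disc that by blast
  qed
  have self: "chart_den a a u = u * \<epsilon>" for u by (simp add: chart_den_self \<epsilon>_def)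
  have im: "circlepath 0 r s \<in> cball 0 r" for s using r by (simp add: circlepath norm_mult)
  let ?c = "circlepath 0 r"
  have c: "circle_at a r s = chart_at a (?c s)" for s by (simp add: circle_at_chart)
  have cont: "continuous_on (cball 0 r) (\<lambda>u. e * (chart_den b a u / chart_den b' a u))"
    "continuous_on (cball 0 r) (\<lambda>u. e / chart_den b' a u)"
    if "b' \<in> D" "b' \<noteq> a" for e b b'
    using other[OF that] by (auto intro!: continuous_intros continuous_on_chart_den)
  show "(\<exists>l. path l \<and> (\<forall>s\<in>{0..1}. exp (l s) = tau (circle_at a r s)) \<and> l 1 - l 0 = two_pi_i) \<and>
      (\<exists>l. path l \<and> (\<forall>s\<in>{0..1}. exp (l s) = tau (circle_at a r s) - 1) \<and> l 1 - l 0 = 0)" if a: "a = a1"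
  proof
    have a3: "a3 \<in> D" "a3 \<noteq> a" "a2 \<in> D" "a2 \<noteq> a" using distinct a by auto
    have "tau (circle_at a r s) = ?c s * (scal * \<epsilon> / chart_den a3 a (?c s))" for s
      unfolding c tau_chart using self[of "?c s"] a by simp
    moreover have "scal * \<epsilon> / chart_den a3 a u \<noteq> 0" if "u \<in> cball 0 r" for u
      using other[OF a3(1,2) that] nz scal_nonzero by simp
    ultimately show "\<exists>l. path l \<and> (\<forall>s\<in>{0..1}. exp (l s) = tau (circle_at a r s)) \<and> l 1 - l 0 = two_pi_i"
      using circle_log_increment(2)[OF cont(2)[OF a3(1,2)] _ r, of "scal * \<epsilon>"] by simp
    have "tau (circle_at a r s) - 1 = k * (chart_den a2 a (?c s) / chart_den a3 a (?c s))" for s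
      unfolding c k_def using other[OF a3(1,2) im] by (intro tau_chart_minus_1) (simp add: chart_den_eq_0_iff)
    moreover have "k * (chart_den a2 a u / chart_den a3 a u) \<noteq> 0" if "u \<in> cball 0 r" for u
      using other[OF a3(1,2) that] other[OF a3(3,4) that] nz by simp
    ultimately show "\<exists>l. path l \<and> (\<forall>s\<in>{0..1}. exp (l s) = tau (circle_at a r s) - 1) \<and> l 1 - l 0 = 0"
      using circle_log_increment(1)[OF cont(1)[OF a3(1,2)] _ r, of k a2] by simp
  qed
  show "(\<exists>l. path l \<and> (\<forall>s\<in>{0..1}. exp (l s) = tau (circle_at a r s)) \<and> l 1 - l 0 = 0) \<and>
      (\<exists>l. path l \<and> (\<forall>s\<in>{0..1}. exp (l s) = tau (circle_at a r s) - 1) \<and> l 1 - l 0 = two_pi_i)" if a: "a = a2"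
  proof
    have a3: "a3 \<in> D" "a3 \<noteq> a" "a1 \<in> D" "a1 \<noteq> a" using distinct a by auto
    have "tau (circle_at a r s) - 1 = ?c s * (k * \<epsilon> / chart_den a3 a (?c s))" for s
      unfolding c k_def using self[of "?c s"] a other[OF a3(1,2) im[of s]] tau_chart_minus_1[of a "?c s"]
      by (simp add: chart_den_eq_0_iff)
    moreover have "k * \<epsilon> / chart_den a3 a u \<noteq> 0" if "u \<in> cball 0 r" for u
      using other[OF a3(1,2) that] nz by simp
    ultimately show "\<exists>l. path l \<and> (\<forall>s\<in>{0..1}. exp (l s) = tau (circle_at a r s) - 1) \<and> l 1 - l 0 = two_pi_i"
      using circle_log_increment(2)[OF cont(2)[OF a3(1,2)] _ r, of "k * \<epsilon>"] by simp
    have "tau (circle_at a r s) = scal * (chart_den a1 a (?c s) / chart_den a3 a (?c s))" for s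
      unfolding c tau_chart ..
    moreover have "scal * (chart_den a1 a u / chart_den a3 a u) \<noteq> 0" if "u \<in> cball 0 r" for u
      using other[OF a3(1,2) that] other[OF a3(3,4) that] scal_nonzero by simp
    ultimately show "\<exists>l. path l \<and> (\<forall>s\<in>{0..1}. exp (l s) = tau (circle_at a r s)) \<and> l 1 - l 0 = 0"
      using circle_log_increment(1)[OF cont(1)[OF a3(1,2)] _ r, of scal a1] by simp
  qed
qed

lemma deck_around_a1:
  assumes "g \<in> loops (- D) p" "loop_around D p a1 g" "has_deck g d"
  shows "fst d = two_pi_i" "fst (snd d) = 0"
  using loop_around_deck[OF assms circle_tau_logs(1)[OF _ _ refl]] by simp_all

lemma deck_around_a2:
  assumes "g \<in> loops (- D) p" "loop_around D p a2 g" "has_deck g d"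
  shows "fst d = 0" "fst (snd d) = two_pi_i"
  using loop_around_deck[OF assms circle_tau_logs(2)[OF _ _ refl]] by simp_all

text \<open>\<open>sigma\<close> turns a closed path in the t-plane, provided with a tail, into a
  loop on the sphere. In this way properties of all loops at \<open>p\<close> can be tested on two
  explicit circles.\<close>

lemma conj_loop_has_deck:
  assumes q: "path q" "path_image q \<subseteq> - {0, 1}" "pathstart q = tau p" and mq: "gs.lift \<beta>0 \<beta>1 q mq" "mq 0 = base"
    and k: "path k" "path_image k \<subseteq> - {0, 1}" "pathfinish q = pathstart k" "pathfinish k = pathstart k"
    and mk: "gs.lift \<beta>0 \<beta>1 k mk" "mk 0 = mq 1"
  obtains g d where "g \<in> loops (- D) p" "has_deck g d" "mk 1 = deck \<beta>0 \<beta>1 d (mk 0)"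
proof -
  have "mk 0 \<in> fib3 (k 0)" "mk 1 \<in> fib3 (k 0)"
    using gs.lift_fib[OF mk(1), of 0] gs.lift_fib[OF mk(1), of 1] k(4) by (simp_all add: pathstart_def pathfinish_def)
  from deck_exists[OF this] obtain d where d: "is_deck d" "mk 1 = deck \<beta>0 \<beta>1 d (mk 0)" by blast
  let ?w = "q +++ k +++ reversepath q"
  obtain m where m: "gs.lift \<beta>0 \<beta>1 ?w m" "m 0 = mq 0" "m 1 = deck \<beta>0 \<beta>1 d (mq 0)"
    using lift_deck_conj[OF q(1,2) k(1,3,4) mq(1) mk d(2,1)] by blast
  have w: "path ?w" "path_image ?w \<subseteq> - {0, 1}" "pathstart ?w = tau p" "pathfinish ?w = tau p"
    using q k by (auto simp: path_image_join)
  have pa3: "p \<noteq> a3" using p by auto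
  have "sigma \<circ> ?w \<in> loops (- D) p"
  proof -
    have "path (sigma \<circ> ?w)"
      using w(1) by (intro path_continuous_image) (auto intro: continuous_on_subset[OF sigma_continuous])
    moreover have "path_image (sigma \<circ> ?w) \<subseteq> - D"
      using w(2) sigma_in unfolding path_image_compose by (auto simp del: Compl_iff)
    ultimately show ?thesis
      using w(3,4) sigma_tau[OF pa3] by (simp add: loops_def pathstart_compose pathfinish_compose)
  qed
  moreover have "tau \<circ> (sigma \<circ> ?w) = ?w" by (simp add: fun_eq_iff tau_sigma)
  then have "has_deck (sigma \<circ> ?w) d" using m mq(2) d(1) unfolding has_deck_def by auto
  ultimately show thesis using that d(2) by blast
qed

text \<open>If \<open>f - s\<close> is multiplied by a constant along every loop, then so it is along the circles
  about 0 and 1 through 1/2, and \<open>beta_integral_zero_if_circles_multiplicative\<close> applies.\<close>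

lemma beta_integral_zero_if_multiplicative:
  assumes \<beta>: "Re \<beta>0 > 0" "Re \<beta>1 > 0"
    and ne: "exp (two_pi_i * \<beta>0) \<noteq> 1" "exp (two_pi_i * \<beta>1) \<noteq> 1"
    and s: "\<And>g d. \<lbrakk>g \<in> loops (- D) p; has_deck g d\<rbrakk> \<Longrightarrow> snd (snd d) = s * (1 - exp (\<beta>0 * fst d + \<beta>1 * fst (snd d)))"
  shows "((\<lambda>t. of_real t powr \<beta>0 * of_real (1 - t) powr \<beta>1) has_integral 0) {0..1::real}"
proof -
  have "path_connected (- {0, 1 :: complex})"
    by (rule path_connected_complement_countable) auto
  moreover have "tau p \<in> - {0, 1}" "1 / 2 \<in> - {0, 1 :: complex}" using tau_in[OF p] by auto
  ultimately obtain q where q: "path q" "path_image q \<subseteq> - {0, 1}" "pathstart q = tau p" "pathfinish q = 1 / 2"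
    unfolding path_connected_def by blast
  have "base \<in> fib3 (pathstart q)" using base_fib q(3) by simp
  from gs.lift_exists[OF q(1,2) this] obtain mq where mq: "gs.lift \<beta>0 \<beta>1 q mq" "mq 0 = base" by blast
  obtain v0 v1 f where v: "mq 1 = (v0, v1, f)" by (metis prod.exhaust)
  have "q 1 = 1 / 2" using q(4) unfolding pathfinish_def .
  moreover have "mq 1 \<in> fib3 (q 1)" using gs.lift_fib[OF mq(1), of 1] by simp
  ultimately have fib: "mq 1 \<in> fib3 (1 / 2)" by (simp only:)
  \<comment> \<open>A closed path at 1/2 with the tail \<open>q\<close> comes from a loop at
    \<open>p\<close>, so the assumption on \<open>s\<close> makes \<open>f - s\<close>
    multiplicative along it. All lifts start at the same triple \<open>mq 1\<close>.\<close>
  have lift: "\<exists>mk. gs.lift \<beta>0 \<beta>1 k mk \<and> mk 0 = (v0, v1, f) \<and>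
      snd (snd (mk 1)) - s = exp (\<beta>0 * (fst (mk 1) - v0) + \<beta>1 * (fst (snd (mk 1)) - v1)) * (f - s)"
    if k: "path k" "path_image k \<subseteq> - {0, 1}" "pathstart k = 1 / 2" "pathfinish k = 1 / 2" for k
  proof -
    have "mq 1 \<in> fib3 (pathstart k)" using fib unfolding k(3) .
    from gs.lift_exists[OF k(1,2) this] obtain mk where mk: "gs.lift \<beta>0 \<beta>1 k mk" "mk 0 = mq 1" by blast
    have kk: "pathfinish q = pathstart k" "pathfinish k = pathstart k" unfolding q(4) k(3,4) by simp_all
    obtain g d where gd: "g \<in> loops (- D) p" "has_deck g d" "mk 1 = deck \<beta>0 \<beta>1 d (mk 0)"
      by (rule conj_loop_has_deck[OF q(1,2,3) mq k(1,2) kk mk])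
    obtain u0 u1 F where d: "d = (u0, u1, F)" by (metis prod.exhaust)
    have F: "F = s * (1 - exp (\<beta>0 * u0 + \<beta>1 * u1))" using s[OF gd(1,2)] d by simp
    have "mk 1 = (v0 + u0, v1 + u1, exp (\<beta>0 * u0 + \<beta>1 * u1) * f + F)"
      using gd(3) mk(2) v d by simp
    then show ?thesis using mk v F by (intro exI[of _ mk]) (simp add: algebra_simps)
  qed
  have im: "path_image (circlepath 0 (1/2)) \<subseteq> - {0, 1 :: complex}" "path_image (circlepath 1 (- (1/2))) \<subseteq> - {0, 1 :: complex}"
  proof -
    have "exp z / 2 \<noteq> 1" if "Re z = 0" for z :: complex
    proof
      assume "exp z / 2 = 1"
      then have "norm (exp z) = 2" by simp
      then show False using that by simp
    qed
    then show "path_image (circlepath 0 (1/2)) \<subseteq> - {0, 1 :: complex}" "path_image (circlepath 1 (- (1/2))) \<subseteq> - {0, 1 :: complex}"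
      by (auto simp: path_image_def circlepath)
  qed
  have ends: "pathstart (circlepath 0 (1/2)) = 1 / 2" "pathfinish (circlepath 0 (1/2)) = 1 / 2"
    "pathstart (circlepath 1 (- (1/2))) = 1 / 2" "pathfinish (circlepath 1 (- (1/2))) = 1 / 2"
    by (simp_all add: pathstart_def pathfinish_def circlepath)
  obtain m where m: "gs.lift \<beta>0 \<beta>1 (circlepath 0 (1/2)) m" "m 0 = (v0, v1, f)"
    "snd (snd (m 1)) - s = exp (\<beta>0 * (fst (m 1) - v0) + \<beta>1 * (fst (snd (m 1)) - v1)) * (f - s)"
    using lift[OF path_circlepath im(1) ends(1,2)] by blast
  obtain m' where m': "gs.lift \<beta>0 \<beta>1 (circlepath 1 (- (1/2))) m'" "m' 0 = (v0, v1, f)"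
    "snd (snd (m' 1)) - s = exp (\<beta>0 * (fst (m' 1) - v0) + \<beta>1 * (fst (snd (m' 1)) - v1)) * (f - s)"
    using lift[OF path_circlepath im(2) ends(3,4)] by blast
  show ?thesis by (rule beta_integral_zero_if_circles_multiplicative[OF \<beta> ne m m'])
qed

text \<open>Here \<open>f\<close> is log t up to a constant, so its translation is the shift of log
  t.\<close>

lemma log_has_deck:
  assumes "\<beta>0 = - 1" "\<beta>1 = 0" and g: "g \<in> loops (- D) p" and "has_deck g d"
  shows "snd (snd d) = fst d"
proof -
  obtain m where m: "gs.lift \<beta>0 \<beta>1 (tau \<circ> g) m" "m 0 = base" "m 1 = deck \<beta>0 \<beta>1 d base" and d: "is_deck d"
    using assms(4) unfolding has_deck_def by blast
  have "snd (snd (m 1)) - snd (snd (m 0)) = fst (m 1) - fst (m 0)"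
    using lift_log_primitive[of "tau \<circ> g" m] m(1) tau_path(1)[OF loopsD(1,2)[OF g]] assms(1,2) by simp
  then show ?thesis unfolding m(2,3) by (cases d) (simp add: base_def)
qed

end

section \<open>Comparison of triangular representations\<close>

lemma GL_hom_facts:
  assumes G: "group G" and \<rho>: "\<rho> \<in> hom G (GL :: (complex^2^2) monoid)"
  shows "x \<in> carrier G \<Longrightarrow> y \<in> carrier G \<Longrightarrow> \<rho> (x \<otimes>\<^bsub>G\<^esub> y) = \<rho> x ** \<rho> y"
    "\<rho> \<one>\<^bsub>G\<^esub> = mat 1"
    "x \<in> carrier G \<Longrightarrow> \<rho> x ** \<rho> (inv\<^bsub>G\<^esub> x) = mat 1"
    "x \<in> carrier G \<Longrightarrow> \<rho> (inv\<^bsub>G\<^esub> x) ** \<rho> x = mat 1"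
proof -
  interpret group G by fact
  show mult: "\<rho> (x \<otimes>\<^bsub>G\<^esub> y) = \<rho> x ** \<rho> y" if "x \<in> carrier G" "y \<in> carrier G" for x y
    using hom_mult[OF \<rho> that] by (simp add: GL_def)
  have "invertible (\<rho> \<one>\<^bsub>G\<^esub>)" using hom_in_carrier[OF \<rho> one_closed] by (simp add: GL_def)
  then obtain B where B: "B ** \<rho> \<one>\<^bsub>G\<^esub> = mat 1" unfolding invertible_def by blast
  have "\<rho> \<one>\<^bsub>G\<^esub> ** \<rho> \<one>\<^bsub>G\<^esub> = \<rho> \<one>\<^bsub>G\<^esub>" using mult[of "\<one>\<^bsub>G\<^esub>" "\<one>\<^bsub>G\<^esub>"] by simp
  then have "B ** (\<rho> \<one>\<^bsub>G\<^esub> ** \<rho> \<one>\<^bsub>G\<^esub>) = B ** \<rho> \<one>\<^bsub>G\<^esub>" by simp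
  then show one: "\<rho> \<one>\<^bsub>G\<^esub> = mat 1" by (simp add: matrix_mul_assoc B)
  show "\<rho> x ** \<rho> (inv\<^bsub>G\<^esub> x) = mat 1" "\<rho> (inv\<^bsub>G\<^esub> x) ** \<rho> x = mat 1" if "x \<in> carrier G" for x
    using that mult[of x "inv\<^bsub>G\<^esub> x"] mult[of "inv\<^bsub>G\<^esub> x" x] one by simp_all
qed

lemma eigenvector_generate:
  assumes G: "group G" and \<rho>: "\<rho> \<in> hom G (GL :: (complex^2^2) monoid)" and X: "X \<subseteq> carrier G"
    and gen: "\<And>x. x \<in> X \<Longrightarrow> \<exists>k. \<rho> x *v v = k *s v" and y: "y \<in> generate G X"
  shows "\<exists>k. \<rho> y *v v = k *s v"
  using y
proof (induction rule: generate.induct)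
  case one
  then show ?case using GL_hom_facts(2)[OF G \<rho>] by (intro exI[of _ 1]) simp
next
  case (incl h)
  then show ?case using gen by blast
next
  case (inv h)
  then have h: "h \<in> carrier G" using X by blast
  obtain k where k: "\<rho> h *v v = k *s v" using gen inv by blast
  have e: "v = k *s (\<rho> (inv\<^bsub>G\<^esub> h) *v v)"
    using GL_hom_facts(4)[OF G \<rho> h] k
    by (metis matrix_vector_mul_assoc matrix_vector_mul_lid vector_scalar_commute)
  show ?case
  proof (cases "k = 0")
    \<comment> \<open>As \<open>\<rho> h\<close> is invertible, the eigenvalue 0 is possible only
      for \<open>v = 0\<close>.\<close>
    case True
    then have "v = 0" using e by simp
    then show ?thesis by simp
  next
    case False
    then have "\<rho> (inv\<^bsub>G\<^esub> h) *v v = (1 / k) *s (k *s (\<rho> (inv\<^bsub>G\<^esub> h) *v v))" by simp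
    then show ?thesis using e by metis
  qed
next
  case (eng h1 h2)
  then have h: "h1 \<in> carrier G" "h2 \<in> carrier G" using group.generate_in_carrier[OF G X] by blast+
  obtain k1 k2 where "\<rho> h1 *v v = k1 *s v" "\<rho> h2 *v v = k2 *s v" using eng by blast
  then have "(\<rho> h1 ** \<rho> h2) *v v = (k2 * k1) *s v"
    by (simp add: matrix_vector_mul_assoc[symmetric] vector_scalar_commute)
  then show ?case using GL_hom_facts(1)[OF G \<rho> h] by metis
qed

lemma intertwine_generate:
  assumes G: "group G" and \<rho>: "\<rho> \<in> hom G (GL :: (complex^2^2) monoid)" and \<tau>: "\<tau> \<in> hom G (GL :: (complex^2^2) monoid)"
    and X: "X \<subseteq> carrier G" and gen: "\<And>x. x \<in> X \<Longrightarrow> R ** \<rho> x = \<tau> x ** R" and y: "y \<in> generate G X"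
  shows "R ** \<rho> y = \<tau> y ** R"
  using y
proof (induction rule: generate.induct)
  case one
  then show ?case using GL_hom_facts(2)[OF G \<rho>] GL_hom_facts(2)[OF G \<tau>] by simp
next
  case (incl h)
  then show ?case using gen by blast
next
  case (inv h)
  then have h: "h \<in> carrier G" and e: "R ** \<rho> h = \<tau> h ** R" using X gen by blast+
  have "\<tau> (inv\<^bsub>G\<^esub> h) ** (\<tau> h ** R) ** \<rho> (inv\<^bsub>G\<^esub> h) = R ** \<rho> (inv\<^bsub>G\<^esub> h)"
    by (simp add: matrix_mul_assoc GL_hom_facts(4)[OF G \<tau> h])
  moreover have "\<tau> (inv\<^bsub>G\<^esub> h) ** (R ** \<rho> h) ** \<rho> (inv\<^bsub>G\<^esub> h) = \<tau> (inv\<^bsub>G\<^esub> h) ** R"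
    by (simp add: matrix_mul_assoc[symmetric] GL_hom_facts(3)[OF G \<rho> h])
  ultimately show ?case using e by simp
next
  case (eng h1 h2)
  then have h: "h1 \<in> carrier G" "h2 \<in> carrier G" using group.generate_in_carrier[OF G X] by blast+
  have "R ** (\<rho> h1 ** \<rho> h2) = \<tau> h1 ** R ** \<rho> h2" by (simp add: matrix_mul_assoc eng)
  also have "\<dots> = \<tau> h1 ** \<tau> h2 ** R" using eng by (simp add: matrix_mul_assoc[symmetric])
  finally show ?case using GL_hom_facts(1)[OF G \<rho> h] GL_hom_facts(1)[OF G \<tau> h] by simp
qed

lemma matrix_inv_cancel:
  fixes S :: "complex^2^2"
  assumes "invertible S"
  shows "S ** matrix_inv S = mat 1" "matrix_inv S ** S = mat 1"
  using assms someI_ex[of "\<lambda>A'. S ** A' = mat 1 \<and> A' ** S = mat 1"]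
  unfolding invertible_def matrix_inv_def by auto

abbreviation ent :: "complex^2^2 \<Rightarrow> 2 \<Rightarrow> 2 \<Rightarrow> complex" where
  "ent A i j \<equiv> A $ i $ j"

text \<open>The relation with \<open>s\<close> makes (- s, 1) an eigenvector of each triangular
  matrix, with eigenvalue its second diagonal entry, beside (1, 0). The images of both vectors under
  \<open>S\<close> span complementary invariant lines.\<close>

lemma not_common_eigenbasis:
  assumes G: "group G" and \<rho>: "\<rho> \<in> hom G (GL :: (complex^2^2) monoid)" and X: "X \<subseteq> carrier G" "generate G X = carrier G"
    and ind: "indecomposable G \<rho>" and S: "invertible S"
    and ut: "\<And>x. x \<in> X \<Longrightarrow> upper_triangular (matrix_inv S ** \<rho> x ** S)"
    and s: "\<And>x. x \<in> X \<Longrightarrow> ent (matrix_inv S ** \<rho> x ** S) 1 2 =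
      s * (ent (matrix_inv S ** \<rho> x ** S) 1 1 - ent (matrix_inv S ** \<rho> x ** S) 2 2)"
  shows False
proof -
  define e w :: "complex^2" where "e = (\<chi> j. if j = 1 then 1 else 0)" and "w = (\<chi> j. if j = 1 then - s else 1)"
  note SS = matrix_inv_cancel[OF S]
  have ew: "\<exists>k. \<rho> x *v (S *v v) = k *s (S *v v)" if x: "x \<in> X" and v: "v = e \<or> v = w" for x v
  proof -
    let ?H = "matrix_inv S ** \<rho> x ** S"
    have "\<exists>k. ?H *v v = k *s v"
    proof (cases "v = e")
      case True
      then show ?thesis using ut[OF x]
        by (intro exI[of _ "ent ?H 1 1"])
           (simp add: vec_eq_iff forall_2 e_def matrix_vector_mult_def[of ?H] sum_2 upper_triangular_def)
    next
      case False
      then have "v = w" using v by blast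
      then show ?thesis using ut[OF x] s[OF x]
        by (intro exI[of _ "ent ?H 2 2"])
           (simp add: vec_eq_iff forall_2 w_def matrix_vector_mult_def[of ?H] sum_2 upper_triangular_def algebra_simps)
    qed
    then obtain k where k: "?H *v v = k *s v" by blast
    have "S *v (?H *v v) = (S ** matrix_inv S) *v (\<rho> x *v (S *v v))"
      by (simp only: matrix_vector_mul_assoc matrix_mul_assoc)
    then have "\<rho> x *v (S *v v) = S *v (?H *v v)" by (simp add: SS)
    also have "\<dots> = k *s (S *v v)" unfolding k by (simp add: vector_scalar_commute)
    finally show ?thesis by blast
  qed
  have inv: "invariant_subspace G \<rho> (vec.span {S *v v})" if v: "v = e \<or> v = w" for v
    unfolding invariant_subspace_def
  proof (intro conjI ballI)
    show "vec.subspace (vec.span {S *v v})" by (rule vec.subspace_span)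
    fix g y assume g: "g \<in> carrier G" and y: "y \<in> vec.span {S *v v}"
    then obtain c where c: "y = c *s (S *v v)" by (auto simp: vec.span_singleton)
    obtain k where "\<rho> g *v (S *v v) = k *s (S *v v)"
      using eigenvector_generate[OF G \<rho> X(1), of "S *v v" g] ew v g X(2) by blast
    then have "\<rho> g *v y = (c * k) *s (S *v v)" unfolding c by (simp add: vector_scalar_commute)
    then show "\<rho> g *v y \<in> vec.span {S *v v}" by (auto simp: vec.span_singleton)
  qed
  have nz: "S *v v \<noteq> 0" if "v \<noteq> 0" for v
    using that SS(2) by (metis matrix_vector_mul_assoc matrix_vector_mul_lid matrix_vector_mult_0_right)
  have vne: "e \<noteq> 0" "w \<noteq> 0" by (simp_all add: e_def w_def vec_eq_iff forall_2)
  have dim: "vec.dim (vec.span {S *v e}) = 1" "vec.dim (vec.span {S *v w}) = 1"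
    using nz vne by (simp_all add: vec.dim_span)
  have "vec.span {S *v e} \<inter> vec.span {S *v w} = {0}"
  proof -
    have zero: "a = 0" if eq: "a *s (S *v e) = b *s (S *v w)" for a b
    proof -
      have "S *v (a *s e) = S *v (b *s w)" using eq by (simp add: vector_scalar_commute)
      then have "matrix_inv S *v (S *v (a *s e)) = matrix_inv S *v (S *v (b *s w))" by simp
      then have "a *s e = b *s w" by (simp add: matrix_vector_mul_assoc SS)
      then show "a = 0" by (simp add: vec_eq_iff forall_2 e_def w_def)
    qed
    have "x = 0" if x: "x \<in> vec.span {S *v e}" "x \<in> vec.span {S *v w}" for x
    proof -
      obtain a b where ab: "x = a *s (S *v e)" "x = b *s (S *v w)"
        using x unfolding vec.span_singleton by blast
      then have "a = 0" by (intro zero[of a b]) simp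
      then show ?thesis using ab(1) by simp
    qed
    then show ?thesis using vec.span_zero by blast
  qed
  moreover have "{v + v' | v v'. v \<in> vec.span {S *v e} \<and> v' \<in> vec.span {S *v w}} = UNIV"
  proof -
    have "\<exists>a b. x = a *s (S *v e) + b *s (S *v w)" for x
    proof -
      define y where "y = matrix_inv S *v x"
      have "y = (y $ 1 + s * y $ 2) *s e + (y $ 2) *s w"
        by (simp add: vec_eq_iff forall_2 e_def w_def)
      moreover have "x = S *v y" by (simp add: y_def matrix_vector_mul_assoc SS)
      ultimately have "x = (y $ 1 + s * y $ 2) *s (S *v e) + (y $ 2) *s (S *v w)"
        by (metis matrix_vector_right_distrib vector_scalar_commute)
      then show ?thesis by blast
    qed
    then show ?thesis unfolding vec.span_singleton by blast
  qed
  ultimately show False using ind inv dim unfolding indecomposable_def by blast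
qed

text \<open>A logarithm divided by 2 pi i, moved to the right by an integer until its real part is
  positive, as the beta integral requires.\<close>

lemma exp_2pi_surj:
  assumes "z \<noteq> 0"
  obtains b where "Re b > 0" "exp (two_pi_i * b) = z"
proof -
  define b where "b = Ln z / (two_pi_i)"
  obtain n :: nat where n: "- Re b < real n" using reals_Archimedean2 by blast
  have "exp (two_pi_i * (b + of_nat n)) = exp (Ln z) * exp (two_pi_i * of_nat n)"
    by (simp add: b_def ring_distribs exp_add)
  also have "exp (two_pi_i * of_nat n) = (exp (two_pi_i)) ^ n"
    by (simp add: exp_of_nat_mult[symmetric] mult_ac)
  finally show thesis using that[of "b + of_nat n"] n assms by simp
qed


section \<open>Matching \<open>chi\<close> with a given pair of triangular matrices\<close>

context monodromy_data
begin

lemma chi_around_a1: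
  assumes "g \<in> loops (- D) p" "loop_around D p a1 g"
  shows "ent (chi (cls g)) 1 1 = 1 / exp (two_pi_i * \<alpha>0)"
    "ent (chi (cls g)) 2 1 = 0"
    "ent (chi (cls g)) 2 2 = 1 / (exp (two_pi_i * \<alpha>0) * exp (two_pi_i * \<beta>0))"
proof -
  obtain d where d: "has_deck g d" using has_deck_exists assms(1) by blast
  note dd = deck_around_a1[OF assms d]
  show "ent (chi (cls g)) 1 1 = 1 / exp (two_pi_i * \<alpha>0)"
    "ent (chi (cls g)) 2 1 = 0"
    "ent (chi (cls g)) 2 2 = 1 / (exp (two_pi_i * \<alpha>0) * exp (two_pi_i * \<beta>0))"
    unfolding chi_loop_class[OF assms(1) d] gmat_entries dd by (simp_all add: mult.commute)
qed

lemma chi_around_a2: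
  assumes "g \<in> loops (- D) p" "loop_around D p a2 g"
  shows "ent (chi (cls g)) 1 1 = 1 / exp (two_pi_i * \<alpha>1)"
    "ent (chi (cls g)) 2 1 = 0"
    "ent (chi (cls g)) 2 2 = 1 / (exp (two_pi_i * \<alpha>1) * exp (two_pi_i * \<beta>1))"
proof -
  obtain d where d: "has_deck g d" using has_deck_exists assms(1) by blast
  note dd = deck_around_a2[OF assms d]
  show "ent (chi (cls g)) 1 1 = 1 / exp (two_pi_i * \<alpha>1)"
    "ent (chi (cls g)) 2 1 = 0"
    "ent (chi (cls g)) 2 2 = 1 / (exp (two_pi_i * \<alpha>1) * exp (two_pi_i * \<beta>1))"
    unfolding chi_loop_class[OF assms(1) d] gmat_entries dd by (simp_all add: mult.commute)
qed

lemma group_pi: "group pi1"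
  by (rule group_fundamental_group) (use p in simp)

lemma loop_class_carrier: "g \<in> loops (- D) p \<Longrightarrow> cls g \<in> carrier pi1"
  by (simp add: fundamental_group_def)

text \<open>If equality held, (- s, 1) would be an eigenvector of both generators and hence of all
  matrices \<open>chi\<close>. The first row of the eigenvector equation then reads F = s (1 - B),
  so every loop multiplies \<open>f - s\<close> by B, and
  \<open>beta_integral_zero_if_multiplicative\<close> contradicts the choice of exponents.\<close>

lemma chi_offdiagonal_independent:
  assumes \<beta>: "Re \<beta>0 > 0" "Re \<beta>1 > 0"
    and ne: "exp (two_pi_i * \<beta>0) \<noteq> 1" "exp (two_pi_i * \<beta>1) \<noteq> 1"
    and I: "\<not> ((\<lambda>t. of_real t powr \<beta>0 * of_real (1 - t) powr \<beta>1) has_integral 0) {0..1::real}"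
    and g1: "g1 \<in> loops (- D) p" "loop_around D p a1 g1" and g2: "g2 \<in> loops (- D) p" "loop_around D p a2 g2"
    and gen: "generate pi1 {cls g1, cls g2} = carrier pi1"
  defines "G1 \<equiv> chi (cls g1)" and "G2 \<equiv> chi (cls g2)"
  shows "ent G1 1 2 * (ent G2 1 1 - ent G2 2 2) \<noteq> ent G2 1 2 * (ent G1 1 1 - ent G1 2 2)"
proof
  define \<delta>1 \<delta>2 where "\<delta>1 = ent G1 1 1 - ent G1 2 2" and "\<delta>2 = ent G2 1 1 - ent G2 2 2"
  assume "ent G1 1 2 * (ent G2 1 1 - ent G2 2 2) = ent G2 1 2 * (ent G1 1 1 - ent G1 2 2)"
  then have eq: "ent G1 1 2 * \<delta>2 = ent G2 1 2 * \<delta>1" by (simp add: \<delta>1_def \<delta>2_def)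
  have \<delta>: "\<delta>1 \<noteq> 0" "\<delta>2 \<noteq> 0"
    using ne unfolding \<delta>1_def \<delta>2_def G1_def G2_def chi_around_a1[OF g1] chi_around_a2[OF g2] by (auto simp: field_simps)
  define s where "s = ent G1 1 2 / \<delta>1"
  have x: "ent G1 1 2 = s * (ent G1 1 1 - ent G1 2 2)" "ent G2 1 2 = s * (ent G2 1 1 - ent G2 2 2)"
    using \<delta> eq unfolding \<delta>1_def[symmetric] \<delta>2_def[symmetric] s_def by (simp_all add: field_simps)
  define v :: "complex^2" where "v = (\<chi> j. if j = 1 then - s else 1)"
  have ut: "ent G1 2 1 = 0" "ent G2 2 1 = 0"
    unfolding G1_def G2_def chi_around_a1[OF g1] chi_around_a2[OF g2] by simp_all
  have ev: "G *v v = (ent G 2 2) *s v" if "ent G 2 1 = 0" "ent G 1 2 = s * (ent G 1 1 - ent G 2 2)" for G :: "complex^2^2"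
    using that by (simp add: vec_eq_iff forall_2 matrix_vector_mult_def[of G] sum_2 v_def algebra_simps)
  have eig: "\<exists>k. chi x *v v = k *s v" if "x \<in> carrier pi1" for x
  proof (rule eigenvector_generate[OF group_pi chi_hom])
    show "{cls g1, cls g2} \<subseteq> carrier pi1"
      using loop_class_carrier g1 g2 by simp
    show "x \<in> generate pi1 {cls g1, cls g2}"
      using that gen by simp
    fix y assume "y \<in> {cls g1, cls g2}"
    then show "\<exists>k. chi y *v v = k *s v"
      using ev[OF ut(1) x(1)] ev[OF ut(2) x(2)] unfolding G1_def G2_def by blast
  qed
  have "snd (snd d) = s * (1 - exp (\<beta>0 * fst d + \<beta>1 * fst (snd d)))" if g: "g \<in> loops (- D) p" and d: "has_deck g d" for g d
  proof -
    define A B where "A = exp (\<alpha>0 * fst d + \<alpha>1 * fst (snd d))" and "B = exp (\<beta>0 * fst d + \<beta>1 * fst (snd d))"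
    have nz: "A \<noteq> 0" "B \<noteq> 0" by (simp_all add: A_def B_def)
    obtain k where "gmat d *v v = k *s v" using eig[OF loop_class_carrier[OF g]] chi_loop_class[OF g d] by auto
    then have "(gmat d *v v) $ 1 = k * v $ 1" "(gmat d *v v) $ 2 = k * v $ 2" by simp_all
    then have "1 / (A * B) = k" "- (snd (snd d) / (A * B)) - s / A = - (k * s)"
      by (simp_all add: matrix_vector_mult_def sum_2 gmat_entries v_def A_def B_def)
    then have E: "- (snd (snd d) / (A * B)) - s / A = - (1 / (A * B) * s)" by simp
    have "snd (snd d) + B * s = - (A * B) * (- (snd (snd d) / (A * B)) - s / A)"
      using nz by (simp add: right_diff_distrib)
    also have "\<dots> = s" unfolding E using nz by simp
    finally show ?thesis unfolding B_def[symmetric] by (simp add: algebra_simps)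
  qed
  then show False using beta_integral_zero_if_multiplicative[OF \<beta> ne] I by blast
qed

text \<open>The assumption is \<open>Q ** H = chi x ** Q\<close> written out in entries. So
  \<open>Q ** matrix_inv S\<close> intertwines \<open>\<rho>\<close> with \<open>chi\<close> on the
  generators, hence on the whole group.\<close>

lemma realizes_triangular:
  assumes g1: "g1 \<in> loops (- D) p" and g2: "g2 \<in> loops (- D) p"
    and gen: "generate pi1 {cls g1, cls g2} = carrier pi1"
    and \<rho>: "\<rho> \<in> hom pi1 GL" and S: "invertible S" and k: "k \<noteq> 0"
    and eq: "\<And>x H G. \<lbrakk>x \<in> {cls g1, cls g2}; H = matrix_inv S ** \<rho> x ** S; G = chi x\<rbrakk> \<Longrightarrow>
      ent H 2 1 = 0 \<and> ent G 2 1 = 0 \<and> ent H 1 1 = ent G 1 1 \<and> ent H 2 2 = ent G 2 2 \<and>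
      ent H 1 2 = k * ent G 1 2 + s * (ent G 1 1 - ent G 2 2)"
  shows "realizes D p cb1 cb2 \<rho>"
proof -
  define Q :: "complex^2^2" where
    "Q = (\<chi> i j. if i = 1 then (if j = 1 then 1 else s) else (if j = 1 then 0 else k))"
  define R where "R = Q ** matrix_inv S"
  note SS = matrix_inv_cancel[OF S]
  have "invertible Q" using k by (simp add: invertible_det_nz det_2 Q_def)
  moreover have "invertible (matrix_inv S)" using SS unfolding invertible_def by blast
  ultimately have "invertible R" unfolding R_def by (rule invertible_mult)
  then obtain R' where R': "R ** R' = mat 1" "R' ** R = mat 1" unfolding invertible_def by blast
  have gens: "R ** \<rho> x = chi x ** R" if x: "x \<in> {cls g1, cls g2}" for x
  proof -
    define H G where "H = matrix_inv S ** \<rho> x ** S" and "G = chi x"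
    have "Q ** H = G ** Q"
      using eq[OF x H_def G_def]
      by (simp add: vec_eq_iff forall_2 matrix_matrix_mult_def sum_2 Q_def algebra_simps)
    moreover have "H ** matrix_inv S = matrix_inv S ** \<rho> x"
      unfolding H_def by (simp add: matrix_mul_assoc[symmetric] SS)
    ultimately show ?thesis
      unfolding R_def G_def[symmetric] by (metis matrix_mul_assoc)
  qed
  have "\<rho> (cls g) = R' ** chi (cls g) ** R" if g: "g \<in> loops (- D) p" for g
  proof -
    have "R ** \<rho> (cls g) = chi (cls g) ** R"
    proof (rule intertwine_generate[OF group_pi \<rho> chi_hom _ gens])
      show "{cls g1, cls g2} \<subseteq> carrier pi1"
        using loop_class_carrier g1 g2 by simp
      show "cls g \<in> generate pi1 {cls g1, cls g2}"
        using loop_class_carrier[OF g] gen by simp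
    qed
    then have "R' ** (R ** \<rho> (cls g)) = R' ** (chi (cls g) ** R)" by simp
    then show ?thesis by (simp add: matrix_mul_assoc R')
  qed
  then show ?thesis using realizes_conjugate[OF R'] by blast
qed

end


text \<open>With x1, x2 the off-diagonal entries of \<open>chi\<close>, numbers k and s are sought
  with z = k x + s (l - m) at both points and k nonzero. For distinct eigenvalues this is a linear
  system: its determinant is nonzero by the beta integral, and k is nonzero by
  indecomposability.\<close>

lemma two_generators_realized:
  fixes a1 a2 a3 p :: cp1 and S :: "complex^2^2" and g1 g2 :: "real \<Rightarrow> cp1"
    and \<rho> :: "(real \<Rightarrow> cp1) set \<Rightarrow> complex^2^2"
  defines "D \<equiv> {a1, a2, a3}"
  defines "G \<equiv> fundamental_group (- D) p" and "c1 \<equiv> loop_class (- D) g1" and "c2 \<equiv> loop_class (- D) g2"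
  defines "H1 \<equiv> matrix_inv S ** \<rho> c1 ** S" and "H2 \<equiv> matrix_inv S ** \<rho> c2 ** S"
  assumes a: "a1 \<noteq> a2" "a2 \<noteq> a3" "a1 \<noteq> a3" and p: "p \<notin> D"
    and g1: "g1 \<in> loops (- D) p" "loop_around D p a1 g1" and g2: "g2 \<in> loops (- D) p" "loop_around D p a2 g2"
    and gen: "generate G {c1, c2} = carrier G"
    and \<rho>: "\<rho> \<in> hom G GL" and ind: "indecomposable G \<rho>" and S: "invertible S"
    and ut: "upper_triangular H1" "upper_triangular H2"
    and cases: "ent H1 1 1 \<noteq> ent H1 2 2 \<and> ent H2 1 1 \<noteq> ent H2 2 2 \<or>
      ent H1 1 1 = ent H1 2 2 \<and> ent H2 1 1 = ent H2 2 2 \<and> ent H2 1 2 = 0"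
  shows "\<exists>b1 b2. riemann_equation D b1 b2 \<and> realizes D p b1 b2 \<rho>"
proof -
  define l1 m1 z1 l2 m2 z2 where "l1 = ent H1 1 1" and "m1 = ent H1 2 2" and "z1 = ent H1 1 2"
    and "l2 = ent H2 1 1" and "m2 = ent H2 2 2" and "z2 = ent H2 1 2"
  note SS = matrix_inv_cancel[OF S]
  have G: "group G" unfolding G_def by (rule group_fundamental_group) (use p in simp)
  have carr: "c1 \<in> carrier G" "c2 \<in> carrier G"
    unfolding G_def c1_def c2_def using g1(1) g2(1) by (simp_all add: fundamental_group_def)
  have inv: "invertible (matrix_inv S ** \<rho> c ** S)" if "c \<in> carrier G" for c
  proof -
    have "invertible (\<rho> c)" using hom_in_carrier[OF \<rho> that] by (simp add: GL_def)
    moreover have "invertible (matrix_inv S)" using SS unfolding invertible_def by blast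
    ultimately show ?thesis using S by (intro invertible_mult)
  qed
  have h21: "ent H1 2 1 = 0" "ent H2 2 1 = 0" using ut by (simp_all add: upper_triangular_def)
  have nz: "l1 \<noteq> 0" "m1 \<noteq> 0" "l2 \<noteq> 0" "m2 \<noteq> 0"
    using inv[OF carr(1)] inv[OF carr(2)] h21
    unfolding H1_def[symmetric] H2_def[symmetric] invertible_det_nz det_2 l1_def m1_def l2_def m2_def by auto
  \<comment> \<open>Inverses, because \<open>chi_around_a1\<close> and \<open>chi_around_a2\<close>
    have the exponentials in the denominator.\<close>
  obtain \<alpha>0 where \<alpha>0: "exp (two_pi_i * \<alpha>0) = 1 / l1"
    using exp_2pi_surj[of "1 / l1"] nz by auto
  obtain \<alpha>1 where \<alpha>1: "exp (two_pi_i * \<alpha>1) = 1 / l2"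
    using exp_2pi_surj[of "1 / l2"] nz by auto
  have ind': "\<not> (z1 = s * (l1 - m1) \<and> z2 = s * (l2 - m2))" for s
  proof
    assume "z1 = s * (l1 - m1) \<and> z2 = s * (l2 - m2)"
    then show False
      using not_common_eigenbasis[OF G \<rho> _ gen ind S, of s] carr ut
      unfolding H1_def[symmetric] H2_def[symmetric] l1_def m1_def z1_def l2_def m2_def z2_def
      by (auto simp: H1_def H2_def)
  qed
  \<comment> \<open>The end of both cases. The locale constants appear with explicit parameters,
    because the exponents \<open>\<beta>0\<close> and \<open>\<beta>1\<close> are chosen differently
    in the two cases.\<close>
  have finish: "realizes D p (riemann_data.cb1 a1 a2 a3 \<alpha>0 \<alpha>1 \<beta>0 \<beta>1) (riemann_data.cb2 a1 a2 a3 \<alpha>0 \<alpha>1 \<beta>0 \<beta>1) \<rho>"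
    if b: "exp (two_pi_i * \<beta>0) = l1 / m1" "exp (two_pi_i * \<beta>1) = l2 / m2" and k: "k \<noteq> 0"
      and x: "z1 = k * ent (monodromy_data.chi a1 a2 a3 \<alpha>0 \<alpha>1 \<beta>0 \<beta>1 p c1) 1 2 + s * (l1 - m1)"
        "z2 = k * ent (monodromy_data.chi a1 a2 a3 \<alpha>0 \<alpha>1 \<beta>0 \<beta>1 p c2) 1 2 + s * (l2 - m2)" for \<beta>0 \<beta>1 k s
  proof -
    interpret M: monodromy_data a1 a2 a3 \<alpha>0 \<alpha>1 \<beta>0 \<beta>1 p
      using a p by unfold_locales (auto simp: D_def)
    note e1 = M.chi_around_a1[OF g1[unfolded D_def]] and e2 = M.chi_around_a2[OF g2[unfolded D_def]]
    have e: "ent (M.chi c1) 1 1 = l1" "ent (M.chi c1) 2 2 = m1" "ent (M.chi c1) 2 1 = 0"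
      "ent (M.chi c2) 1 1 = l2" "ent (M.chi c2) 2 2 = m2" "ent (M.chi c2) 2 1 = 0"
      unfolding c1_def c2_def D_def e1 e2 \<alpha>0 \<alpha>1 b using nz by simp_all
    show ?thesis
      unfolding D_def
    proof (rule M.realizes_triangular[OF g1(1)[unfolded D_def] g2(1)[unfolded D_def] _ _ S k, where s = s])
      show "generate (fundamental_group (- {a1, a2, a3}) p) {loop_class (- {a1, a2, a3}) g1, loop_class (- {a1, a2, a3}) g2} =
          carrier (fundamental_group (- {a1, a2, a3}) p)"
        using gen unfolding G_def c1_def c2_def D_def .
      show "\<rho> \<in> hom (fundamental_group (- {a1, a2, a3}) p) GL" using \<rho> unfolding G_def D_def .
      fix c H C
      assume c: "c \<in> {loop_class (- {a1, a2, a3}) g1, loop_class (- {a1, a2, a3}) g2}"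
        and H: "H = matrix_inv S ** \<rho> c ** S" and C: "C = M.chi c"
      then consider "H = H1" "C = M.chi c1" | "H = H2" "C = M.chi c2"
        unfolding H1_def H2_def c1_def c2_def D_def by blast
      then show "ent H 2 1 = 0 \<and> ent C 2 1 = 0 \<and> ent H 1 1 = ent C 1 1 \<and> ent H 2 2 = ent C 2 2 \<and>
          ent H 1 2 = k * ent C 1 2 + s * (ent C 1 1 - ent C 2 2)"
      proof cases
        case 1
        then show ?thesis using e h21 x(1) by (simp add: l1_def m1_def z1_def)
      next
        case 2
        then show ?thesis using e h21 x(2) by (simp add: l2_def m2_def z2_def)
      qed
    qed
  qed
  have "\<exists>\<beta>0 \<beta>1 k s. exp (two_pi_i * \<beta>0) = l1 / m1 \<and> exp (two_pi_i * \<beta>1) = l2 / m2 \<and> k \<noteq> 0 \<and>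
      z1 = k * ent (monodromy_data.chi a1 a2 a3 \<alpha>0 \<alpha>1 \<beta>0 \<beta>1 p c1) 1 2 + s * (l1 - m1) \<and>
      z2 = k * ent (monodromy_data.chi a1 a2 a3 \<alpha>0 \<alpha>1 \<beta>0 \<beta>1 p c2) 1 2 + s * (l2 - m2)"
    using cases unfolding l1_def[symmetric] m1_def[symmetric] l2_def[symmetric] m2_def[symmetric] z2_def[symmetric]
  proof (elim disjE conjE)
    assume ne: "l1 \<noteq> m1" "l2 \<noteq> m2"
    have "l1 / m1 \<noteq> 0" "l2 / m2 \<noteq> 0" using nz by simp_all
    obtain b where b: "Re b > 0" "exp (two_pi_i * b) = l1 / m1"
      using exp_2pi_surj[OF \<open>l1 / m1 \<noteq> 0\<close>] by blast
    obtain \<beta>1 where b1: "Re \<beta>1 > 0" "exp (two_pi_i * \<beta>1) = l2 / m2"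
      using exp_2pi_surj[OF \<open>l2 / m2 \<noteq> 0\<close>] by blast
    obtain n :: nat where n: "\<not> ((\<lambda>t. of_real t powr (b + of_nat n) * of_real (1 - t) powr \<beta>1) has_integral 0) {0..1::real}"
      using beta_integral_shift_nonzero[OF b(1) b1(1)] by blast
    \<comment> \<open>The shift by \<open>n\<close> makes the beta integral nonzero and leaves
      \<open>exp (two_pi_i * \<beta>0)\<close>, and with it the diagonal, unchanged.\<close>
    define \<beta>0 where "\<beta>0 = b + of_nat n"
    have "exp (two_pi_i * \<beta>0) = exp (two_pi_i * b) * exp (two_pi_i) ^ n"
      by (simp add: \<beta>0_def ring_distribs exp_add exp_of_nat_mult[symmetric] mult_ac)
    then have b0: "exp (two_pi_i * \<beta>0) = l1 / m1" "Re \<beta>0 > 0"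
      using b by (simp_all add: \<beta>0_def)
    have ne1: "exp (two_pi_i * \<beta>0) \<noteq> 1" "exp (two_pi_i * \<beta>1) \<noteq> 1"
      unfolding b0 b1 using ne nz by simp_all
    interpret M: monodromy_data a1 a2 a3 \<alpha>0 \<alpha>1 \<beta>0 \<beta>1 p
      using a p by unfold_locales (auto simp: D_def)
    note e1 = M.chi_around_a1[OF g1[unfolded D_def]] and e2 = M.chi_around_a2[OF g2[unfolded D_def]]
    have e: "ent (M.chi c1) 1 1 = l1" "ent (M.chi c1) 2 2 = m1" "ent (M.chi c2) 1 1 = l2" "ent (M.chi c2) 2 2 = m2"
      unfolding c1_def c2_def D_def e1 e2 \<alpha>0 \<alpha>1 b0 b1 using nz by simp_all
    define x1 x2 where "x1 = ent (M.chi c1) 1 2" and "x2 = ent (M.chi c2) 1 2"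
    have X: "x1 * (l2 - m2) - x2 * (l1 - m1) \<noteq> 0"
      using M.chi_offdiagonal_independent[OF b0(2) b1(1) ne1 n[folded \<beta>0_def] g1[unfolded D_def] g2[unfolded D_def]
          gen[unfolded G_def c1_def c2_def D_def]] e
      unfolding x1_def x2_def c1_def c2_def D_def by simp
    \<comment> \<open>Otherwise \<open>s = z1 / (l1 - m1)\<close> would satisfy both relations,
      contrary to \<open>ind'\<close>.\<close>
    have Z: "z1 * (l2 - m2) - z2 * (l1 - m1) \<noteq> 0"
      using ind'[of "z1 / (l1 - m1)"] ne by (auto simp: field_simps)
    \<comment> \<open>Cramer's rule for k; s is then determined by the equation at the first
      point.\<close>
    define k s where "k = (z1 * (l2 - m2) - z2 * (l1 - m1)) / (x1 * (l2 - m2) - x2 * (l1 - m1))"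
      and "s = (z1 - k * x1) / (l1 - m1)"
    have k0: "k \<noteq> 0" using X Z by (simp add: k_def)
    have d1: "l1 - m1 \<noteq> 0" using ne by simp
    have s1: "z1 = k * x1 + s * (l1 - m1)" using d1 by (simp add: s_def)
    have "k * (x1 * (l2 - m2) - x2 * (l1 - m1)) = z1 * (l2 - m2) - z2 * (l1 - m1)" using X by (simp add: k_def)
    then have "(z1 - k * x1) * (l2 - m2) = (z2 - k * x2) * (l1 - m1)" by (simp add: algebra_simps)
    then have s2: "z2 = k * x2 + s * (l2 - m2)" using d1 by (simp add: s_def field_simps)
    show ?thesis using b0 b1 k0 s1 s2 unfolding x1_def x2_def by blast
  next
    assume eq: "l1 = m1" "l2 = m2" "z2 = 0"
    \<comment> \<open>With exponents -1 and 0, f is a branch of log t: its translation is 2 pi i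
      around \<open>a1\<close> and 0 around \<open>a2\<close>. So s = 0 and k = z1 / x1 solve both
      equations, and z1 is nonzero by indecomposability.\<close>
    interpret M: monodromy_data a1 a2 a3 \<alpha>0 \<alpha>1 "- 1" 0 p
      using a p by unfold_locales (auto simp: D_def)
    obtain d1 where d1: "M.has_deck g1 d1" using M.has_deck_exists g1(1) unfolding D_def by blast
    obtain d2 where d2: "M.has_deck g2 d2" using M.has_deck_exists g2(1) unfolding D_def by blast
    have c: "M.chi c1 = M.gmat d1" "M.chi c2 = M.gmat d2"
      unfolding c1_def c2_def D_def
      using M.chi_loop_class[OF g1(1)[unfolded D_def] d1] M.chi_loop_class[OF g2(1)[unfolded D_def] d2] by simp_all
    have F: "snd (snd d1) = two_pi_i" "snd (snd d2) = 0"
      using M.log_has_deck[OF refl refl g1(1)[unfolded D_def] d1] M.deck_around_a1[OF g1[unfolded D_def] d1]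
        M.log_has_deck[OF refl refl g2(1)[unfolded D_def] d2] M.deck_around_a2[OF g2[unfolded D_def] d2] by simp_all
    define x1 where "x1 = ent (M.chi c1) 1 2"
    have x1: "x1 \<noteq> 0" "ent (M.chi c2) 1 2 = 0" unfolding x1_def c M.gmat_entries F by simp_all
    have "z1 \<noteq> 0" using ind'[of 0] eq by simp
    then have "z1 / x1 \<noteq> 0" "z1 = z1 / x1 * x1 + 0 * (l1 - m1)" using x1 by simp_all
    moreover have "exp (two_pi_i * - 1) = l1 / m1" "exp (two_pi_i * 0) = l2 / m2"
      using eq nz by (simp_all add: exp_minus)
    ultimately show ?thesis
      using eq x1(2) unfolding x1_def
      by (intro exI[of _ "- 1"] exI[of _ "0::complex"] exI[of _ "z1 / ent (M.chi c1) 1 2"]) simp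
  qed
  then obtain \<beta>0 \<beta>1 where "realizes D p (riemann_data.cb1 a1 a2 a3 \<alpha>0 \<alpha>1 \<beta>0 \<beta>1) (riemann_data.cb2 a1 a2 a3 \<alpha>0 \<alpha>1 \<beta>0 \<beta>1) \<rho>"
    using finish by blast
  moreover interpret R: riemann_data a1 a2 a3 \<alpha>0 \<alpha>1 \<beta>0 \<beta>1 using a by unfold_locales
  have "riemann_equation D R.cb1 R.cb2" unfolding D_def by (rule R.riemann_equation_D)
  ultimately show ?thesis by blast
qed

theorem theorem1p3:
  fixes a :: "3 \<Rightarrow> cp1" and p :: cp1 and \<gamma> :: "3 \<Rightarrow> real \<Rightarrow> cp1"
    and \<rho> :: "(real \<Rightarrow> cp1) set \<Rightarrow> complex^2^2"
  assumes "inj a"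
    and "p \<notin> range a"
    and "standard_generators a p \<gamma>"
    and "\<rho> \<in> hom (fundamental_group (- range a) p) GL"
    and "reducible (fundamental_group (- range a) p) \<rho>"
    and "indecomposable (fundamental_group (- range a) p) \<rho>"
    and "\<exists>S::complex^2^2. invertible S \<and>
           (\<forall>i. upper_triangular (matrix_inv S ** \<rho> (loop_class (- range a) (\<gamma> i)) ** S)) \<and>
           (\<exists>i. diagonal (matrix_inv S ** \<rho> (loop_class (- range a) (\<gamma> i)) ** S))"
  shows "\<exists>b1 b2. riemann_equation (range a) b1 b2 \<and> realizes (range a) p b1 b2 \<rho>"
proof -
  define G where "G = fundamental_group (- range a) p"
  define c where "c i = loop_class (- range a) (\<gamma> i)" for i
  have sg: "\<And>i. \<gamma> i \<in> loops (- range a) p" "\<And>i. loop_around (range a) p (a i) (\<gamma> i)"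
    "generate G (range c) = carrier G" "c 1 \<otimes>\<^bsub>G\<^esub> c 2 \<otimes>\<^bsub>G\<^esub> c 3 = \<one>\<^bsub>G\<^esub>"
    using assms(3) unfolding standard_generators_def Let_def G_def c_def by auto
  have grp: "group G" unfolding G_def by (rule group_fundamental_group) (use assms(2) in simp)
  interpret group G by (rule grp)
  have carr: "c i \<in> carrier G" for i
    unfolding G_def c_def using sg(1)[of i] by (simp add: fundamental_group_def)
  \<comment> \<open>The cyclic rotations of the relation, one for each pair of generators that may
    take the role of the first two.\<close>
  have rel: "c 1 \<otimes>\<^bsub>G\<^esub> (c 2 \<otimes>\<^bsub>G\<^esub> c 3) = \<one>\<^bsub>G\<^esub>" "c 2 \<otimes>\<^bsub>G\<^esub> (c 3 \<otimes>\<^bsub>G\<^esub> c 1) = \<one>\<^bsub>G\<^esub>" "c 3 \<otimes>\<^bsub>G\<^esub> (c 1 \<otimes>\<^bsub>G\<^esub> c 2) = \<one>\<^bsub>G\<^esub>"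
  proof -
    show 1: "c 1 \<otimes>\<^bsub>G\<^esub> (c 2 \<otimes>\<^bsub>G\<^esub> c 3) = \<one>\<^bsub>G\<^esub>" using sg(4) carr by (simp add: m_assoc)
    have "(c 2 \<otimes>\<^bsub>G\<^esub> c 3) \<otimes>\<^bsub>G\<^esub> c 1 = \<one>\<^bsub>G\<^esub>" using inv_comm[OF 1] carr by simp
    then show 2: "c 2 \<otimes>\<^bsub>G\<^esub> (c 3 \<otimes>\<^bsub>G\<^esub> c 1) = \<one>\<^bsub>G\<^esub>" using carr by (simp add: m_assoc)
    show "c 3 \<otimes>\<^bsub>G\<^esub> (c 1 \<otimes>\<^bsub>G\<^esub> c 2) = \<one>\<^bsub>G\<^esub>" using inv_comm[OF sg(4)] carr by simp
  qed
  \<comment> \<open>The relation makes \<open>c k\<close> the inverse of the product of the other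
    two, so these already generate.\<close>
  have gen: "generate G {c i, c j} = carrier G"
    if r: "c k \<otimes>\<^bsub>G\<^esub> (c i \<otimes>\<^bsub>G\<^esub> c j) = \<one>\<^bsub>G\<^esub>" and ijk: "UNIV = {i, j, k}" for i j k
  proof
    have sub: "subgroup (generate G {c i, c j}) G" using carr by (intro generate_is_subgroup) auto
    show "generate G {c i, c j} \<subseteq> carrier G" using carr by (intro generate_incl) auto
    have ij: "c i \<in> generate G {c i, c j}" "c j \<in> generate G {c i, c j}" by (auto intro: generate.incl)
    have "c k = inv\<^bsub>G\<^esub> (c i \<otimes>\<^bsub>G\<^esub> c j)" using inv_equality[OF r] carr by simp
    then have "c k \<in> generate G {c i, c j}"
      using ij subgroup.m_closed[OF sub] subgroup.m_inv_closed[OF sub] by simp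
    moreover have "range c = {c i, c j, c k}" unfolding ijk by auto
    ultimately have "range c \<subseteq> generate G {c i, c j}" using ij by auto
    then show "carrier G \<subseteq> generate G {c i, c j}"
      using generate_subgroup_incl[OF _ sub] sg(3) by blast
  qed
  obtain S :: "complex^2^2" where S: "invertible S"
    and ut: "\<And>i. upper_triangular (matrix_inv S ** \<rho> (c i) ** S)"
    and dg: "\<exists>i. diagonal (matrix_inv S ** \<rho> (c i) ** S)"
    using assms(7) unfolding c_def by blast
  define H where "H i = matrix_inv S ** \<rho> (c i) ** S" for i
  have h21: "ent (H i) 2 1 = 0" for i using ut[of i] by (simp add: upper_triangular_def H_def)
  have realized: ?thesis
    if r: "c k \<otimes>\<^bsub>G\<^esub> (c i \<otimes>\<^bsub>G\<^esub> c j) = \<one>\<^bsub>G\<^esub>" and ijk: "UNIV = {i, j, k}" "i \<noteq> j" "j \<noteq> k" "i \<noteq> k"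
      and cs: "ent (H i) 1 1 \<noteq> ent (H i) 2 2 \<and> ent (H j) 1 1 \<noteq> ent (H j) 2 2 \<or>
        ent (H i) 1 1 = ent (H i) 2 2 \<and> ent (H j) 1 1 = ent (H j) 2 2 \<and> ent (H j) 1 2 = 0" for i j k
  proof -
    have ra: "range a = {a i, a j, a k}" unfolding ijk(1) by auto
    have "a i \<noteq> a j" "a j \<noteq> a k" "a i \<noteq> a k" using assms(1) ijk by (auto dest: injD)
    from two_generators_realized[of "a i" "a j" "a k" p "\<gamma> i" "\<gamma> j" \<rho> S, folded ra, folded G_def c_def, folded H_def,
        OF this assms(2) sg(1) sg(2) sg(1) sg(2) gen[OF r ijk(1)] _ _ S _ _ cs]
    show ?thesis using assms(4,6) ut unfolding G_def[symmetric] H_def by blast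
  qed
  note hom = GL_hom_facts[OF grp assms(4)[folded G_def]]
  have "H 1 ** H 2 ** H 3 = mat 1"
  proof -
    have "H 1 ** H 2 ** H 3 = matrix_inv S ** (\<rho> (c 1) ** (S ** matrix_inv S) ** \<rho> (c 2) ** (S ** matrix_inv S) ** \<rho> (c 3)) ** S"
      unfolding H_def by (simp only: matrix_mul_assoc)
    also have "\<dots> = matrix_inv S ** \<rho> (c 1 \<otimes>\<^bsub>G\<^esub> c 2 \<otimes>\<^bsub>G\<^esub> c 3) ** S"
      using carr by (simp add: matrix_inv_cancel[OF S] hom(1))
    also have "\<dots> = mat 1" unfolding sg(4) hom(2) by (simp add: matrix_inv_cancel[OF S])
    finally show ?thesis .
  qed
  then have "ent (H 1 ** H 2 ** H 3) 1 1 = 1" "ent (H 1 ** H 2 ** H 3) 2 2 = 1" by (simp_all add: mat_def)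
  then have prod: "ent (H 1) 1 1 * ent (H 2) 1 1 * ent (H 3) 1 1 = 1" "ent (H 1) 2 2 * ent (H 2) 2 2 * ent (H 3) 2 2 = 1"
    by (simp_all add: matrix_matrix_mult_def sum_2 h21)
  have U: "UNIV = {1, 2, 3 :: 3}" "UNIV = {2, 3, 1 :: 3}" "UNIV = {3, 1, 2 :: 3}" using UNIV_3 by auto
  have ne: "(1::3) \<noteq> 2" "(2::3) \<noteq> 3" "(1::3) \<noteq> 3" by simp_all
  define \<delta> where "\<delta> i \<longleftrightarrow> ent (H i) 1 1 = ent (H i) 2 2" for i
  \<comment> \<open>Both products of diagonal entries over the three points are 1. A double
    eigenvalue at two points therefore forces one at the third, and it cannot happen that exactly
    one generator has distinct eigenvalues.\<close>
  have two: "\<delta> 1" "\<delta> 2" "\<delta> 3" if "\<delta> 1 \<and> \<delta> 2 \<or> \<delta> 2 \<and> \<delta> 3 \<or> \<delta> 3 \<and> \<delta> 1"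
  proof -
    have canc: "x = y" if "u * x = (1::complex)" "u * y = 1" for u x y
      using that by (metis mult_cancel_left zero_neq_one mult_zero_left)
    have "\<delta> 1 \<and> \<delta> 2 \<and> \<delta> 3"
      using \<open>\<delta> 1 \<and> \<delta> 2 \<or> \<delta> 2 \<and> \<delta> 3 \<or> \<delta> 3 \<and> \<delta> 1\<close>
    proof (elim disjE conjE)
      assume "\<delta> 1" "\<delta> 2"
      then show ?thesis using prod canc[of "ent (H 1) 1 1 * ent (H 2) 1 1"] unfolding \<delta>_def by (simp add: mult_ac)
    next
      assume "\<delta> 2" "\<delta> 3"
      then show ?thesis using prod canc[of "ent (H 2) 1 1 * ent (H 3) 1 1"] unfolding \<delta>_def by (simp add: mult_ac)
    next
      assume "\<delta> 3" "\<delta> 1"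
      then show ?thesis using prod canc[of "ent (H 3) 1 1 * ent (H 1) 1 1"] unfolding \<delta>_def by (simp add: mult_ac)
    qed
    then show "\<delta> 1" "\<delta> 2" "\<delta> 3" by auto
  qed
  consider "\<not> \<delta> 1 \<and> \<not> \<delta> 2" | "\<not> \<delta> 2 \<and> \<not> \<delta> 3" | "\<not> \<delta> 3 \<and> \<not> \<delta> 1" | "\<delta> 1 \<and> \<delta> 2 \<and> \<delta> 3"
    using two by blast
  then show ?thesis
  proof cases
    case 1
    then show ?thesis using realized[OF rel(3) U(1)] ne unfolding \<delta>_def by simp
  next
    case 2
    then show ?thesis using realized[OF rel(1) U(2)] ne unfolding \<delta>_def by simp
  next
    case 3
    then show ?thesis using realized[OF rel(2) U(3)] ne unfolding \<delta>_def by simp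
  next
    case 4
    \<comment> \<open>A diagonal matrix with a double eigenvalue is scalar. The rotation is chosen
      so that its index \<open>i\<close> is the second of the pair, where \<open>realized\<close>
      asks for a zero off-diagonal entry.\<close>
    obtain i where "ent (H i) 1 2 = 0" using dg unfolding H_def diagonal_def by blast
    moreover have "i = 1 \<or> i = 2 \<or> i = 3" using U(1) by blast
    ultimately show ?thesis
      using 4 realized[OF rel(3) U(1)] realized[OF rel(1) U(2)] realized[OF rel(2) U(3)] ne
      unfolding \<delta>_def by auto
  qed
qed

end
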